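(* Let $K\subset\mathbb{R}^2$ be compact and nonpolar, and $V:=JR_Y(-1)J^*-R(-1)$. For each $s>0$, $V$ extends to a bounded operator from $\mathscr{H}_{-s}$ to $\mathscr{H}_s$, and this extension is compact and self-adjoint (i.e. $\langle\cdot\rangle^sV\langle\cdot\rangle^s$ extends to a compact self-adjoint operator on $L^2(\mathbb{R}^2)$).
   Context: $H=-\Delta$ on $L^2(\mathbb{R}^2)$, $R(\zeta)=(H-\zeta)^{-1}$; $Y=\mathbb{R}^2\setminus K$, $H_Y$ the non-negative Dirichlet Laplacian on $L^2(Y)$, $R_Y(\zeta)=(H_Y-\zeta)^{-1}$, $J$ extension by zero from $L^2(Y)$ to $L^2(\mathbb{R}^2)$. $\langle x\rangle=(1+|x|^2)^{1/2}$, $\mathscr{H}_s=\{u:\langle\cdot\rangle^su\in L^2(\mathbb{R}^2)\}$. *)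

theory Defs
  imports "HOL-Analysis.Analysis"
begin

type_synonym pt = "real^2"
type_synonym fn = "pt \<Rightarrow> complex"

section \<open>L^2(R^2) (complex valued, functions modulo a.e. handled via norms)\<close>

definition L2 :: "fn \<Rightarrow> bool" where
  "L2 f \<longleftrightarrow> f \<in> borel_measurable lborel \<and> integrable lborel (\<lambda>x. (norm (f x))\<^sup>2)"

definition l2norm :: "fn \<Rightarrow> real" where
  "l2norm f = sqrt (integral\<^sup>L lborel (\<lambda>x. (norm (f x))\<^sup>2))"

definition l2inner :: "fn \<Rightarrow> fn \<Rightarrow> complex" where
  "l2inner f g = integral\<^sup>L lborel (\<lambda>x. f x * cnj (g x))"

definition pd :: "pt \<Rightarrow> fn \<Rightarrow> fn" where
  "pd v f = (\<lambda>x. frechet_derivative f (at x) v)"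

fun Dl :: "pt list \<Rightarrow> fn \<Rightarrow> fn" where
  "Dl [] f = f"
| "Dl (v # vs) f = pd v (Dl vs f)"

definition smooth :: "fn \<Rightarrow> bool" where
  "smooth f \<longleftrightarrow> (\<forall>vs x. Dl vs f differentiable (at x))"

definition test_fn :: "pt set \<Rightarrow> fn \<Rightarrow> bool" where
  "test_fn U f \<longleftrightarrow> smooth f \<and> compact (closure {x. f x \<noteq> 0}) \<and> closure {x. f x \<noteq> 0} \<subseteq> U"

definition weak_partial :: "pt \<Rightarrow> fn \<Rightarrow> fn \<Rightarrow> bool" where
  "weak_partial e u g \<longleftrightarrow>
     (\<forall>\<phi>. test_fn UNIV \<phi> \<longrightarrow>
        integral\<^sup>L lborel (\<lambda>x. u x * pd e \<phi> x) = - integral\<^sup>L lborel (\<lambda>x. g x * \<phi> x))"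

definition H1 :: "fn \<Rightarrow> bool" where
  "H1 u \<longleftrightarrow> L2 u \<and> (\<forall>e\<in>(Basis :: pt set). \<exists>g. L2 g \<and> weak_partial e u g)"

definition wgrad :: "pt \<Rightarrow> fn \<Rightarrow> fn" where
  "wgrad e u = (SOME g. L2 g \<and> weak_partial e u g)"

definition h1norm :: "fn \<Rightarrow> real" where
  "h1norm u = sqrt ((l2norm u)\<^sup>2 + (\<Sum>e\<in>(Basis :: pt set). (l2norm (wgrad e u))\<^sup>2))"

text \<open>H^1_0(Y): closure of C_c^infty(Y) in H^1, functions extended by zero to R^2.\<close>
definition H10 :: "pt set \<Rightarrow> fn \<Rightarrow> bool" where
  "H10 Y u \<longleftrightarrow> H1 u \<and>
     (\<exists>\<phi>. (\<forall>n. test_fn Y (\<phi> n)) \<and> (\<lambda>n. h1norm (\<lambda>x. u x - \<phi> n x)) \<longlonglongrightarrow> 0)"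

definition form1 :: "fn \<Rightarrow> fn \<Rightarrow> complex" where
  "form1 u v = l2inner u v + (\<Sum>e\<in>(Basis :: pt set). l2inner (wgrad e u) (wgrad e v))"

text \<open>R(-1) f: the unique u in the form domain H^1 of H = -Delta with
  form1 u v = <f,v> for all v in H^1.\<close>
definition Rfree :: "fn \<Rightarrow> fn" where
  "Rfree f = (SOME u. H1 u \<and> (\<forall>v. H1 v \<longrightarrow> form1 u v = l2inner f v))"

text \<open>J R_Y(-1) J^* f: the unique u in H^1_0(Y) (the form domain of the Dirichlet
  Laplacian H_Y), extended by zero, with form1 u v = <J^* f, v>_{L^2(Y)} for all v in H^1_0(Y).\<close>
definition RDir :: "pt set \<Rightarrow> fn \<Rightarrow> fn" where
  "RDir Y f = (SOME u. H10 Y u \<and>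
      (\<forall>v. H10 Y v \<longrightarrow> form1 u v = integral\<^sup>L lborel (\<lambda>x. indicator Y x * f x * cnj (v x))))"

definition Vop :: "pt set \<Rightarrow> fn \<Rightarrow> fn" where
  "Vop K f = (\<lambda>x. RDir (- K) f x - Rfree f x)"

definition jb :: "real \<Rightarrow> pt \<Rightarrow> real" where
  "jb s x = (1 + (norm x)\<^sup>2) powr (s / 2)"

text \<open>A compact set K is polar iff every nonzero finite Borel measure supported on K
  has logarithmic energy I(mu) = \<integral>\<integral> log|z-w| d mu d mu = -infinity. Since log|z-w| is
  bounded above on K x K, this is equivalent to the integral of the negative part
  (with value +infinity on the diagonal) being infinite.\<close>
definition log_kernel_neg :: "pt \<Rightarrow> pt \<Rightarrow> ennreal" where
  "log_kernel_neg z w = (if z = w then \<infinity> else ennreal (max 0 (- ln (dist z w))))"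

definition polar :: "pt set \<Rightarrow> bool" where
  "polar K \<longleftrightarrow> (\<forall>\<mu> :: pt measure.
      sets \<mu> = sets borel \<longrightarrow> finite_measure \<mu> \<longrightarrow> emeasure \<mu> (space \<mu>) \<noteq> 0 \<longrightarrow>
      emeasure \<mu> (- K) = 0 \<longrightarrow>
      (\<integral>\<^sup>+ p. log_kernel_neg (fst p) (snd p) \<partial>(\<mu> \<Otimes>\<^sub>M \<mu>)) = \<infinity>)"

end

theory Submission
  imports Defs "HOL-Complex_Analysis.Great_Picard"
begin

text \<open>
  Write \<open>a\<close> for the \<open>H\<^sup>1\<close> form, \<open>w = R(-1) f\<close> and \<open>u = J R\<^sub>Y(-1) J\<^sup>* f\<close>. Then \<open>V f = u - w\<close> is
  \<open>a\<close>-orthogonal to \<open>H\<^sup>1\<^sub>0(Y)\<close>, so \<open>\<langle>V f, g\<rangle> = - a(V f, V g)\<close>, which is symmetric. Moreover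
  \<open>- V f\<close> is the component of \<open>w\<close> orthogonal to \<open>H\<^sup>1\<^sub>0(Y)\<close>, and \<open>(1 - \<chi>) w\<close> lies in \<open>H\<^sup>1\<^sub>0(Y)\<close> for a
  cutoff \<open>\<chi>\<close> that is \<open>1\<close> near \<open>K\<close>; hence the \<open>H\<^sup>1\<close> norm of \<open>V f\<close> is at most that of \<open>\<chi> w\<close>.

  Testing the equation of \<open>w\<close> with \<open>\<eta>\<^sup>2 w\<close>, where \<open>\<eta>\<close> is a slowly varying polynomially decaying weight,
  bounds \<open>w\<close> on bounded sets by the norm of \<open>f\<close> in \<open>H\<^sub>-\<^sub>s\<close>; testing with \<open>\<chi>\<^sup>2 w\<close> then bounds \<open>\<chi> w\<close> in
  \<open>H\<^sup>1\<close> by the local \<open>L\<^sup>2\<close> norms of \<open>f\<close> and \<open>w\<close>. By duality the norm of \<open>V f\<close> in \<open>H\<^sub>s\<close> is controlled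
  by the \<open>H\<^sup>1\<close> norm of \<open>\<chi> w\<close>, which gives boundedness, and compactness by Rellich's theorem.

  That test functions are dense in \<open>H\<^sup>1(\<real>\<^sup>2)\<close> is shown without mollifier limits: if \<open>v\<close> is
  \<open>a\<close>-orthogonal to all test functions, its correlation with any real test function solves
  \<open>\<Delta> U = U\<close> and vanishes at infinity, so \<open>U = 0\<close> by the maximum principle.
\<close>

text \<open>The duality step: since <V f, h> = - a(V f, V h), pairing V f with h = <x>^(2s) V f,
  truncated to a ball, bounds the weighted norm by a product of two H^1 norms, both of which are
  controlled near K.

  Compactness rests on keeping the energy estimate quadratic: the squared H^1 norm of chi w is at
  most a constant times the norm of the data times the local L^2 norm of w. Rellich yields local L^2
  convergence of w only, but that single factor already forces the H^1 norms of differences to zero.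

  Density of test functions enters twice: a free solution cut off away from K must be an H^1 limit
  of test functions supported off K, and the translation estimate behind Rellich is first proved for
  test functions.

  The spaces consist of actual functions and the resolvents are Hilbert choices, hence linear only
  up to null sets. Estimates are therefore stated for arbitrary weak solutions, a class that is
  stable under differences.\<close>

section \<open>Smooth functions\<close>

text \<open>Counting derivatives turns closure of \<open>smooth\<close> under sums, products and
  reciprocals into inductions: a derivative of such an expression is again built from sums and
  products, one order lower.\<close>

definition Cn :: "nat \<Rightarrow> fn \<Rightarrow> bool" where
  "Cn n f \<longleftrightarrow> (\<forall>vs x. length vs \<le> n \<longrightarrow> Dl vs f differentiable (at x))"

lemma smooth_iff_Cn: "smooth f \<longleftrightarrow> (\<forall>n. Cn n f)"
  unfolding smooth_def Cn_def by blast

lemma Dl_append: "Dl (vs @ ws) f = Dl vs (Dl ws f)"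
  by (induction vs) auto

lemma Cn_0: "Cn 0 f \<longleftrightarrow> (\<forall>x. f differentiable (at x))"
  by (auto simp: Cn_def)

text \<open>\<open>Dl\<close> applies the last entry of its list first, so the derivative taken
  first is split off at the end of the list.\<close>

lemma Cn_Suc: "Cn (Suc n) f \<longleftrightarrow> (\<forall>x. f differentiable (at x)) \<and> (\<forall>v. Cn n (pd v f))"
proof safe
  assume *: "Cn (Suc n) f"
  show "f differentiable (at x)" for x
    using *[unfolded Cn_def, rule_format, of "[]" x] by simp
  show "Cn n (pd v f)" for v
    unfolding Cn_def
  proof safe
    fix vs :: "pt list" and x assume "length vs \<le> n"
    then show "Dl vs (pd v f) differentiable (at x)"
      using *[unfolded Cn_def, rule_format, of "vs @ [v]" x] by (simp add: Dl_append)
  qed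
next
  assume d: "\<forall>x. f differentiable (at x)" and *: "\<forall>v. Cn n (pd v f)"
  show "Cn (Suc n) f"
    unfolding Cn_def
  proof safe
    fix vs :: "pt list" and x assume "length vs \<le> Suc n"
    then show "Dl vs f differentiable (at x)"
      using d *[unfolded Cn_def, rule_format, of "butlast vs" "last vs" x]
      by (cases vs rule: rev_cases) (auto simp: Dl_append)
  qed
qed

lemma Cn_SucD: "Cn (Suc n) f \<Longrightarrow> Cn n f"
  unfolding Cn_def by auto

lemma Cn_differentiable: "Cn n f \<Longrightarrow> f differentiable (at x)"
  by (cases n) (auto simp: Cn_0 Cn_Suc)

lemma pd_eqI: "(f has_derivative f') (at x) \<Longrightarrow> pd v f x = f' v"
  unfolding pd_def using frechet_derivative_at by metis

lemma has_derivative_pd: "f differentiable (at x) \<Longrightarrow> (f has_derivative (\<lambda>v. pd v f x)) (at x)"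
  unfolding pd_def using iffD1[OF frechet_derivative_works] by blast

lemma pd_const [simp]: "pd v (\<lambda>x. c) = (\<lambda>x. 0)"
  by (auto simp: pd_def)

lemma pd_add:
  assumes "f differentiable (at x)" "g differentiable (at x)"
  shows "pd v (\<lambda>x. f x + g x) x = pd v f x + pd v g x"
  by (rule pd_eqI) (intro has_derivative_add has_derivative_pd assms)

lemma pd_mult:
  assumes "f differentiable (at x)" "g differentiable (at x)"
  shows "pd v (\<lambda>x. f x * g x) x = f x * pd v g x + pd v f x * g x"
  by (rule pd_eqI) (intro has_derivative_mult has_derivative_pd assms)

lemma pd_inverse:
  assumes "f differentiable (at x)" "f x \<noteq> 0"
  shows "pd v (\<lambda>x. inverse (f x)) x = - (pd v f x * (inverse (f x) * inverse (f x)))"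
proof -
  have "pd v (\<lambda>x. inverse (f x)) x = - (inverse (f x) * pd v f x * inverse (f x))"
    by (rule pd_eqI) (intro Deriv.has_derivative_inverse has_derivative_pd assms)
  then show ?thesis by (simp add: mult_ac)
qed

lemma Cn_const: "Cn n (\<lambda>x. c)"
proof (induction n arbitrary: c)
  case 0 then show ?case by (simp add: Cn_0)
next
  case (Suc n) then show ?case by (simp add: Cn_Suc)
qed

lemma Cn_add: "Cn n f \<Longrightarrow> Cn n g \<Longrightarrow> Cn n (\<lambda>x. f x + g x)"
proof (induction n arbitrary: f g)
  case 0 then show ?case by (simp add: Cn_0)
next
  case (Suc n)
  have "pd v (\<lambda>x. f x + g x) = (\<lambda>x. pd v f x + pd v g x)" for v
    using Suc.prems by (auto simp: Cn_Suc pd_add)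
  then show ?case using Suc by (simp add: Cn_Suc)
qed

lemma Cn_mult: "Cn n f \<Longrightarrow> Cn n g \<Longrightarrow> Cn n (\<lambda>x. f x * g x)"
proof (induction n arbitrary: f g)
  case 0 then show ?case by (simp add: Cn_0)
next
  case (Suc n)
  have "pd v (\<lambda>x. f x * g x) = (\<lambda>x. f x * pd v g x + pd v f x * g x)" for v
    using Suc.prems by (auto simp: Cn_Suc pd_mult)
  moreover have "Cn n (\<lambda>x. f x * pd v g x + pd v f x * g x)" for v
    using Suc.prems by (intro Cn_add Suc.IH Cn_SucD[OF Suc.prems(1)] Cn_SucD[OF Suc.prems(2)]) (auto simp: Cn_Suc)
  moreover have "(\<lambda>x. f x * g x) differentiable (at x)" for x
    using Suc.prems by (auto simp: Cn_Suc)
  ultimately show ?case by (simp add: Cn_Suc)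
qed

lemma Cn_uminus: "Cn n f \<Longrightarrow> Cn n (\<lambda>x. - f x)"
  using Cn_mult[OF Cn_const[of n "-1"], of f] by simp

lemma Cn_inverse: "Cn n f \<Longrightarrow> (\<And>x. f x \<noteq> 0) \<Longrightarrow> Cn n (\<lambda>x. inverse (f x))"
proof (induction n arbitrary: f)
  case 0 then show ?case by (simp add: Cn_0 differentiable_inverse)
next
  case (Suc n)
  have d: "f differentiable (at x)" for x using Suc.prems by (simp add: Cn_Suc)
  have "pd v (\<lambda>x. inverse (f x)) = (\<lambda>x. - (pd v f x * (inverse (f x) * inverse (f x))))" for v
    using Suc.prems(2) d pd_inverse by blast
  moreover have "Cn n (\<lambda>x. - (pd v f x * (inverse (f x) * inverse (f x))))" for v
    using Suc.prems by (intro Cn_uminus Cn_mult Suc.IH Cn_SucD[OF Suc.prems(1)]) (auto simp: Cn_Suc)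
  ultimately show ?case using Suc.prems d by (simp add: Cn_Suc differentiable_inverse)
qed

lemma differentiable_of_real_iff:
  fixes q :: "pt \<Rightarrow> real"
  shows "(\<lambda>x. complex_of_real (q x)) differentiable (at x) \<longleftrightarrow> q differentiable (at x)"
proof
  assume "(\<lambda>x. complex_of_real (q x)) differentiable (at x)"
  then obtain D where "((\<lambda>x. complex_of_real (q x)) has_derivative D) (at x)"
    by (auto simp: differentiable_def)
  from bounded_linear.has_derivative[OF bounded_linear_Re this]
  show "q differentiable (at x)" by (auto simp: differentiable_def)
next
  assume "q differentiable (at x)"
  then obtain D where "(q has_derivative D) (at x)"
    by (auto simp: differentiable_def)
  from bounded_linear.has_derivative[OF bounded_linear_of_real this]
  show "(\<lambda>x. complex_of_real (q x)) differentiable (at x)" unfolding differentiable_def by blast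
qed

lemma pd_compose_of_real:
  assumes k: "\<And>t. (k has_real_derivative k' t) (at t)"
    and q: "(\<lambda>x. complex_of_real (q x)) differentiable (at x)"
  shows "(\<lambda>x. complex_of_real (k (q x))) differentiable (at x)"
    and "pd v (\<lambda>x. complex_of_real (k (q x))) x =
      complex_of_real (k' (q x)) * pd v (\<lambda>x. complex_of_real (q x)) x"
proof -
  have "q differentiable (at x)" using q by (simp only: differentiable_of_real_iff)
  then obtain D where D: "(q has_derivative D) (at x)"
    by (auto simp: differentiable_def)
  have 1: "((\<lambda>x. k (q x)) has_derivative (\<lambda>v. k' (q x) * D v)) (at x)"
    using has_derivative_compose[OF D, of k "(*) (k' (q x))"] k[of "q x"]
    by (simp add: has_field_derivative_def)
  have 2: "((\<lambda>x. complex_of_real (k (q x))) has_derivative (\<lambda>v. complex_of_real (k' (q x) * D v))) (at x)"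
    by (rule bounded_linear.has_derivative[OF bounded_linear_of_real 1])
  have 3: "((\<lambda>x. complex_of_real (q x)) has_derivative (\<lambda>v. complex_of_real (D v))) (at x)"
    by (rule bounded_linear.has_derivative[OF bounded_linear_of_real D])
  show "(\<lambda>x. complex_of_real (k (q x))) differentiable (at x)"
    using 2 unfolding differentiable_def by blast
  show "pd v (\<lambda>x. complex_of_real (k (q x))) x =
      complex_of_real (k' (q x)) * pd v (\<lambda>x. complex_of_real (q x)) x"
    by (simp add: pd_eqI[OF 2] pd_eqI[OF 3])
qed

text \<open>All successive derivatives of the outer function are supplied as a sequence because
  differentiating \<open>k m\<close> after \<open>q\<close> produces \<open>k (Suc m)\<close>; the
  induction on \<open>n\<close> is therefore uniform in \<open>m\<close>.\<close>

lemma Cn_compose_of_real: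
  assumes k: "\<And>m t. (k m has_real_derivative k (Suc m) t) (at t)"
  shows "Cn n (\<lambda>x. complex_of_real (q x)) \<Longrightarrow> Cn n (\<lambda>x. complex_of_real (k m (q x)))"
proof (induction n arbitrary: m)
  case 0 then show ?case using pd_compose_of_real(1)[OF k] by (simp add: Cn_0)
next
  case (Suc n)
  have d: "(\<lambda>x. complex_of_real (q x)) differentiable (at x)" for x
    using Suc.prems by (simp add: Cn_Suc)
  have "pd v (\<lambda>x. complex_of_real (k m (q x))) =
     (\<lambda>x. complex_of_real (k (Suc m) (q x)) * pd v (\<lambda>x. complex_of_real (q x)) x)" for v
    using pd_compose_of_real(2)[OF k d] by auto
  then show ?case
    using Suc.prems pd_compose_of_real(1)[OF k d]
    by (auto simp: Cn_Suc intro!: Cn_mult Suc.IH Cn_SucD[OF Suc.prems])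
qed

lemma smooth_const: "smooth (\<lambda>x. c)"
  and smooth_add: "smooth f \<Longrightarrow> smooth g \<Longrightarrow> smooth (\<lambda>x. f x + g x)"
  and smooth_mult: "smooth f \<Longrightarrow> smooth g \<Longrightarrow> smooth (\<lambda>x. f x * g x)"
  and smooth_uminus: "smooth f \<Longrightarrow> smooth (\<lambda>x. - f x)"
  and smooth_inverse: "smooth f \<Longrightarrow> (\<And>x. f x \<noteq> 0) \<Longrightarrow> smooth (\<lambda>x. inverse (f x))"
  by (auto simp: smooth_iff_Cn intro!: Cn_const Cn_add Cn_mult Cn_inverse Cn_uminus)

lemma smooth_diff: "smooth f \<Longrightarrow> smooth g \<Longrightarrow> smooth (\<lambda>x. f x - g x)"
  using smooth_add[OF _ smooth_uminus, of f g] by simp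

lemma smooth_power: "smooth f \<Longrightarrow> smooth (\<lambda>x. f x ^ n)"
  by (induction n) (auto intro!: smooth_const smooth_mult)

lemma smooth_sum: "(\<And>i. i \<in> I \<Longrightarrow> smooth (f i)) \<Longrightarrow> smooth (\<lambda>x. \<Sum>i\<in>I. f i x)"
  by (induction I rule: infinite_finite_induct) (auto intro!: smooth_const smooth_add)

lemma smooth_prod: "(\<And>i. i \<in> I \<Longrightarrow> smooth (f i)) \<Longrightarrow> smooth (\<lambda>x. \<Prod>i\<in>I. f i x)"
  by (induction I rule: infinite_finite_induct) (auto intro!: smooth_const smooth_mult)

lemma smooth_compose_of_real:
  assumes "\<And>m t. (k m has_real_derivative k (Suc m) t) (at t)"
    and "smooth (\<lambda>x. complex_of_real (q x))"
  shows "smooth (\<lambda>x. complex_of_real (k m (q x)))"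
  using assms Cn_compose_of_real unfolding smooth_iff_Cn by blast

lemma smooth_differentiable: "smooth f \<Longrightarrow> f differentiable (at x)"
  by (auto simp: smooth_iff_Cn intro: Cn_differentiable)

lemma smooth_pd: "smooth f \<Longrightarrow> smooth (pd v f)"
  by (auto simp: smooth_iff_Cn) (meson Cn_Suc)

lemma smooth_continuous_on: "smooth f \<Longrightarrow> continuous_on A f"
  by (meson smooth_differentiable continuous_at_imp_continuous_on differentiable_imp_continuous_within)

lemma smooth_bounded_linear:
  assumes "bounded_linear (l :: pt \<Rightarrow> real)"
  shows "smooth (\<lambda>x. complex_of_real (l x))"
proof -
  have 1: "((\<lambda>x. complex_of_real (l x)) has_derivative (\<lambda>v. complex_of_real (l v))) (at x)" for x
    by (rule bounded_linear.has_derivative[OF bounded_linear_of_real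
          bounded_linear.has_derivative[OF assms has_derivative_ident]])
  have "Cn n (\<lambda>x. complex_of_real (l x))" for n
  proof (cases n)
    case 0 show ?thesis using 1 unfolding 0 Cn_0 differentiable_def by blast
  next
    case (Suc k)
    have "pd v (\<lambda>x. complex_of_real (l x)) = (\<lambda>x. complex_of_real (l v))" for v
      using pd_eqI[OF 1] by auto
    then show ?thesis using 1 unfolding Suc Cn_Suc by (auto simp: Cn_const differentiable_def)
  qed
  then show ?thesis by (simp add: smooth_iff_Cn)
qed

lemma cnj_pd:
  assumes f: "smooth f" and real: "\<And>x. cnj (f x) = f x"
  shows "cnj (pd e f x) = pd e f x"
proof -
  have "((\<lambda>x. cnj (f x)) has_derivative (\<lambda>v. cnj (pd v f x))) (at x)"
    by (intro bounded_linear.has_derivative[OF bounded_linear_cnj] has_derivative_pd smooth_differentiable f)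
  then have "pd e f x = cnj (pd e f x)" unfolding real by (rule pd_eqI)
  then show ?thesis by simp
qed

lemma pd_translate:
  assumes "smooth f"
  shows "pd v (\<lambda>x. f (x + c)) = (\<lambda>x. pd v f (x + c))"
proof
  fix x
  have 1: "((\<lambda>x. x + c) has_derivative (\<lambda>v. v)) (at x)"
    by (auto intro!: derivative_eq_intros)
  have 2: "(f has_derivative (\<lambda>v. pd v f (x + c))) (at (x + c))"
    using assms by (intro has_derivative_pd smooth_differentiable)
  show "pd v (\<lambda>x. f (x + c)) x = pd v f (x + c)"
    by (rule pd_eqI) (use has_derivative_compose[OF 1 2] in simp)
qed

lemma smooth_translate: "smooth f \<Longrightarrow> smooth (\<lambda>x. f (x + c))"
proof -
  have "Cn n (\<lambda>x. f (x + c))" if "smooth f" for n f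
    using that
  proof (induction n arbitrary: f)
    case 0
    have "(\<lambda>x. f (x + c)) differentiable (at x)" for x
    proof -
      have "(\<lambda>x. x + c) differentiable (at x)" by simp
      from differentiable_chain_at[OF this smooth_differentiable[OF 0]]
      show ?thesis by (simp add: o_def)
    qed
    then show ?case by (simp add: Cn_0)
  next
    case (Suc n)
    have "Cn n (pd v (\<lambda>x. f (x + c)))" for v
      unfolding pd_translate[OF Suc.prems] by (rule Suc.IH[OF smooth_pd[OF Suc.prems]])
    moreover have "(\<lambda>x. f (x + c)) differentiable (at x)" for x
      using Suc.IH[OF Suc.prems] Cn_differentiable by blast
    ultimately show ?case by (simp add: Cn_Suc)
  qed
  then show "smooth f \<Longrightarrow> ?thesis" by (simp add: smooth_iff_Cn)
qed

lemma pd_Basis_sum: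
  assumes "f differentiable (at x)"
  shows "pd v f x = (\<Sum>e\<in>Basis. (v \<bullet> e) *\<^sub>R pd e f x)"
proof -
  have l: "linear (\<lambda>v. pd v f x)"
    using has_derivative_pd[OF assms] by (rule has_derivative_linear)
  have "pd v f x = pd (\<Sum>e\<in>Basis. (v \<bullet> e) *\<^sub>R e) f x"
    by (simp add: euclidean_representation)
  also have "\<dots> = (\<Sum>e\<in>Basis. (v \<bullet> e) *\<^sub>R pd e f x)"
    by (subst linear_sum[OF l], subst linear_scale[OF l]) simp
  finally show ?thesis .
qed

section \<open>Bump functions\<close>

text \<open>These functions are closed under differentiation: with s = 1/t, the derivative of p(s)
  exp(-s) in t is s^2 (p - p')(s) exp(-s), and \<open>[:0, 0, 1:]\<close> is the polynomial s^2. The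
  case p = 1 is \<open>bump\<close>, which is thereby smooth across 0.\<close>

definition hpoly :: "real poly \<Rightarrow> real \<Rightarrow> real" where
  "hpoly p t = (if t > 0 then poly p (inverse t) * exp (- inverse t) else 0)"

lemma poly_times_exp_tendsto_0: "((\<lambda>s. poly p s * exp (- s)) \<longlongrightarrow> (0::real)) at_top"
proof -
  have "((\<lambda>s. \<Sum>i\<le>degree p. coeff p i * (s ^ i / exp s)) \<longlongrightarrow> (\<Sum>i\<le>degree p. coeff p i * 0)) at_top"
    by (intro tendsto_sum tendsto_mult tendsto_const tendsto_power_div_exp_0)
  moreover have "(\<lambda>s. \<Sum>i\<le>degree p. coeff p i * (s ^ i / exp s)) = (\<lambda>s. poly p s * exp (- s))"
    by (auto simp: poly_altdef exp_minus divide_inverse sum_distrib_right mult.assoc)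
  ultimately show ?thesis by simp
qed

lemma hpoly_has_derivative:
  "(hpoly p has_real_derivative hpoly ((p - pderiv p) * [:0, 0, 1:]) t) (at t)"
proof -
  consider "t < 0" | "t > 0" | "t = 0" by linarith
  then show ?thesis
  proof cases
    case 1
    have "(hpoly p has_real_derivative 0) (at t)"
      by (rule has_field_derivative_transform_within_open[of "\<lambda>_. 0" _ _ "{..<0}"])
        (use 1 in \<open>auto simp: hpoly_def\<close>)
    then show ?thesis using 1 by (simp add: hpoly_def)
  next
    case 2
    have "((\<lambda>t. poly p (inverse t) * exp (- inverse t)) has_real_derivative
        hpoly ((p - pderiv p) * [:0, 0, 1:]) t) (at t)"
      using 2 by (auto intro!: derivative_eq_intros simp: hpoly_def algebra_simps power2_eq_square)
    then show ?thesis
      by (rule has_field_derivative_transform_within_open[where S="{0<..}"])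
        (use 2 in \<open>auto simp: hpoly_def\<close>)
  next
    case 3
    have "((\<lambda>y. hpoly p y / y) \<longlongrightarrow> 0) (at_right 0)"
    proof -
      \<comment> \<open>From the right, the difference quotient at 0 is s p(s) exp(-s) with s = 1/y,
        again a polynomial times a decaying exponential.\<close>
      have "((\<lambda>y. poly ([:0, 1:] * p) (inverse y) * exp (- inverse y)) \<longlongrightarrow> 0) (at_right 0)"
        by (rule filterlim_compose[OF poly_times_exp_tendsto_0 filterlim_inverse_at_top_right])
      then show ?thesis
        by (rule tendsto_cong[THEN iffD1, rotated])
          (auto simp: hpoly_def divide_inverse mult_ac eventually_at_filter)
    qed
    moreover have "((\<lambda>y. hpoly p y / y) \<longlongrightarrow> 0) (at_left 0)"
      by (rule tendsto_eventually) (auto simp: hpoly_def eventually_at_filter)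
    ultimately have "((\<lambda>y. hpoly p y / y) \<longlongrightarrow> 0) (at 0)"
      by (simp add: filterlim_at_split)
    then show ?thesis using 3 by (simp add: has_field_derivative_iff hpoly_def)
  qed
qed

definition bump :: "real \<Rightarrow> real" where
  "bump t = (if t > 0 then exp (- inverse t) else 0)"

lemma bump_nonneg: "0 \<le> bump t" and bump_le_1: "bump t \<le> 1"
  and bump_pos_iff [simp]: "0 < bump t \<longleftrightarrow> 0 < t" and bump_eq_0_iff [simp]: "bump t = 0 \<longleftrightarrow> t \<le> 0"
  by (auto simp: bump_def)

lemma smooth_bump:
  assumes "smooth (\<lambda>x. complex_of_real (q x))"
  shows "smooth (\<lambda>x. complex_of_real (bump (q x)))"
proof -
  define k where "k = (\<lambda>m. hpoly (((\<lambda>p. (p - pderiv p) * [:0, 0, 1:]) ^^ m) 1))"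
  have "(k m has_real_derivative k (Suc m) t) (at t)" for m t
    unfolding k_def funpow.simps o_def by (rule hpoly_has_derivative)
  from smooth_compose_of_real[of k q 0, OF this assms]
  moreover have "k 0 t = bump t" for t by (simp add: k_def hpoly_def bump_def)
  ultimately show ?thesis by simp
qed

definition step :: "real \<Rightarrow> real" where
  "step t = bump t / (bump t + bump (1 - t))"

text \<open>One of t and 1 - t is always positive, so the denominator of \<open>step\<close> never
  vanishes.\<close>

lemma bump_sum_pos: "0 < bump t + bump (1 - t)"
  using bump_nonneg[of t] bump_nonneg[of "1-t"] bump_pos_iff[of t] bump_pos_iff[of "1 - t"]
  by linarith

lemma step_eq_0: "t \<le> 0 \<Longrightarrow> step t = 0" and step_eq_1: "1 \<le> t \<Longrightarrow> step t = 1"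
  and step_nonneg: "0 \<le> step t" and step_le_1: "step t \<le> 1"
  using bump_sum_pos[of t] bump_nonneg[of t] bump_nonneg[of "1-t"]
  by (auto simp: step_def)

lemma smooth_step:
  assumes q: "smooth (\<lambda>x. complex_of_real (q x))"
  shows "smooth (\<lambda>x. complex_of_real (step (q x)))"
proof -
  have 1: "smooth (\<lambda>x. complex_of_real (1 - q x))"
    using smooth_diff[OF smooth_const[of 1] q] by simp
  have nz: "complex_of_real (bump (q x)) + complex_of_real (bump (1 - q x)) \<noteq> 0" for x
    using bump_sum_pos[of "q x"] by (metis less_irrefl of_real_add of_real_eq_0_iff)
  have "smooth (\<lambda>x. complex_of_real (bump (q x)) *
      inverse (complex_of_real (bump (q x)) + complex_of_real (bump (1 - q x))))"
    by (intro smooth_mult smooth_inverse smooth_add smooth_bump q 1 nz)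
  then show ?thesis by (simp add: step_def divide_inverse)
qed

lemma smooth_norm_square: "smooth (\<lambda>x. complex_of_real ((norm x)\<^sup>2))"
proof -
  have "smooth (\<lambda>x. \<Sum>e\<in>Basis. complex_of_real (x \<bullet> e) * complex_of_real (x \<bullet> e))"
    by (intro smooth_sum smooth_mult smooth_bounded_linear bounded_linear_inner_left)
  moreover have "complex_of_real ((norm x)\<^sup>2) = (\<Sum>e\<in>Basis. complex_of_real (x \<bullet> e) * complex_of_real (x \<bullet> e))" for x :: pt
    by (subst power2_norm_eq_inner, subst euclidean_inner) simp
  ultimately show ?thesis by simp
qed

text \<open>Using the squared norm keeps the function smooth at the origin. It falls from 1 to 0
  between the radii R and sqrt (R^2 + 1), and the latter is at most R + 1.\<close>

definition cutoff :: "real \<Rightarrow> pt \<Rightarrow> real" where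
  "cutoff R x = step (R\<^sup>2 + 1 - (norm x)\<^sup>2)"

lemma smooth_cutoff: "smooth (\<lambda>x. complex_of_real (cutoff R x))"
proof -
  have "smooth (\<lambda>x. complex_of_real (R\<^sup>2 + 1 - (norm x)\<^sup>2))"
    using smooth_diff[OF smooth_const[of "of_real (R\<^sup>2 + 1)"] smooth_norm_square] by simp
  then show ?thesis unfolding cutoff_def by (rule smooth_step)
qed

lemma cutoff_eq_1: "norm x \<le> R \<Longrightarrow> cutoff R x = 1"
  unfolding cutoff_def by (rule step_eq_1) (use power_mono[of "norm x" R 2] in auto)

lemma cutoff_eq_0:
  assumes "0 \<le> R" "R + 1 \<le> norm x"
  shows "cutoff R x = 0"
proof -
  have "(R + 1)\<^sup>2 \<le> (norm x)\<^sup>2" using assms by (intro power_mono) auto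
  then show ?thesis unfolding cutoff_def using assms(1)
    by (intro step_eq_0) (simp add: power2_eq_square algebra_simps)
qed

section \<open>Test functions\<close>

lemma test_fn_smooth: "test_fn U f \<Longrightarrow> smooth f"
  by (simp add: test_fn_def)

lemma test_fn_mono: "test_fn U f \<Longrightarrow> U \<subseteq> V \<Longrightarrow> test_fn V f"
  by (auto simp: test_fn_def)

lemma test_fnI:
  assumes "smooth f" "closed S" "S \<subseteq> U" "bounded S" "\<And>x. x \<notin> S \<Longrightarrow> f x = 0"
  shows "test_fn U f"
proof -
  have "{x. f x \<noteq> 0} \<subseteq> S" using assms(5) by auto
  then have "closure {x. f x \<noteq> 0} \<subseteq> S" using assms(2) by (simp add: closure_minimal)
  moreover from this have "compact (closure {x. f x \<noteq> 0})"
    using assms(4) by (meson bounded_subset closed_closure compact_eq_bounded_closed)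
  ultimately show ?thesis using assms(1,3) by (auto simp: test_fn_def)
qed

lemma test_fnE:
  assumes "test_fn U f"
  obtains S where "compact S" "S \<subseteq> U" "\<And>x. x \<notin> S \<Longrightarrow> f x = 0"
proof
  show "compact (closure {x. f x \<noteq> 0})" "closure {x. f x \<noteq> 0} \<subseteq> U"
    using assms by (auto simp: test_fn_def)
  show "f x = 0" if "x \<notin> closure {x. f x \<noteq> 0}" for x
    using that closure_subset[of "{x. f x \<noteq> 0}"] by auto
qed

lemma test_fn_outside: "test_fn U f \<Longrightarrow> x \<notin> U \<Longrightarrow> f x = 0"
  by (meson test_fnE subset_iff)

lemma test_fn_0: "test_fn U (\<lambda>x. 0)"
  by (rule test_fnI[of _ "{}"]) (auto simp: smooth_const)

lemma test_fn_add:
  assumes "test_fn U f" "test_fn U g" shows "test_fn U (\<lambda>x. f x + g x)"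
proof -
  obtain S T where "compact S" "S \<subseteq> U" "\<And>x. x \<notin> S \<Longrightarrow> f x = 0"
    "compact T" "T \<subseteq> U" "\<And>x. x \<notin> T \<Longrightarrow> g x = 0"
    using assms by (metis test_fnE)
  then show ?thesis using assms
    by (intro test_fnI[where S="S \<union> T"])
      (auto intro!: smooth_add test_fn_smooth[OF assms(1)] test_fn_smooth[OF assms(2)] simp: compact_eq_bounded_closed)
qed

lemma test_fn_smooth_mult:
  assumes "smooth f" "test_fn U g" shows "test_fn U (\<lambda>x. f x * g x)"
proof -
  obtain S where "compact S" "S \<subseteq> U" "\<And>x. x \<notin> S \<Longrightarrow> g x = 0"
    using assms by (metis test_fnE)
  then show ?thesis using assms
    by (intro test_fnI[of _ S])
      (auto intro!: smooth_mult dest: test_fn_smooth simp: compact_eq_bounded_closed)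
qed

lemma test_fn_scale: "test_fn U g \<Longrightarrow> test_fn U (\<lambda>x. c * g x)"
  by (rule test_fn_smooth_mult[OF smooth_const])

lemma test_fn_pd:
  assumes "test_fn U f" shows "test_fn U (pd v f)"
proof -
  obtain S where S: "compact S" "S \<subseteq> U" "\<And>x. x \<notin> S \<Longrightarrow> f x = 0"
    using assms by (metis test_fnE)
  have "pd v f x = 0" if "x \<notin> S" for x
  proof -
    have "((\<lambda>_. 0) has_derivative (\<lambda>_. 0)) (at x)" by simp
    then have "(f has_derivative (\<lambda>_. 0)) (at x)"
      by (rule has_derivative_transform_within_open[where s="-S"])
        (use S that in \<open>auto simp: compact_imp_closed open_Compl\<close>)
    then show ?thesis by (rule pd_eqI)
  qed
  then show ?thesis using S assms
    by (intro test_fnI[of _ S]) (auto intro!: smooth_pd dest: test_fn_smooth simp: compact_eq_bounded_closed)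
qed

lemma test_fn_translate:
  assumes "test_fn UNIV f" shows "test_fn UNIV (\<lambda>x. f (x + c))"
proof -
  obtain S where S: "compact S" "\<And>x. x \<notin> S \<Longrightarrow> f x = 0"
    using assms by (metis test_fnE)
  have "x \<in> (\<lambda>y. y - c) ` S" if "x + c \<in> S" for x
    using that by (intro image_eqI[of _ _ "x + c"]) auto
  then show ?thesis using S assms compact_translation_subtract[of S c]
    by (intro test_fnI[of _ "(\<lambda>y. y - c) ` S"]) (auto intro!: smooth_translate dest: test_fn_smooth simp: compact_eq_bounded_closed)
qed

lemma test_fn_bounds:
  assumes "test_fn U f"
  obtains B R where "0 \<le> B" "0 \<le> R" "\<And>x. norm (f x) \<le> B" "\<And>x. R < norm x \<Longrightarrow> f x = 0"
proof -
  obtain S where S: "compact S" "\<And>x. x \<notin> S \<Longrightarrow> f x = 0"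
    using assms by (metis test_fnE)
  have "compact (f ` S)"
    using S(1) assms by (intro compact_continuous_image smooth_continuous_on test_fn_smooth)
  then obtain B where B: "\<And>x. x \<in> S \<Longrightarrow> norm (f x) \<le> B"
    using compact_imp_bounded bounded_iff by (metis imageI)
  obtain R where R: "\<And>x. x \<in> S \<Longrightarrow> norm x \<le> R"
    using S(1) compact_imp_bounded bounded_iff by metis
  show ?thesis
  proof (rule that[of "max B 0" "max R 0"])
    show "norm (f x) \<le> max B 0" for x using B[of x] S(2)[of x] by (cases "x \<in> S") auto
    show "f x = 0" if "max R 0 < norm x" for x using R[of x] S(2)[of x] that by force
  qed auto
qed

lemma test_fn_measurable: "test_fn U f \<Longrightarrow> f \<in> borel_measurable borel"
  by (intro borel_measurable_continuous_onI smooth_continuous_on test_fn_smooth)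

lemma test_fn_cutoff: "0 \<le> R \<Longrightarrow> test_fn UNIV (\<lambda>x. complex_of_real (cutoff R x))"
  by (rule test_fnI[of _ "cball 0 (R + 1)"]) (auto simp: smooth_cutoff cutoff_eq_0)

section \<open>Positive semidefinite forms\<close>

text \<open>The spaces are sets of functions rather than quotients, so the forms vanish on functions
  that are zero almost everywhere and only semidefiniteness can be asked. The instances are
  \<open>L2\<close>, \<open>H1\<close> and \<open>H10 Y\<close> for every \<open>Y\<close>.\<close>

locale psd_form =
  fixes M :: "('a \<Rightarrow> complex) \<Rightarrow> bool" and B :: "('a \<Rightarrow> complex) \<Rightarrow> ('a \<Rightarrow> complex) \<Rightarrow> complex"
  assumes add: "M u \<Longrightarrow> M v \<Longrightarrow> M (\<lambda>x. u x + v x)"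
    and scale: "M u \<Longrightarrow> M (\<lambda>x. c * u x)"
    and B_add: "M u \<Longrightarrow> M v \<Longrightarrow> M w \<Longrightarrow> B (\<lambda>x. u x + v x) w = B u w + B v w"
    and B_scale: "M u \<Longrightarrow> M w \<Longrightarrow> B (\<lambda>x. c * u x) w = c * B u w"
    and B_sym: "M u \<Longrightarrow> M v \<Longrightarrow> B u v = cnj (B v u)"
    and B_pos: "M u \<Longrightarrow> 0 \<le> Re (B u u)"
begin

definition nrm :: "('a \<Rightarrow> complex) \<Rightarrow> real" where "nrm u = sqrt (Re (B u u))"

lemma nrm_nonneg: "M u \<Longrightarrow> 0 \<le> nrm u" by (simp add: nrm_def B_pos)

lemma nrm_sq: "M u \<Longrightarrow> (nrm u)\<^sup>2 = Re (B u u)"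
  by (simp add: nrm_def B_pos)

lemma diff: "M u \<Longrightarrow> M v \<Longrightarrow> M (\<lambda>x. u x - v x)"
  using add[OF _ scale[of v "-1"], of u] by simp

lemma B_diff: "M u \<Longrightarrow> M v \<Longrightarrow> M w \<Longrightarrow> B (\<lambda>x. u x - v x) w = B u w - B v w"
  using B_add[OF _ scale[of v "-1"], of u w] B_scale[of v w "-1"] by simp

lemma B_add_right: "M u \<Longrightarrow> M v \<Longrightarrow> M w \<Longrightarrow> B w (\<lambda>x. u x + v x) = B w u + B w v"
  using B_sym[of w "\<lambda>x. u x + v x"] B_sym[of w u] B_sym[of w v] by (simp add: add B_add)

lemma B_scale_right: "M u \<Longrightarrow> M w \<Longrightarrow> B w (\<lambda>x. c * u x) = cnj c * B w u"
  using B_sym[of w "\<lambda>x. c * u x"] B_sym[of w u] by (simp add: scale B_scale)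

lemma B_diff_right: "M u \<Longrightarrow> M v \<Longrightarrow> M w \<Longrightarrow> B w (\<lambda>x. u x - v x) = B w u - B w v"
  using B_sym[of w "\<lambda>x. u x - v x"] B_sym[of w u] B_sym[of w v] by (simp add: diff B_diff)

lemma B_self: "M u \<Longrightarrow> B u u = complex_of_real ((nrm u)\<^sup>2)"
  using B_sym[of u u] B_pos[of u] by (simp add: nrm_def complex_eq_iff)

lemma nrm_scale: "M u \<Longrightarrow> nrm (\<lambda>x. c * u x) = cmod c * nrm u"
proof -
  assume u: "M u"
  have "B (\<lambda>x. c * u x) (\<lambda>x. c * u x) = complex_of_real ((cmod c * nrm u)\<^sup>2)"
    using u by (simp add: B_scale B_scale_right scale B_self power_mult_distrib complex_norm_square mult_ac del: of_real_power)
  then show ?thesis using nrm_nonneg[OF u] by (simp add: nrm_def[of "\<lambda>x. c * u x"])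
qed

lemma nrm_add_sq:
  assumes "M u" "M v"
  shows "(nrm (\<lambda>x. u x + v x))\<^sup>2 = (nrm u)\<^sup>2 + 2 * Re (B u v) + (nrm v)\<^sup>2"
proof -
  have "B (\<lambda>x. u x + v x) (\<lambda>x. u x + v x) = B u u + B u v + cnj (B u v) + B v v"
    using assms B_sym[of v u] by (simp add: B_add B_add_right add)
  then have "Re (B (\<lambda>x. u x + v x) (\<lambda>x. u x + v x)) = Re (B u u) + 2 * Re (B u v) + Re (B v v)"
    by simp
  then show ?thesis by (simp only: nrm_sq[OF add[OF assms]] nrm_sq[OF assms(1)] nrm_sq[OF assms(2)])
qed

lemma nrm_diff_sq:
  assumes "M u" "M v"
  shows "(nrm (\<lambda>x. u x - v x))\<^sup>2 = (nrm u)\<^sup>2 - 2 * Re (B u v) + (nrm v)\<^sup>2"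
  using nrm_add_sq[OF assms(1) scale[OF assms(2), of "-1"]] B_scale_right[OF assms(2,1), of "-1"]
    nrm_scale[OF assms(2), of "-1"] by simp

lemma Re_B_le:
  assumes u: "M u" and v: "M v"
  shows "\<bar>Re (B u v)\<bar> \<le> nrm u * nrm v"
proof -
  have *: "0 \<le> (nrm u)\<^sup>2 + 2 * t * Re (B u v) + t\<^sup>2 * (nrm v)\<^sup>2" for t :: real
    using nrm_add_sq[OF u scale[OF v, of "of_real t"]] u v zero_le_power2[of "nrm (\<lambda>x. u x + of_real t * v x)"]
    by (simp add: B_scale_right nrm_scale power_mult_distrib)
  have "(Re (B u v))\<^sup>2 \<le> (nrm u * nrm v)\<^sup>2"
  proof (cases "nrm v = 0")
    case True
    have "Re (B u v) = 0"
    proof (rule ccontr)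
      assume "Re (B u v) \<noteq> 0"
      \<comment> \<open>With \<open>nrm v = 0\<close> the expression in \<open>*\<close> is affine
        in t; this t gives it the value -1.\<close>
      then show False using *[of "- ((nrm u)\<^sup>2 + 1) / (2 * Re (B u v))"] True by (simp add: field_simps)
    qed
    then show ?thesis by simp
  next
    case False
    define N where "N = (nrm v)\<^sup>2"
    have p: "0 < N" using False by (simp add: N_def)
    \<comment> \<open>The value t = - Re (B u v) / N minimises the quadratic in
      \<open>*\<close>.\<close>
    have "(- Re (B u v) / N)\<^sup>2 * N = (Re (B u v))\<^sup>2 / N" using p by (simp add: power2_eq_square)
    moreover have "2 * (- Re (B u v) / N) * Re (B u v) = - 2 * ((Re (B u v))\<^sup>2 / N)" by (simp add: power2_eq_square)
    ultimately have "(Re (B u v))\<^sup>2 / N \<le> (nrm u)\<^sup>2"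
      using *[of "- Re (B u v) / N"] unfolding N_def[symmetric] by linarith
    then show ?thesis using p unfolding power_mult_distrib N_def[symmetric] by (simp add: field_simps)
  qed
  then show ?thesis
    using nrm_nonneg[OF u] nrm_nonneg[OF v] by (metis abs_le_square_iff abs_of_nonneg mult_nonneg_nonneg)
qed

lemma Cauchy_Schwarz:
  assumes u: "M u" and v: "M v"
  shows "cmod (B u v) \<le> nrm u * nrm v"
proof (cases "B u v = 0")
  case True then show ?thesis using u v by (simp add: nrm_nonneg)
next
  case False
  define c where "c = cnj (B u v) / cmod (B u v)"
  have c: "cmod c = 1" using False by (simp add: c_def norm_divide)
  have "B (\<lambda>x. c * u x) v = c * B u v" using u v by (rule B_scale)
  also have "\<dots> = complex_of_real (cmod (B u v))"
    using False by (simp add: c_def field_simps complex_norm_square[symmetric] power2_eq_square mult.commute[of _ "B u v"])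
  finally have "cmod (B u v) = Re (B (\<lambda>x. c * u x) v)" by simp
  also have "\<dots> \<le> nrm (\<lambda>x. c * u x) * nrm v" using Re_B_le[OF scale[OF u] v, of c] by linarith
  finally show ?thesis using u c by (simp add: nrm_scale)
qed

lemma nrm_triangle:
  assumes u: "M u" and v: "M v"
  shows "nrm (\<lambda>x. u x + v x) \<le> nrm u + nrm v"
proof (rule power2_le_imp_le)
  show "(nrm (\<lambda>x. u x + v x))\<^sup>2 \<le> (nrm u + nrm v)\<^sup>2"
    using nrm_add_sq[OF u v] Re_B_le[OF u v] by (simp add: power2_sum)
qed (simp add: nrm_nonneg u v)

lemma nrm_triangle_diff:
  assumes u: "M u" and v: "M v"
  shows "nrm (\<lambda>x. u x - v x) \<le> nrm u + nrm v"
  using nrm_triangle[OF u scale[OF v, of "-1"]] nrm_scale[OF v, of "-1"] by simp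

lemma nrm_minus_commute: "M u \<Longrightarrow> M v \<Longrightarrow> nrm (\<lambda>x. u x - v x) = nrm (\<lambda>x. v x - u x)"
  using nrm_scale[OF diff[of u v], of "-1"] by simp

lemma nrm_triangle_mid:
  assumes u: "M u" and v: "M v" and w: "M w"
  shows "nrm (\<lambda>x. u x - w x) \<le> nrm (\<lambda>x. u x - v x) + nrm (\<lambda>x. v x - w x)"
  using nrm_triangle[OF diff[OF u v] diff[OF v w]] by simp

text \<open>The representing vector minimises \<open>(nrm u)\<^sup>2 - 2 * Re (l u)\<close>; a minimising sequence is Cauchy
  by the parallelogram law.\<close>

lemma Riesz:
  assumes ne: "M u0"
    and complete: "\<And>us. (\<And>n. M (us n)) \<Longrightarrow>
      (\<And>e. 0 < e \<Longrightarrow> \<exists>N. \<forall>m\<ge>N. \<forall>n\<ge>N. nrm (\<lambda>x. us m x - us n x) < e) \<Longrightarrow>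
      \<exists>u. M u \<and> (\<lambda>n. nrm (\<lambda>x. us n x - u x)) \<longlonglongrightarrow> 0"
    and l_add: "\<And>u v. M u \<Longrightarrow> M v \<Longrightarrow> l (\<lambda>x. u x + v x) = l u + l v"
    and l_scale: "\<And>c u. M u \<Longrightarrow> l (\<lambda>x. c * u x) = cnj c * l u"
    and l_bound: "\<And>u. M u \<Longrightarrow> cmod (l u) \<le> C * nrm u"
  shows "\<exists>u. M u \<and> (\<forall>v. M v \<longrightarrow> B u v = l v)"
proof -
  define J where "J u = (nrm u)\<^sup>2 - 2 * Re (l u)" for u
  have Jlow: "- (C\<^sup>2) \<le> J u" if "M u" for u
  proof -
    have "Re (l u) \<le> C * nrm u" using l_bound[OF that] complex_Re_le_cmod order_trans by blast
    moreover have "0 \<le> (nrm u - C)\<^sup>2" by simp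
    ultimately show ?thesis by (simp add: J_def power2_diff mult.commute)
  qed
  define m where "m = (INF u\<in>Collect M. J u)"
  have bdd: "bdd_below (J ` Collect M)" using Jlow by (auto intro!: bdd_belowI)
  have mle: "m \<le> J u" if "M u" for u
    unfolding m_def using that by (intro cINF_lower[OF bdd]) simp
  have "\<exists>u. M u \<and> J u < m + 1 / real (Suc n)" for n
  proof -
    have "(INF u\<in>Collect M. J u) < m + 1 / real (Suc n)" by (simp add: m_def)
    then show ?thesis using ne bdd by (subst (asm) cINF_less_iff) auto
  qed
  then obtain us where us: "\<And>n. M (us n)" "\<And>n. J (us n) < m + 1 / real (Suc n)" by metis
  have par: "(nrm (\<lambda>x. us i x - us j x))\<^sup>2 \<le> 2 / real (Suc i) + 2 / real (Suc j)" for i j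
  proof -
    let ?w = "\<lambda>x. (1/2) * (us i x + us j x)"
    have M1: "M (\<lambda>x. us i x + us j x)" and M2: "M ?w" by (intro scale add us(1))+
    have "(nrm ?w)\<^sup>2 = (1/4) * (nrm (\<lambda>x. us i x + us j x))\<^sup>2"
      unfolding nrm_scale[OF M1] by (simp add: power2_eq_square norm_divide)
    moreover have "Re (l ?w) = (1/2) * (Re (l (us i)) + Re (l (us j)))"
      unfolding l_scale[OF M1] l_add[OF us(1) us(1)] by simp
    moreover have "m \<le> J ?w" by (rule mle[OF M2])
    ultimately have "4 * m \<le> (nrm (\<lambda>x. us i x + us j x))\<^sup>2 - 4 * (Re (l (us i)) + Re (l (us j)))"
      unfolding J_def by linarith
    moreover have "J (us i) < m + 1 / real (Suc i)" "J (us j) < m + 1 / real (Suc j)" by (rule us(2))+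
    ultimately show ?thesis
      using nrm_add_sq[OF us(1)[of i] us(1)[of j]] nrm_diff_sq[OF us(1)[of i] us(1)[of j]]
      unfolding J_def by simp
  qed
  have "\<exists>u. M u \<and> (\<lambda>n. nrm (\<lambda>x. us n x - u x)) \<longlonglongrightarrow> 0"
  proof (rule complete[OF us(1)])
    fix e :: real assume e: "0 < e"
    obtain N where N: "1 / real (Suc N) < e\<^sup>2 / 4" using nat_approx_posE[of "e\<^sup>2/4"] e by auto
    show "\<exists>N. \<forall>m\<ge>N. \<forall>n\<ge>N. nrm (\<lambda>x. us m x - us n x) < e"
    proof (intro exI allI impI)
      fix i j assume ij: "N \<le> i" "N \<le> j"
      have "1 / real (Suc i) \<le> 1 / real (Suc N)" "1 / real (Suc j) \<le> 1 / real (Suc N)"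
        using ij by (auto simp: frac_le)
      with par[of i j] N have "(nrm (\<lambda>x. us i x - us j x))\<^sup>2 < e\<^sup>2" by simp
      then show "nrm (\<lambda>x. us i x - us j x) < e" using e power2_less_imp_less by fastforce
    qed
  qed
  then obtain u where u: "M u" and lim: "(\<lambda>n. nrm (\<lambda>x. us n x - u x)) \<longlonglongrightarrow> 0" by blast
  have Ju: "J u \<le> m"
  proof (rule field_le_epsilon)
    fix e :: real assume e: "0 < e"
    let ?d = "\<lambda>n. nrm (\<lambda>x. us n x - u x)"
    have l1: "(\<lambda>n. 2 * (nrm u + C) * ?d n) \<longlonglongrightarrow> 0"
      using tendsto_mult[OF tendsto_const[of "2 * (nrm u + C)"] lim] by simp
    have "(\<lambda>n. 2 * (nrm u + C) * ?d n + 1 / real (Suc n)) \<longlonglongrightarrow> 0 + 0"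
      by (rule tendsto_add[OF l1 LIMSEQ_inverse_real_of_nat[unfolded inverse_eq_divide]])
    then have "eventually (\<lambda>n. 2 * (nrm u + C) * ?d n + 1 / real (Suc n) < e) sequentially"
      using e by (simp add: order_tendsto_iff)
    then obtain n where n: "2 * (nrm u + C) * ?d n + 1 / real (Suc n) < e"
      by (auto simp: eventually_sequentially)
    have d: "M (\<lambda>x. us n x - u x)" by (rule diff[OF us(1) u])
    have "(nrm (us n))\<^sup>2 = (nrm u)\<^sup>2 + 2 * Re (B u (\<lambda>x. us n x - u x)) + (?d n)\<^sup>2"
      using nrm_add_sq[OF u d] by simp
    moreover have "\<bar>Re (B u (\<lambda>x. us n x - u x))\<bar> \<le> nrm u * ?d n" by (rule Re_B_le[OF u d])
    ultimately have 1: "(nrm u)\<^sup>2 \<le> (nrm (us n))\<^sup>2 + 2 * nrm u * ?d n"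
      using zero_le_power2[of "?d n"] by linarith
    have "l (us n) = l u + l (\<lambda>x. us n x - u x)" using l_add[OF u d] by simp
    moreover have "\<bar>Re (l (\<lambda>x. us n x - u x))\<bar> \<le> C * ?d n"
      using l_bound[OF d] abs_Re_le_cmod order_trans by blast
    ultimately have 2: "Re (l (us n)) \<le> Re (l u) + C * ?d n" by simp
    have "J u \<le> J (us n) + 2 * (nrm u + C) * ?d n"
      using 1 2 unfolding J_def by (simp add: algebra_simps)
    then show "J u \<le> m + e" using us(2)[of n] n by linarith
  qed
  have key: "Re (B u v) = Re (l v)" if v: "M v" for v
  proof (rule ccontr)
    assume ne: "Re (B u v) \<noteq> Re (l v)"
    define b where "b = Re (B u v) - Re (l v)"
    have *: "0 \<le> 2 * t * b + t\<^sup>2 * (nrm v)\<^sup>2" for t :: real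
    proof -
      have "J u \<le> J (\<lambda>x. u x + of_real t * v x)" using Ju mle[OF add[OF u scale[OF v]]] by (rule order_trans)
      then show ?thesis
        unfolding J_def nrm_add_sq[OF u scale[OF v]] l_add[OF u scale[OF v]] l_scale[OF v]
          nrm_scale[OF v] B_scale_right[OF v u]
        by (simp add: b_def algebra_simps power_mult_distrib)
    qed
    have b: "b \<noteq> 0" using ne by (simp add: b_def)
    \<comment> \<open>Adding 1 avoids a division by \<open>nrm v\<close>, which may vanish; t = - b
      / s still makes the quadratic negative.\<close>
    let ?s = "(nrm v)\<^sup>2 + 1"
    have p: "0 < ?s" by (simp add: add_nonneg_pos)
    have eq: "2 * (- b / ?s) * b + (- b / ?s)\<^sup>2 * (nrm v)\<^sup>2 = - ((b\<^sup>2 / ?s) * (2 - (nrm v)\<^sup>2 / ?s))"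
      by (simp add: power2_eq_square algebra_simps)
    have "(nrm v)\<^sup>2 / ?s < 1" using p by simp
    then have "0 < 2 - (nrm v)\<^sup>2 / ?s" by linarith
    moreover have "0 < b\<^sup>2 / ?s" using b p by simp
    ultimately have "0 < (b\<^sup>2 / ?s) * (2 - (nrm v)\<^sup>2 / ?s)" by (rule mult_pos_pos[rotated])
    with eq have "2 * (- b / ?s) * b + (- b / ?s)\<^sup>2 * (nrm v)\<^sup>2 < 0" by linarith
    then show False using *[of "- b / ?s"] by linarith
  qed
  have "B u v = l v" if v: "M v" for v
  proof (rule complex_eqI)
    show "Re (B u v) = Re (l v)" by (rule key[OF v])
    \<comment> \<open>Both sides are conjugate linear in v, so their real parts at i v are their
      imaginary parts at v.\<close>
    show "Im (B u v) = Im (l v)"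
      using key[OF scale[OF v, of "\<i>"]] by (simp add: B_scale_right[OF v u] l_scale[OF v])
  qed
  then show ?thesis using u by blast
qed

end

section \<open>The space \<open>L\<^sup>2\<close>\<close>

lemma L2_measurable [measurable_dest]: "L2 f \<Longrightarrow> f \<in> borel_measurable borel"
  by (simp add: L2_def)

lemma L2_integrable_sq: "L2 f \<Longrightarrow> integrable lborel (\<lambda>x. (norm (f x))\<^sup>2)"
  by (simp add: L2_def)

lemma norm_prod_le_sq: "norm (a * b :: complex) \<le> (norm a)\<^sup>2 + (norm b)\<^sup>2"
proof -
  have "2 * (norm a * norm b) \<le> (norm a)\<^sup>2 + (norm b)\<^sup>2"
    using sum_squares_bound[of "norm a" "norm b"] by (simp add: mult_ac)
  moreover have "0 \<le> norm a * norm b" by simp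
  ultimately show ?thesis unfolding norm_mult by linarith
qed

lemma L2_prod_integrable:
  assumes "L2 f" "L2 g" shows "integrable lborel (\<lambda>x. f x * g x)"
proof (rule Bochner_Integration.integrable_bound)
  show "integrable lborel (\<lambda>x. (norm (f x))\<^sup>2 + (norm (g x))\<^sup>2)"
    using assms by (intro Bochner_Integration.integrable_add L2_integrable_sq)
  show "(\<lambda>x. f x * g x) \<in> borel_measurable lborel"
    using assms[THEN L2_measurable] by simp
  show "AE x in lborel. norm (f x * g x) \<le> norm ((norm (f x))\<^sup>2 + (norm (g x))\<^sup>2)"
    using norm_prod_le_sq by (intro AE_I2) (metis abs_of_nonneg add_nonneg_nonneg real_norm_def zero_le_power2)
qed

lemma L2_bound:
  assumes "L2 f" and "g \<in> borel_measurable borel" and "\<And>x. norm (g x) \<le> C * norm (f x)"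
  shows "L2 g"
  unfolding L2_def
proof
  show "integrable lborel (\<lambda>x. (norm (g x))\<^sup>2)"
  proof (rule Bochner_Integration.integrable_bound)
    show "integrable lborel (\<lambda>x. C\<^sup>2 * (norm (f x))\<^sup>2)"
      using assms(1) by (intro integrable_mult_right L2_integrable_sq)
    show "(\<lambda>x. (norm (g x))\<^sup>2) \<in> borel_measurable lborel" using assms(2) by simp
    show "AE x in lborel. norm ((norm (g x))\<^sup>2) \<le> norm (C\<^sup>2 * (norm (f x))\<^sup>2)"
      using power_mono[OF assms(3) norm_ge_zero, of _ 2] by (simp add: power_mult_distrib)
  qed
qed (use assms(2) in simp)

lemma L2_mult_bounded:
  assumes "L2 f" and "g \<in> borel_measurable borel" and "\<And>x. norm (g x) \<le> C"
  shows "L2 (\<lambda>x. g x * f x)"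
proof (rule L2_bound[OF assms(1)])
  show "(\<lambda>x. g x * f x) \<in> borel_measurable borel"
    using assms L2_measurable[OF assms(1)] by simp
  show "norm (g x * f x) \<le> C * norm (f x)" for x
    using assms(3) by (simp add: norm_mult mult_right_mono)
qed

lemma L2_scale: "L2 f \<Longrightarrow> L2 (\<lambda>x. c * f x)"
  by (rule L2_mult_bounded[where g="\<lambda>_. c"]) auto

lemma L2_cnj: "L2 f \<Longrightarrow> L2 (\<lambda>x. cnj (f x))"
  by (rule L2_bound[where C=1])
    (auto intro!: measurable_compose[OF L2_measurable borel_measurable_continuous_onI[OF continuous_on_cnj[OF continuous_on_id]]])

lemma L2_add:
  assumes "L2 f" "L2 g" shows "L2 (\<lambda>x. f x + g x)"
  unfolding L2_def
proof
  show "integrable lborel (\<lambda>x. (norm (f x + g x))\<^sup>2)"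
  proof (rule Bochner_Integration.integrable_bound)
    show "integrable lborel (\<lambda>x. 2 * (norm (f x))\<^sup>2 + 2 * (norm (g x))\<^sup>2)"
      using assms by (intro Bochner_Integration.integrable_add integrable_mult_right L2_integrable_sq)
    show "(\<lambda>x. (norm (f x + g x))\<^sup>2) \<in> borel_measurable lborel"
      using assms[THEN L2_measurable] by simp
    have "(norm (a + b))\<^sup>2 \<le> 2 * (norm a)\<^sup>2 + 2 * (norm b)\<^sup>2" for a b :: complex
    proof -
      have "(norm (a + b))\<^sup>2 \<le> (norm a + norm b)\<^sup>2" by (intro power_mono norm_triangle_ineq) simp
      also have "\<dots> \<le> 2 * (norm a)\<^sup>2 + 2 * (norm b)\<^sup>2"
        using sum_squares_bound[of "norm a" "norm b"] by (simp add: power2_sum)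
      finally show ?thesis .
    qed
    then show "AE x in lborel. norm ((norm (f x + g x))\<^sup>2) \<le> norm (2 * (norm (f x))\<^sup>2 + 2 * (norm (g x))\<^sup>2)"
      by simp
  qed
qed (use assms[THEN L2_measurable] in simp)

interpretation L2: psd_form L2 l2inner
proof
  fix u v w :: fn and c :: complex
  show "L2 u \<Longrightarrow> L2 v \<Longrightarrow> L2 (\<lambda>x. u x + v x)" by (rule L2_add)
  show "L2 u \<Longrightarrow> L2 (\<lambda>x. c * u x)" by (rule L2_scale)
  show "L2 u \<Longrightarrow> L2 v \<Longrightarrow> L2 w \<Longrightarrow> l2inner (\<lambda>x. u x + v x) w = l2inner u w + l2inner v w"
    unfolding l2inner_def by (simp add: distrib_right L2_prod_integrable L2_cnj)
  show "L2 u \<Longrightarrow> L2 w \<Longrightarrow> l2inner (\<lambda>x. c * u x) w = c * l2inner u w"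
    unfolding l2inner_def by (simp add: mult.assoc)
  have "cnj (l2inner v u) = integral\<^sup>L lborel (\<lambda>x. cnj (v x * cnj (u x)))"
    unfolding l2inner_def by (rule Bochner_Integration.integral_cnj[symmetric])
  then show "l2inner u v = cnj (l2inner v u)"
    unfolding l2inner_def by (simp add: mult.commute)
  have "l2inner u u = complex_of_real (integral\<^sup>L lborel (\<lambda>x. (norm (u x))\<^sup>2))"
    unfolding l2inner_def by (simp flip: integral_complex_of_real complex_norm_square)
  then show "L2 u \<Longrightarrow> 0 \<le> Re (l2inner u u)" by simp
qed

lemma l2inner_self: "l2inner u u = complex_of_real ((l2norm u)\<^sup>2)"
proof -
  have "l2inner u u = complex_of_real (integral\<^sup>L lborel (\<lambda>x. (norm (u x))\<^sup>2))"
    unfolding l2inner_def by (simp flip: integral_complex_of_real complex_norm_square)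
  then show ?thesis by (simp add: l2norm_def)
qed

lemma l2norm_nonneg: "0 \<le> l2norm f" by (simp add: l2norm_def)

lemma L2_nrm [simp]: "L2.nrm = l2norm"
  by (auto simp: L2.nrm_def l2inner_self l2norm_nonneg)

lemmas l2_Cauchy_Schwarz = L2.Cauchy_Schwarz[unfolded L2_nrm]
lemmas l2norm_triangle = L2.nrm_triangle[unfolded L2_nrm]
lemmas l2norm_triangle_diff = L2.nrm_triangle_diff[unfolded L2_nrm]
lemmas l2norm_triangle_mid = L2.nrm_triangle_mid[unfolded L2_nrm]
lemmas l2norm_scale = L2.nrm_scale[unfolded L2_nrm]
lemmas L2_diff = L2.diff

lemma l2norm_sq: "(l2norm f)\<^sup>2 = integral\<^sup>L lborel (\<lambda>x. (norm (f x))\<^sup>2)"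
  by (simp add: l2norm_def)

lemma l2norm_mono:
  assumes "L2 f" "L2 g" "\<And>x. norm (g x) \<le> C * norm (f x)" "0 \<le> C"
  shows "l2norm g \<le> C * l2norm f"
proof (rule power2_le_imp_le)
  have "integral\<^sup>L lborel (\<lambda>x. (norm (g x))\<^sup>2) \<le> integral\<^sup>L lborel (\<lambda>x. C\<^sup>2 * (norm (f x))\<^sup>2)"
    using assms power_mono[OF assms(3) norm_ge_zero, of _ 2]
    by (intro integral_mono integrable_mult_right L2_integrable_sq) (auto simp: power_mult_distrib)
  then show "(l2norm g)\<^sup>2 \<le> (C * l2norm f)\<^sup>2" by (simp add: l2norm_sq power_mult_distrib)
qed (simp add: assms(4) l2norm_nonneg)

lemma l2norm_cong_AE:
  assumes "L2 f" "L2 g" "AE x in lborel. f x = g x"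
  shows "l2norm f = l2norm g"
  unfolding l2norm_def using assms by (intro arg_cong[of _ _ sqrt] integral_cong_AE) (auto dest: L2_measurable)

lemma l2inner_cong_AE:
  assumes "L2 f" "L2 g" "L2 f'" "L2 g'" "AE x in lborel. f x = f' x" "AE x in lborel. g x = g' x"
  shows "l2inner f g = l2inner f' g'"
  unfolding l2inner_def
proof (rule integral_cong_AE)
  show "AE x in lborel. f x * cnj (g x) = f' x * cnj (g' x)"
    using assms(5,6) by eventually_elim simp
qed (intro borel_measurable_integrable L2_prod_integrable L2_cnj assms)+

lemma l2norm_eq_0D:
  assumes "L2 f" "l2norm f = 0" shows "AE x in lborel. f x = 0"
proof -
  have "integral\<^sup>L lborel (\<lambda>x. (norm (f x))\<^sup>2) = 0" using assms(2) by (simp add: l2norm_def)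
  then show ?thesis
    by (subst (asm) integral_nonneg_eq_0_iff_AE) (auto simp: L2_integrable_sq[OF assms(1)])
qed

lemma L2_0: "L2 (\<lambda>x. 0)" by (simp add: L2_def)

lemma integrable_indicator_cball: "integrable lborel (indicat_real (cball (0::pt) R))"
proof -
  have "emeasure lborel (cball 0 R :: pt set) < top"
    using emeasure_bounded_finite[OF bounded_cball, of "0::pt" R] by simp
  then show ?thesis by (intro integrable_real_indicator) auto
qed

lemma integrable_bounded_support:
  fixes f :: "pt \<Rightarrow> 'b::{banach, second_countable_topology}"
  assumes "f \<in> borel_measurable borel" "\<And>x. norm (f x) \<le> B" "\<And>x. R < norm x \<Longrightarrow> f x = 0"
  shows "integrable lborel f"
proof (rule Bochner_Integration.integrable_bound)
  show "integrable lborel (\<lambda>x::pt. B * indicat_real (cball 0 R) x)"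
    by (intro integrable_mult_right integrable_indicator_cball)
  show "AE x in lborel. norm (f x) \<le> norm (B * indicat_real (cball 0 R) x)"
  proof (rule AE_I2)
    fix x show "norm (f x) \<le> norm (B * indicat_real (cball 0 R) x)"
      using assms(2)[of x] assms(3)[of x] by (cases "norm x \<le> R") (auto simp: indicator_def)
  qed
qed (use assms(1) in simp)

lemma L2_bounded_support:
  assumes "f \<in> borel_measurable borel" "\<And>x. norm (f x) \<le> B" "\<And>x. R < norm x \<Longrightarrow> f x = 0"
  shows "L2 f"
  unfolding L2_def
proof
  show "integrable lborel (\<lambda>x. (norm (f x))\<^sup>2)"
  proof (rule integrable_bounded_support[where B="B\<^sup>2"])
    show "norm ((norm (f x))\<^sup>2) \<le> B\<^sup>2" for x using assms(2)[of x] by (simp add: power_mono)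
  qed (use assms in auto)
qed (use assms(1) in simp)

lemma L2_test_fn: "test_fn U f \<Longrightarrow> L2 f"
  by (metis L2_bounded_support test_fn_bounds test_fn_measurable)

lemma L2_indicator_cball: "L2 (\<lambda>x. indicator (cball 0 R) x)"
  by (rule L2_bounded_support[where B=1 and R=R]) (auto simp: indicator_def)

section \<open>Translations, difference quotients and integration by parts\<close>

lemma nn_integral_translate:
  fixes f :: "pt \<Rightarrow> ennreal"
  assumes "f \<in> borel_measurable borel"
  shows "(\<integral>\<^sup>+x. f (x + c) \<partial>lborel) = (\<integral>\<^sup>+x. f x \<partial>lborel)"
proof -
  have "(\<integral>\<^sup>+x. f x \<partial>lborel) = (\<integral>\<^sup>+x. f x \<partial>(distr lborel borel ((+) c)))"
    by (simp add: lborel_distr_plus)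
  also have "\<dots> = (\<integral>\<^sup>+x. f (c + x) \<partial>lborel)"
    using assms by (subst nn_integral_distr) auto
  finally show ?thesis by (simp add: add.commute)
qed

lemma
  fixes f :: "pt \<Rightarrow> 'b::{banach, second_countable_topology}"
  assumes [measurable]: "f \<in> borel_measurable borel"
  shows integral_translate: "integral\<^sup>L lborel (\<lambda>x. f (x + c)) = integral\<^sup>L lborel f"
    and integrable_translate: "integrable lborel (\<lambda>x. f (x + c)) \<longleftrightarrow> integrable lborel f"
proof -
  have "integral\<^sup>L lborel f = integral\<^sup>L (distr lborel borel ((+) c)) f"
    by (simp add: lborel_distr_plus)
  also have "\<dots> = integral\<^sup>L lborel (\<lambda>x. f (c + x))"
    by (subst integral_distr) auto
  finally show "integral\<^sup>L lborel (\<lambda>x. f (x + c)) = integral\<^sup>L lborel f" by (simp add: add.commute)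
  have "integrable lborel f \<longleftrightarrow> integrable (distr lborel borel ((+) c)) f"
    by (simp add: lborel_distr_plus)
  also have "\<dots> \<longleftrightarrow> integrable lborel (\<lambda>x. f (c + x))"
    by (subst integrable_distr_eq) auto
  finally show "integrable lborel (\<lambda>x. f (x + c)) \<longleftrightarrow> integrable lborel f" by (simp add: add.commute)
qed

lemma L2_translate: assumes "L2 u" shows "L2 (\<lambda>x. u (x + c))"
proof -
  note [measurable] = L2_measurable[OF assms]
  show ?thesis using L2_integrable_sq[OF assms] integrable_translate[of "\<lambda>x. (norm (u x))\<^sup>2" c]
    by (simp add: L2_def)
qed

lemma l2norm_translate: assumes "L2 u" shows "l2norm (\<lambda>x. u (x + c)) = l2norm u"
proof -
  note [measurable] = L2_measurable[OF assms]
  show ?thesis using integral_translate[of "\<lambda>x. (norm (u x))\<^sup>2" c] by (simp add: l2norm_def)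
qed

lemma test_fn_Lipschitz:
  assumes "test_fn U f"
  obtains L where "0 \<le> L" "\<And>x w. norm (f (x + w) - f x) \<le> L * norm w"
proof -
  have "\<exists>B\<ge>0. \<forall>x. norm (pd e f x) \<le> B" for e
    using test_fn_bounds[OF test_fn_pd[OF assms, of e]] by metis
  then obtain B where B: "\<And>e. 0 \<le> B e" "\<And>e x. norm (pd e f x) \<le> B e" by metis
  define L where "L = (\<Sum>e\<in>Basis. B e)"
  have d: "f differentiable (at x)" for x by (rule smooth_differentiable[OF test_fn_smooth[OF assms]])
  have on: "onorm (\<lambda>v. pd v f x) \<le> L" for x
  proof (rule onorm_le)
    fix v
    have "norm (pd v f x) \<le> (\<Sum>e\<in>Basis. norm ((v \<bullet> e) *\<^sub>R pd e f x))"
      unfolding pd_Basis_sum[OF d, of v] by (rule norm_sum)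
    also have "\<dots> \<le> (\<Sum>e\<in>Basis. norm v * B e)"
      by (intro sum_mono) (auto intro!: mult_mono B simp: Basis_le_norm)
    finally show "norm (pd v f x) \<le> L * norm v" by (simp add: L_def sum_distrib_left mult.commute)
  qed
  show ?thesis
  proof (rule that[of L])
    show "0 \<le> L" by (simp add: L_def sum_nonneg B)
    show "norm (f (x + w) - f x) \<le> L * norm w" for x w
      using differentiable_bound[of UNIV f "\<lambda>x v. pd v f x" L "x + w" x] on has_derivative_pd[OF d]
      by simp
  qed
qed

lemma difference_quotient_tendsto:
  assumes "smooth f"
  shows "(\<lambda>n. of_nat (Suc n) * (f (x + (1 / real (Suc n)) *\<^sub>R z) - f x)) \<longlonglongrightarrow> pd z f x"
proof -
  have "((\<lambda>t. x + t *\<^sub>R z) has_derivative (\<lambda>t. t *\<^sub>R z)) (at (0::real))"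
    by (auto intro!: derivative_eq_intros)
  moreover have "(f has_derivative (\<lambda>v. pd v f x)) (at (x + 0 *\<^sub>R z))"
    using has_derivative_pd[OF smooth_differentiable[OF assms]] by simp
  ultimately have D: "((\<lambda>t. f (x + t *\<^sub>R z)) has_derivative (\<lambda>t. pd (t *\<^sub>R z) f x)) (at 0)"
    by (rule has_derivative_compose)
  have "pd (t *\<^sub>R z) f x = t *\<^sub>R pd z f x" for t
    using linear_scale[OF has_derivative_linear[OF has_derivative_pd[OF smooth_differentiable[OF assms]]]] .
  with D have "((\<lambda>t. norm (f (x + t *\<^sub>R z) - f x - t *\<^sub>R pd z f x) / norm t) \<longlongrightarrow> 0) (at 0)"
    by (simp add: has_derivative_at)
  moreover have "filterlim (\<lambda>n. 1 / real (Suc n)) (at 0) sequentially"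
    by (rule filterlim_atI[OF LIMSEQ_inverse_real_of_nat[unfolded inverse_eq_divide]]) auto
  ultimately have "(\<lambda>n. norm (f (x + (1 / real (Suc n)) *\<^sub>R z) - f x - (1 / real (Suc n)) *\<^sub>R pd z f x)
      / norm (1 / real (Suc n))) \<longlonglongrightarrow> 0"
    by (rule filterlim_compose)
  moreover have "norm (a - (1 / real (Suc n)) *\<^sub>R b) / norm (1 / real (Suc n)) = norm (of_nat (Suc n) * a - b)"
    for a b :: complex and n
  proof -
    have "of_nat (Suc n) * a - b = of_nat (Suc n) * (a - (1 / real (Suc n)) *\<^sub>R b)"
      by (simp add: scaleR_conv_of_real algebra_simps del: of_nat_Suc)
    then show ?thesis by (simp add: norm_mult mult.commute del: of_nat_Suc)
  qed
  ultimately have "(\<lambda>n. norm (of_nat (Suc n) * (f (x + (1 / real (Suc n)) *\<^sub>R z) - f x) - pd z f x)) \<longlonglongrightarrow> 0"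
    by simp
  then show ?thesis by (rule LIM_zero_cancel[OF tendsto_norm_zero_cancel])
qed

text \<open>Supplies a majorant uniform in n: the steps have length at most |z| and so move the
  support by at most |z|, while the Lipschitz bound cancels the factor \<open>Suc n\<close>.\<close>

lemma difference_quotient_bound:
  assumes f: "test_fn UNIV f"
  obtains B R where "0 \<le> B" "\<And>n x. norm (of_nat (Suc n) * (f (x + (1 / real (Suc n)) *\<^sub>R z) - f x))
    \<le> B * indicator (cball 0 R) x"
proof -
  obtain L where L: "0 \<le> L" "\<And>x w. norm (f (x + w) - f x) \<le> L * norm w"
    using test_fn_Lipschitz[OF f] by metis
  obtain B R where B: "0 \<le> B" "0 \<le> R" "\<And>x. norm (f x) \<le> B" "\<And>x. R < norm x \<Longrightarrow> f x = 0"
    using test_fn_bounds[OF f] by metis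
  have "norm (of_nat (Suc n) * (f (x + (1 / real (Suc n)) *\<^sub>R z) - f x))
      \<le> L * norm z * indicator (cball 0 (R + norm z)) x" for n x
  proof (cases "norm x \<le> R + norm z")
    case True
    have "norm (f (x + (1 / real (Suc n)) *\<^sub>R z) - f x) \<le> L * norm ((1 / real (Suc n)) *\<^sub>R z)"
      by (rule L(2))
    then have "real (Suc n) * norm (f (x + (1 / real (Suc n)) *\<^sub>R z) - f x) \<le> L * norm z"
      by (simp add: field_simps)
    then show ?thesis using True by (simp add: norm_mult del: of_nat_Suc)
  next
    case False
    have "norm ((1 / real (Suc n)) *\<^sub>R z) \<le> norm z" by (simp add: field_simps)
    then have "R < norm (x + (1 / real (Suc n)) *\<^sub>R z)" "R < norm x"
      using False norm_diff_ineq[of x "(1 / real (Suc n)) *\<^sub>R z"] norm_ge_zero[of z] by linarith+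
    then show ?thesis using B(4) False by simp
  qed
  from that[OF mult_nonneg_nonneg[OF L(1) norm_ge_zero] this] show ?thesis .
qed

text \<open>By translation invariance every difference quotient has integral zero, and dominated
  convergence carries this over to the derivative.\<close>

lemma integral_pd_test_fn:
  assumes f: "test_fn UNIV f"
  shows "integral\<^sup>L lborel (pd z f) = 0"
proof -
  note [measurable] = test_fn_measurable[OF f] test_fn_measurable[OF test_fn_pd[OF f]]
  obtain B R where B: "\<And>n x. norm (of_nat (Suc n) * (f (x + (1 / real (Suc n)) *\<^sub>R z) - f x))
      \<le> B * indicator (cball 0 R) x"
    using difference_quotient_bound[OF f] by metis
  let ?q = "\<lambda>n x. of_nat (Suc n) * (f (x + (1 / real (Suc n)) *\<^sub>R z) - f x)"
  have int: "integrable lborel f"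
    using test_fn_bounds[OF f] integrable_bounded_support[OF test_fn_measurable[OF f]] by metis
  have z: "integral\<^sup>L lborel (?q n) = 0" for n
    using integral_translate[of f] integrable_translate[of f] int by simp
  have "(\<lambda>n. integral\<^sup>L lborel (?q n)) \<longlonglongrightarrow> integral\<^sup>L lborel (pd z f)"
  proof (rule integral_dominated_convergence)
    show "integrable lborel (\<lambda>x::pt. B * indicator (cball 0 R) x)"
      by (intro integrable_mult_right integrable_indicator_cball)
    show "AE x in lborel. (\<lambda>n. ?q n x) \<longlonglongrightarrow> pd z f x"
      using difference_quotient_tendsto[OF test_fn_smooth[OF f]] by auto
    show "AE x in lborel. norm (?q n x) \<le> B * indicator (cball 0 R) x" for n
      by (intro AE_I2 B)
  qed auto
  then show ?thesis unfolding z using LIMSEQ_unique tendsto_const by metis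
qed

section \<open>The fundamental lemma of the calculus of variations\<close>

text \<open>A smooth approximation of the indicator of an open box from inside: every factor tends
  to 1 at interior points as n grows, and the product vanishes outside the box for every n.\<close>

definition box_bump :: "pt \<Rightarrow> pt \<Rightarrow> nat \<Rightarrow> pt \<Rightarrow> real" where
  "box_bump a b n x = (\<Prod>e\<in>Basis. bump (real (Suc n) * ((x - a) \<bullet> e)) * bump (real (Suc n) * ((b - x) \<bullet> e)))"

lemma box_bump_outside: "x \<notin> box a b \<Longrightarrow> box_bump a b n x = 0"
  unfolding box_bump_def by (auto simp: mem_box not_less inner_diff_left mult_le_0_iff intro!: prod_zero)

lemma box_bump_le_1: "0 \<le> box_bump a b n x" "box_bump a b n x \<le> 1"
  unfolding box_bump_def by (auto intro!: prod_nonneg prod_le_1 mult_nonneg_nonneg mult_le_one bump_nonneg bump_le_1)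

lemma test_fn_box_bump: "test_fn UNIV (\<lambda>x. complex_of_real (box_bump a b n x))"
proof (rule test_fnI[where S="cbox a b"])
  have "smooth (\<lambda>x. complex_of_real (real (Suc n) * ((x - a) \<bullet> e)))" for e a
  proof -
    have "smooth (\<lambda>x. complex_of_real (real (Suc n)) * (complex_of_real (x \<bullet> e) - complex_of_real (a \<bullet> e)))"
      by (intro smooth_mult smooth_const smooth_diff smooth_bounded_linear bounded_linear_inner_left)
    then show ?thesis by (simp add: inner_diff_left)
  qed
  moreover have "smooth (\<lambda>x. complex_of_real (real (Suc n) * ((b - x) \<bullet> e)))" for e b
  proof -
    have "smooth (\<lambda>x. complex_of_real (real (Suc n)) * (complex_of_real (b \<bullet> e) - complex_of_real (x \<bullet> e)))"
      by (intro smooth_mult smooth_const smooth_diff smooth_bounded_linear bounded_linear_inner_left)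
    then show ?thesis by (simp add: inner_diff_left)
  qed
  ultimately show "smooth (\<lambda>x. complex_of_real (box_bump a b n x))"
    unfolding box_bump_def of_real_prod of_real_mult[of "bump _"] by (intro smooth_prod smooth_mult smooth_bump)
  show "complex_of_real (box_bump a b n x) = 0" if "x \<notin> cbox a b" for x
    using that box_bump_outside box_subset_cbox by (metis of_real_0 subset_iff)
qed auto

lemma box_bump_tendsto: "(\<lambda>n. box_bump a b n x) \<longlonglongrightarrow> indicator (box a b) x"
proof (cases "x \<in> box a b")
  case False then show ?thesis by (simp add: box_bump_outside)
next
  case True
  have "(\<lambda>n. bump (real (Suc n) * t)) \<longlonglongrightarrow> 1" if "0 < t" for t
  proof -
    have "(\<lambda>n. exp (- (inverse (real (Suc n)) * inverse t))) \<longlonglongrightarrow> exp (- (0 * inverse t))"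
      by (intro tendsto_intros LIMSEQ_inverse_real_of_nat)
    moreover have "bump (real (Suc n) * t) = exp (- (inverse (real (Suc n)) * inverse t))" for n
      using that by (simp add: bump_def zero_less_mult_iff mult.commute del: of_nat_Suc)
    ultimately show ?thesis by simp
  qed
  then have "(\<lambda>n. box_bump a b n x) \<longlonglongrightarrow> (\<Prod>e\<in>(Basis::pt set). 1 * 1)"
    unfolding box_bump_def using True by (intro tendsto_prod tendsto_mult) (auto simp: mem_box inner_diff_left)
  then show ?thesis using True by simp
qed

text \<open>Approximating indicators gives zero integrals over boxes. Boxes form an
  intersection-stable generator of the Borel sets, and a function with zero integral over every
  Borel set vanishes almost everywhere.\<close>

lemma L2_eq_0I:
  assumes u: "L2 u" and ortho: "\<And>\<phi>. test_fn UNIV (\<lambda>x. complex_of_real (\<phi> x)) \<Longrightarrow>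
     integral\<^sup>L lborel (\<lambda>x. u x * complex_of_real (\<phi> x)) = 0"
  shows "AE x in lborel. u x = 0"
proof -
  note [measurable] = L2_measurable[OF u] test_fn_measurable[OF test_fn_box_bump]
  have loc: "integrable lborel (\<lambda>x. indicator S x *\<^sub>R u x)" if "S \<in> sets borel" "bounded S" for S
  proof -
    have "L2 (\<lambda>x. indicator S x)"
    proof -
      obtain R where "S \<subseteq> cball 0 R"
        using \<open>bounded S\<close> unfolding bounded_iff by (metis mem_cball_0 subsetI)
      then show ?thesis using that(1)
        by (intro L2_bounded_support[where B=1 and R=R]) (auto simp: indicator_def)
    qed
    from L2_prod_integrable[OF u this] show ?thesis
      by (rule Bochner_Integration.integrable_cong[THEN iffD1, rotated -1]) (auto simp: indicator_def)
  qed
  have box0: "integral\<^sup>L lborel (\<lambda>x. indicator (box a b) x *\<^sub>R u x) = 0" for a b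
  proof -
    have "(\<lambda>n. integral\<^sup>L lborel (\<lambda>x. u x * complex_of_real (box_bump a b n x))) \<longlonglongrightarrow>
       integral\<^sup>L lborel (\<lambda>x. indicator (box a b) x *\<^sub>R u x)"
    proof (rule integral_dominated_convergence)
      show "integrable lborel (\<lambda>x. norm (indicator (box a b) x *\<^sub>R u x))"
        by (intro integrable_norm loc) auto
      show "AE x in lborel. (\<lambda>n. u x * complex_of_real (box_bump a b n x)) \<longlonglongrightarrow> indicator (box a b) x *\<^sub>R u x"
      proof (rule AE_I2)
        fix x
        have "(\<lambda>n. box_bump a b n x *\<^sub>R u x) \<longlonglongrightarrow> indicator (box a b) x *\<^sub>R u x"
          by (intro tendsto_intros box_bump_tendsto)
        then show "(\<lambda>n. u x * complex_of_real (box_bump a b n x)) \<longlonglongrightarrow> indicator (box a b) x *\<^sub>R u x"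
          by (simp add: scaleR_conv_of_real mult.commute)
      qed
      show "AE x in lborel. norm (u x * complex_of_real (box_bump a b n x)) \<le> norm (indicator (box a b) x *\<^sub>R u x)" for n
      proof (rule AE_I2)
        fix x show "norm (u x * complex_of_real (box_bump a b n x)) \<le> norm (indicator (box a b) x *\<^sub>R u x)"
          using box_bump_le_1[of a b n x] box_bump_outside[of x a b n]
          by (cases "x \<in> box a b") (auto simp: norm_mult mult_left_le)
      qed
    qed auto
    then show ?thesis unfolding ortho[OF test_fn_box_bump] using LIMSEQ_unique tendsto_const by metis
  qed
  \<comment> \<open>Functions in L^2 are integrable on bounded sets but perhaps not globally, so the
    argument runs inside one bounded box at a time.\<close>
  have "AE x in lborel. indicator (box (- (real n *\<^sub>R One)) (real n *\<^sub>R One)) x *\<^sub>R u x = 0" for n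
  proof (rule sigma_finite_measure.density_zero[OF sigma_finite_lborel])
    let ?Q = "box (- (real n *\<^sub>R One)) (real n *\<^sub>R One) :: pt set"
    let ?f = "\<lambda>x. indicator ?Q x *\<^sub>R u x"
    show int: "integrable lborel ?f" by (rule loc) auto
    let ?G = "range (\<lambda>(a, b). box a b :: pt set)"
    have "integral\<^sup>L lborel (\<lambda>x. indicator A x *\<^sub>R ?f x) = 0" if "A \<in> sigma_sets UNIV ?G" for A
      using _ _ that
    proof (rule sigma_sets_induct_disjoint)
      show "Int_stable ?G" by (auto simp: Int_stable_def box_Int_box)
      show "integral\<^sup>L lborel (\<lambda>x. indicator {} x *\<^sub>R ?f x) = 0" by simp
    next
      fix A assume "A \<in> ?G"
      then obtain a b where A: "A = box a b" by auto
      obtain c d where "A \<inter> ?Q = box c d" unfolding A box_Int_box by blast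
      then have "indicat_real A x * indicat_real ?Q x = indicat_real (box c d) x" for x
        by (metis indicator_inter_arith)
      then have "(\<lambda>x. indicator A x *\<^sub>R ?f x) = (\<lambda>x. indicator (box c d) x *\<^sub>R u x)"
        unfolding scaleR_scaleR by simp
      then show "integral\<^sup>L lborel (\<lambda>x. indicator A x *\<^sub>R ?f x) = 0" by (simp only: box0)
    next
      fix A assume A: "A \<in> sigma_sets UNIV ?G" and 0: "integral\<^sup>L lborel (\<lambda>x. indicator A x *\<^sub>R ?f x) = 0"
      then have m: "A \<in> sets lborel" by (simp add: borel_eq_box)
      have "indicator (UNIV - A) x *\<^sub>R ?f x = ?f x - indicator A x *\<^sub>R ?f x" for x
        by (simp add: indicator_def)
      then have eq: "integral\<^sup>L lborel (\<lambda>x. indicator (UNIV - A) x *\<^sub>R ?f x) =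
          integral\<^sup>L lborel ?f - integral\<^sup>L lborel (\<lambda>x. indicator A x *\<^sub>R ?f x)"
        using Bochner_Integration.integral_diff[OF int integrable_mult_indicator[OF m int]] by simp
      then show "integral\<^sup>L lborel (\<lambda>x. indicator (UNIV - A) x *\<^sub>R ?f x) = 0"
        unfolding eq 0 box0 by simp
    next
      fix A :: "nat \<Rightarrow> pt set"
      assume dj: "disjoint_family A" and A: "range A \<subseteq> sigma_sets UNIV ?G"
        and 0: "\<And>i. integral\<^sup>L lborel (\<lambda>x. indicator (A i) x *\<^sub>R ?f x) = 0"
      have m: "A i \<in> sets lborel" for i using A by (auto simp: borel_eq_box)
      have "set_integrable lborel (\<Union>i. A i) ?f"
        unfolding set_integrable_def by (intro integrable_mult_indicator int sets.countable_UN) (use m in blast)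
      then have eq: "set_lebesgue_integral lborel (\<Union>i. A i) ?f = (\<Sum>i. set_lebesgue_integral lborel (A i) ?f)"
        using m dj by (intro lebesgue_integral_countable_add) (auto simp only: disjoint_family_on_def)
      show "integral\<^sup>L lborel (\<lambda>x. indicator (\<Union>i. A i) x *\<^sub>R ?f x) = 0"
        using eq unfolding set_lebesgue_integral_def 0 by simp
    qed auto
    then show "set_lebesgue_integral lborel A ?f = 0" if "A \<in> sets lborel" for A
      using that by (simp add: set_lebesgue_integral_def borel_eq_box)
  qed
  then have "AE x in lborel. \<forall>n. indicator (box (- (real n *\<^sub>R One)) (real n *\<^sub>R One)) x *\<^sub>R u x = 0"
    unfolding AE_all_countable by blast
  then show ?thesis
  proof eventually_elim
    case (elim x)
    obtain n where "x \<in> box (- (real n *\<^sub>R One)) (real n *\<^sub>R One)"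
      using UN_box_eq_UNIV by blast
    with elim show ?case by (metis indicator_simps(1) scaleR_one)
  qed
qed

section \<open>Completeness of \<open>L\<^sup>2\<close>\<close>

lemma nn_integral_sq: "L2 f \<Longrightarrow> (\<integral>\<^sup>+x. ennreal ((norm (f x))\<^sup>2) \<partial>lborel) = ennreal ((l2norm f)\<^sup>2)"
  by (simp add: l2norm_sq nn_integral_eq_integral L2_integrable_sq)

lemma L2_nn_integralI:
  assumes [measurable]: "f \<in> borel_measurable borel"
    and "(\<integral>\<^sup>+x. ennreal ((norm (f x))\<^sup>2) \<partial>lborel) \<le> ennreal (c\<^sup>2)" "0 \<le> c"
  shows "L2 f" "l2norm f \<le> c"
proof -
  have "integrable lborel (\<lambda>x. (norm (f x))\<^sup>2)"
  proof (rule integrableI_nonneg)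
    show "(\<integral>\<^sup>+x. ennreal ((norm (f x))\<^sup>2) \<partial>lborel) < \<infinity>"
      using assms(2) ennreal_less_top le_less_trans by fastforce
  qed auto
  then show L: "L2 f" by (simp add: L2_def)
  show "l2norm f \<le> c"
    using assms(2,3) unfolding nn_integral_sq[OF L] by (auto simp: ennreal_le_iff intro: power2_le_imp_le)
qed

lemma cauchy_subseq_fast:
  fixes D :: "nat \<Rightarrow> nat \<Rightarrow> real"
  assumes "\<And>e. 0 < e \<Longrightarrow> \<exists>N. \<forall>m\<ge>N. \<forall>n\<ge>N. D m n < e"
  obtains r :: "nat \<Rightarrow> nat" where "strict_mono r" "\<And>k m n. r k \<le> m \<Longrightarrow> r k \<le> n \<Longrightarrow> D m n < (1/4)^k"
proof -
  have "\<exists>N. \<forall>m\<ge>N. \<forall>n\<ge>N. D m n < (1/4)^k" for k by (rule assms) simp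
  then obtain N where N: "\<And>k m n. N k \<le> m \<Longrightarrow> N k \<le> n \<Longrightarrow> D m n < (1/4)^k" by metis
  \<comment> \<open>Summing the thresholds makes \<open>r k\<close> dominate all of them up to k;
    the extra k makes \<open>r\<close> strictly increasing.\<close>
  define r where "r k = (\<Sum>i\<le>k. N i) + k" for k
  show ?thesis
  proof (rule that[of r])
    show "strict_mono r" by (rule strict_mono_Suc_iff[THEN iffD2]) (simp add: r_def)
    have "N k \<le> r k" for k
      using member_le_sum[of k "{..k}" N] by (simp add: r_def)
    then show "D m n < (1/4)^k" if "r k \<le> m" "r k \<le> n" for k m n
      using N that order_trans by blast
  qed
qed

text \<open>A rapidly Cauchy subsequence converges pointwise almost everywhere, and Fatou's lemma
  turns its pointwise limit into the norm limit of the whole sequence.\<close>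

lemma L2_complete:
  assumes u: "\<And>n. L2 (u n)"
    and cauchy: "\<And>e. 0 < e \<Longrightarrow> \<exists>N. \<forall>m\<ge>N. \<forall>n\<ge>N. l2norm (\<lambda>x. u m x - u n x) < e"
  shows "\<exists>f. L2 f \<and> (\<lambda>n. l2norm (\<lambda>x. u n x - f x)) \<longlonglongrightarrow> 0"
proof -
  note [measurable] = L2_measurable[OF u]
  obtain r where r: "strict_mono r"
    "\<And>k m n. r k \<le> m \<Longrightarrow> r k \<le> n \<Longrightarrow> l2norm (\<lambda>x. u m x - u n x) < (1/4)^k"
    using cauchy_subseq_fast[OF cauchy] by metis
  define d where "d k x = u (r (Suc k)) x - u (r k) x" for k x
  have d: "L2 (d k)" for k unfolding d_def by (intro L2_diff u)
  note [measurable] = L2_measurable[OF d]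
  have dn: "l2norm (d k) \<le> (1/4)^k" for k
    unfolding d_def using r(2)[of k "r (Suc k)" "r k"] strict_mono_leD[OF r(1), of k "Suc k"] by simp
  \<comment> \<open>With the weight 2^k the terms integrate to at most (2/16)^k = (1/8)^k, and
    finiteness of the sum at a point puts |d k x| below a geometric sequence of ratio 1/sqrt
    2.\<close>
  have "(\<integral>\<^sup>+x. (\<Sum>k. ennreal (2^k * (norm (d k x))\<^sup>2)) \<partial>lborel) = (\<Sum>k. \<integral>\<^sup>+x. ennreal (2^k * (norm (d k x))\<^sup>2) \<partial>lborel)"
    by (rule nn_integral_suminf) simp
  also have "\<dots> \<le> (\<Sum>k. ennreal ((1/8)^k))"
  proof (rule suminf_le)
    fix k
    have "(\<integral>\<^sup>+x. ennreal (2^k * (norm (d k x))\<^sup>2) \<partial>lborel) = ennreal (2^k) * ennreal ((l2norm (d k))\<^sup>2)"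
      by (simp add: ennreal_mult nn_integral_cmult nn_integral_sq[OF d])
    also have "\<dots> \<le> ennreal (2^k) * ennreal (((1/4)^k)\<^sup>2)"
      by (intro mult_left_mono ennreal_leI power_mono dn l2norm_nonneg) simp
    also have "\<dots> = ennreal ((1/8)^k)"
    proof -
      have "(2::real)^k * (((1/4)^k)\<^sup>2) = (2 * ((1/4) * (1/4)))^k" by (simp only: power_mult_distrib power2_eq_square)
      then show ?thesis by (simp flip: ennreal_mult)
    qed
    finally show "(\<integral>\<^sup>+x. ennreal (2^k * (norm (d k x))\<^sup>2) \<partial>lborel) \<le> ennreal ((1/8)^k)" .
  qed auto
  also have "\<dots> = ennreal (\<Sum>k. (1/8)^k)" by (rule suminf_ennreal2) auto
  also have "\<dots> < \<infinity>" by simp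
  finally have fin: "AE x in lborel. (\<Sum>k. ennreal (2^k * (norm (d k x))\<^sup>2)) \<noteq> \<infinity>"
    by (intro nn_integral_PInf_AE) auto
  have conv: "AE x in lborel. convergent (\<lambda>k. u (r k) x)"
    using fin
  proof eventually_elim
    case (elim x)
    have "\<exists>c. y = ennreal c \<and> 0 \<le> c" if "y \<noteq> \<infinity>" for y
      using that by (cases y) auto
    from this[OF elim] obtain c where c: "(\<Sum>k. ennreal (2^k * (norm (d k x))\<^sup>2)) = ennreal c" "0 \<le> c"
      by blast
    have bd: "norm (d k x) \<le> sqrt c * (1 / sqrt 2)^k" for k
    proof -
      have "ennreal (2^k * (norm (d k x))\<^sup>2) \<le> ennreal c"
      proof -
        define F where "F k = ennreal (2^k * (norm (d k x))\<^sup>2)" for k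
        have "sum F {k} \<le> suminf F" by (rule sum_le_suminf) auto
        moreover have "suminf F = ennreal c" using c(1) by (simp only: F_def[abs_def])
        ultimately show ?thesis by (simp add: F_def)
      qed
      then have "2^k * (norm (d k x))\<^sup>2 \<le> c" using c(2) by simp
      then have "(norm (d k x))\<^sup>2 \<le> c * (1 / 2)^k" by (simp add: field_simps power_divide)
      then have "sqrt ((norm (d k x))\<^sup>2) \<le> sqrt (c * (1 / 2)^k)" by (rule real_sqrt_le_mono)
      then show ?thesis by (simp add: real_sqrt_mult real_sqrt_power real_sqrt_divide power_divide)
    qed
    have "summable (\<lambda>k. sqrt c * (1 / sqrt 2)^k)"
      by (intro summable_mult summable_geometric) (simp add: real_less_rsqrt)
    then have "summable (\<lambda>k. d k x)" by (rule summable_comparison_test') (rule bd)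
    then have "convergent (\<lambda>n. \<Sum>k<n. d k x)" by (simp add: summable_iff_convergent)
    moreover have "(\<Sum>k<n. d k x) = u (r n) x - u (r 0) x" for n
      unfolding d_def by (rule sum_lessThan_telescope)
    ultimately have "convergent (\<lambda>n. (u (r n) x - u (r 0) x) + u (r 0) x)"
      using convergent_add[OF _ convergent_const, of "\<lambda>n. \<Sum>k<n. d k x" "u (r 0) x"] by simp
    then show ?case by simp
  qed
  define f where "f x = lim (\<lambda>k. u (r k) x)" for x
  have [measurable]: "f \<in> borel_measurable borel" unfolding f_def by (rule borel_measurable_lim_metric) simp
  have est: "L2 (\<lambda>x. u m x - f x) \<and> l2norm (\<lambda>x. u m x - f x) \<le> e"
    if e: "0 < e" and N: "\<And>m n. N \<le> m \<Longrightarrow> N \<le> n \<Longrightarrow> l2norm (\<lambda>x. u m x - u n x) < e" and m: "N \<le> m" for e N m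
  proof -
    \<comment> \<open>Fatou's lemma along the subsequence bounds the distance from
      \<open>u m\<close> to the limit for every late m, not only for members of the
      subsequence.\<close>
    have "(\<integral>\<^sup>+x. ennreal ((norm (u m x - f x))\<^sup>2) \<partial>lborel) =
        (\<integral>\<^sup>+x. liminf (\<lambda>k. ennreal ((norm (u m x - u (r k) x))\<^sup>2)) \<partial>lborel)"
    proof (rule nn_integral_cong_AE)
      show "AE x in lborel. ennreal ((norm (u m x - f x))\<^sup>2) = liminf (\<lambda>k. ennreal ((norm (u m x - u (r k) x))\<^sup>2))"
        using conv
      proof eventually_elim
        case (elim x)
        then have "(\<lambda>k. u (r k) x) \<longlonglongrightarrow> f x" unfolding f_def by (rule convergent_LIMSEQ_iff[THEN iffD1])
        then have "(\<lambda>k. ennreal ((norm (u m x - u (r k) x))\<^sup>2)) \<longlonglongrightarrow> ennreal ((norm (u m x - f x))\<^sup>2)"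
          by (intro tendsto_ennrealI tendsto_intros)
        from lim_imp_Liminf[OF sequentially_bot this] show ?case by (rule sym)
      qed
    qed
    also have "\<dots> \<le> liminf (\<lambda>k. \<integral>\<^sup>+x. ennreal ((norm (u m x - u (r k) x))\<^sup>2) \<partial>lborel)"
      by (rule nn_integral_liminf) simp
    also have "\<dots> \<le> limsup (\<lambda>k. \<integral>\<^sup>+x. ennreal ((norm (u m x - u (r k) x))\<^sup>2) \<partial>lborel)"
      by (rule Liminf_le_Limsup) simp
    also have "\<dots> \<le> ennreal (e\<^sup>2)"
    proof (rule Limsup_bounded)
      show "\<forall>\<^sub>F k in sequentially. (\<integral>\<^sup>+x. ennreal ((norm (u m x - u (r k) x))\<^sup>2) \<partial>lborel) \<le> ennreal (e\<^sup>2)"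
        unfolding eventually_sequentially
      proof (intro exI allI impI)
        fix k assume "N \<le> k"
        then have "N \<le> r k" using seq_suble[OF r(1), of k] by linarith
        then have "l2norm (\<lambda>x. u m x - u (r k) x) < e" using N m by blast
        then show "(\<integral>\<^sup>+x. ennreal ((norm (u m x - u (r k) x))\<^sup>2) \<partial>lborel) \<le> ennreal (e\<^sup>2)"
          unfolding nn_integral_sq[OF L2_diff[OF u u]] by (intro ennreal_leI power_mono l2norm_nonneg) simp
      qed
    qed
    finally show ?thesis using L2_nn_integralI[of "\<lambda>x. u m x - f x" e] e by simp
  qed
  have "L2 f"
  proof -
    obtain N where "\<And>m n. N \<le> m \<Longrightarrow> N \<le> n \<Longrightarrow> l2norm (\<lambda>x. u m x - u n x) < 1" using cauchy[of 1] by auto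
    from est[OF _ this, of N] have "L2 (\<lambda>x. u N x - f x)" by simp
    from L2_diff[OF u[of N] this] show ?thesis by simp
  qed
  moreover have "(\<lambda>n. l2norm (\<lambda>x. u n x - f x)) \<longlonglongrightarrow> 0"
  proof (rule LIMSEQ_I)
    fix e :: real assume e: "0 < e"
    obtain N where N: "\<And>m n. N \<le> m \<Longrightarrow> N \<le> n \<Longrightarrow> l2norm (\<lambda>x. u m x - u n x) < e/2" using cauchy[of "e/2"] e by auto
    have "norm (l2norm (\<lambda>x. u n x - f x) - 0) < e" if "N \<le> n" for n
      using est[OF _ N that] e l2norm_nonneg[of "\<lambda>x. u n x - f x"] by simp
    then show "\<exists>N. \<forall>n\<ge>N. norm (l2norm (\<lambda>x. u n x - f x) - 0) < e" by blast
  qed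
  ultimately show ?thesis by blast
qed

section \<open>Weak derivatives and the form on \<open>H\<^sup>1\<close>\<close>

lemma L2_pd_test_fn: "test_fn U f \<Longrightarrow> L2 (pd e f)"
  by (rule L2_test_fn[OF test_fn_pd])

lemma weak_partial_add:
  assumes "L2 u" "L2 v" "L2 g" "L2 h" "weak_partial e u g" "weak_partial e v h"
  shows "weak_partial e (\<lambda>x. u x + v x) (\<lambda>x. g x + h x)"
  using assms unfolding weak_partial_def
  by (simp add: distrib_right L2_prod_integrable L2_pd_test_fn L2_test_fn)

lemma weak_partial_scale:
  assumes "weak_partial e u g"
  shows "weak_partial e (\<lambda>x. c * u x) (\<lambda>x. c * g x)"
  using assms unfolding weak_partial_def by (simp add: mult.assoc)

lemma weak_partial_diff:
  assumes "L2 u" "L2 v" "L2 g" "L2 h" "weak_partial e u g" "weak_partial e v h"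
  shows "weak_partial e (\<lambda>x. u x - v x) (\<lambda>x. g x - h x)"
  using assms unfolding weak_partial_def
  by (simp add: left_diff_distrib L2_prod_integrable L2_pd_test_fn L2_test_fn)

lemma weak_partial_unique:
  assumes "L2 g" "L2 h" "weak_partial e u g" "weak_partial e u h"
  shows "AE x in lborel. g x = h x"
proof -
  have "AE x in lborel. g x - h x = 0"
  proof (rule L2_eq_0I)
    fix p :: "pt \<Rightarrow> real" assume p: "test_fn UNIV (\<lambda>x. complex_of_real (p x))"
    have "integral\<^sup>L lborel (\<lambda>x. g x * complex_of_real (p x)) = integral\<^sup>L lborel (\<lambda>x. h x * complex_of_real (p x))"
      using assms(3,4) p unfolding weak_partial_def by (metis minus_equation_iff)
    then show "integral\<^sup>L lborel (\<lambda>x. (g x - h x) * complex_of_real (p x)) = 0"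
      using assms(1,2) L2_test_fn[OF p] by (simp add: left_diff_distrib L2_prod_integrable)
  qed (intro L2_diff assms)
  then show ?thesis by simp
qed

lemma weak_partial_cong_AE:
  assumes "L2 u" "L2 v" "AE x in lborel. u x = v x" "weak_partial e u g"
  shows "weak_partial e v g"
  unfolding weak_partial_def
proof safe
  fix \<phi> assume \<phi>: "test_fn UNIV \<phi>"
  have "integral\<^sup>L lborel (\<lambda>x. v x * pd e \<phi> x) = integral\<^sup>L lborel (\<lambda>x. u x * pd e \<phi> x)"
    using assms(3) by (intro integral_cong_AE borel_measurable_integrable L2_prod_integrable L2_pd_test_fn[OF \<phi>] assms) auto
  then show "integral\<^sup>L lborel (\<lambda>x. v x * pd e \<phi> x) = - integral\<^sup>L lborel (\<lambda>x. g x * \<phi> x)"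
    using assms(4) \<phi> by (simp add: weak_partial_def)
qed

lemma wgrad:
  assumes "H1 u" "e \<in> Basis"
  shows "L2 (wgrad e u)" "weak_partial e u (wgrad e u)"
proof -
  have "\<exists>g. L2 g \<and> weak_partial e u g" using assms by (simp add: H1_def)
  from someI_ex[OF this] show "L2 (wgrad e u)" "weak_partial e u (wgrad e u)" by (auto simp: wgrad_def)
qed

text \<open>\<open>wgrad\<close> is a Hilbert choice among functions that agree almost everywhere,
  so every calculus rule for it is an identity almost everywhere.\<close>

lemma wgrad_AE_eq:
  assumes "L2 g" "weak_partial e u g"
  shows "AE x in lborel. wgrad e u x = g x"
proof -
  have "\<exists>g. L2 g \<and> weak_partial e u g" using assms by auto
  from someI_ex[OF this] have "L2 (wgrad e u)" "weak_partial e u (wgrad e u)" by (auto simp: wgrad_def)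
  then show ?thesis using weak_partial_unique assms by blast
qed

lemma H1_L2: "H1 u \<Longrightarrow> L2 u" by (simp add: H1_def)

lemma H1_add: "H1 u \<Longrightarrow> H1 v \<Longrightarrow> H1 (\<lambda>x. u x + v x)"
proof -
  assume u: "H1 u" and v: "H1 v"
  have "\<exists>g. L2 g \<and> weak_partial e (\<lambda>x. u x + v x) g" if e: "e \<in> Basis" for e
  proof -
    obtain g h where "L2 g" "weak_partial e u g" "L2 h" "weak_partial e v h"
      using u v e unfolding H1_def by blast
    then show ?thesis using u v
      by (intro exI[of _ "\<lambda>x. g x + h x"] conjI L2_add weak_partial_add) (auto simp: H1_def)
  qed
  then show ?thesis using u v by (auto simp: H1_def L2_add)
qed

lemma H1_scale: "H1 u \<Longrightarrow> H1 (\<lambda>x. c * u x)"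
proof -
  assume u: "H1 u"
  have "\<exists>g. L2 g \<and> weak_partial e (\<lambda>x. c * u x) g" if e: "e \<in> Basis" for e
  proof -
    obtain g where "L2 g" "weak_partial e u g" using u e unfolding H1_def by blast
    then show ?thesis by (intro exI[of _ "\<lambda>x. c * g x"] conjI L2_scale weak_partial_scale)
  qed
  then show ?thesis using u by (auto simp: H1_def L2_scale)
qed

lemma H1_diff: "H1 u \<Longrightarrow> H1 v \<Longrightarrow> H1 (\<lambda>x. u x - v x)"
proof -
  assume u: "H1 u" and v: "H1 v"
  have "\<exists>g. L2 g \<and> weak_partial e (\<lambda>x. u x - v x) g" if e: "e \<in> Basis" for e
  proof -
    obtain g h where "L2 g" "weak_partial e u g" "L2 h" "weak_partial e v h"
      using u v e unfolding H1_def by blast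
    then show ?thesis using u v
      by (intro exI[of _ "\<lambda>x. g x - h x"] conjI L2_diff weak_partial_diff) (auto simp: H1_def)
  qed
  then show ?thesis using u v by (auto simp: H1_def L2_diff)
qed

lemma wgrad_add:
  "H1 u \<Longrightarrow> H1 v \<Longrightarrow> e \<in> Basis \<Longrightarrow> AE x in lborel. wgrad e (\<lambda>x. u x + v x) x = wgrad e u x + wgrad e v x"
  by (intro wgrad_AE_eq L2_add weak_partial_add wgrad H1_L2)

lemma wgrad_diff:
  "H1 u \<Longrightarrow> H1 v \<Longrightarrow> e \<in> Basis \<Longrightarrow> AE x in lborel. wgrad e (\<lambda>x. u x - v x) x = wgrad e u x - wgrad e v x"
  by (intro wgrad_AE_eq L2_diff weak_partial_diff wgrad H1_L2)

lemma wgrad_scale: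
  "H1 u \<Longrightarrow> e \<in> Basis \<Longrightarrow> AE x in lborel. wgrad e (\<lambda>x. c * u x) x = c * wgrad e u x"
  by (intro wgrad_AE_eq L2_scale weak_partial_scale wgrad)

interpretation H1: psd_form H1 form1
proof
  fix u v w :: fn and c :: complex
  show "H1 u \<Longrightarrow> H1 v \<Longrightarrow> H1 (\<lambda>x. u x + v x)" by (rule H1_add)
  show "H1 u \<Longrightarrow> H1 (\<lambda>x. c * u x)" by (rule H1_scale)
  show "form1 (\<lambda>x. u x + v x) w = form1 u w + form1 v w" if u: "H1 u" and v: "H1 v" and w: "H1 w"
  proof -
    have "l2inner (wgrad e (\<lambda>x. u x + v x)) (wgrad e w) = l2inner (wgrad e u) (wgrad e w) + l2inner (wgrad e v) (wgrad e w)"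
      if e: "e \<in> Basis" for e
    proof -
      have "l2inner (wgrad e (\<lambda>x. u x + v x)) (wgrad e w) = l2inner (\<lambda>x. wgrad e u x + wgrad e v x) (wgrad e w)"
        using wgrad_add[OF u v e] u v w e by (intro l2inner_cong_AE wgrad L2_add H1_add) auto
      then show ?thesis using u v w e by (simp add: L2.B_add wgrad)
    qed
    then show ?thesis using u v w by (simp add: form1_def L2.B_add H1_L2 sum.distrib)
  qed
  show "form1 (\<lambda>x. c * u x) w = c * form1 u w" if u: "H1 u" and w: "H1 w"
  proof -
    have "l2inner (wgrad e (\<lambda>x. c * u x)) (wgrad e w) = c * l2inner (wgrad e u) (wgrad e w)"
      if e: "e \<in> Basis" for e
    proof -
      have "l2inner (wgrad e (\<lambda>x. c * u x)) (wgrad e w) = l2inner (\<lambda>x. c * wgrad e u x) (wgrad e w)"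
        using wgrad_scale[OF u e] u w e by (intro l2inner_cong_AE wgrad L2_scale H1_scale) auto
      then show ?thesis using u w e by (simp add: L2.B_scale wgrad)
    qed
    then show ?thesis using u w by (simp add: form1_def L2.B_scale H1_L2 distrib_left sum_distrib_left)
  qed
  show "form1 u v = cnj (form1 v u)" if u: "H1 u" and v: "H1 v"
  proof -
    have "l2inner (wgrad e u) (wgrad e v) = cnj (l2inner (wgrad e v) (wgrad e u))" if "e \<in> Basis" for e
      using u v that by (intro L2.B_sym wgrad)
    then show ?thesis using L2.B_sym[of u v] u v by (simp add: form1_def H1_L2)
  qed
  show "0 \<le> Re (form1 u u)"
    by (simp add: form1_def l2inner_self sum_nonneg del: of_real_power)
qed

lemma h1norm_nonneg: "0 \<le> h1norm u" by (simp add: h1norm_def add_nonneg_nonneg sum_nonneg)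

lemma h1norm_sq: "(h1norm u)\<^sup>2 = (l2norm u)\<^sup>2 + (\<Sum>e\<in>Basis. (l2norm (wgrad e u))\<^sup>2)"
  by (simp add: h1norm_def add_nonneg_nonneg sum_nonneg)

lemma H1_nrm [simp]: "H1.nrm = h1norm"
  by (auto simp: H1.nrm_def form1_def l2inner_self h1norm_def simp del: of_real_power)

lemmas form1_Cauchy_Schwarz = H1.Cauchy_Schwarz[unfolded H1_nrm]
lemmas h1norm_triangle = H1.nrm_triangle[unfolded H1_nrm]
lemmas h1norm_triangle_diff = H1.nrm_triangle_diff[unfolded H1_nrm]
lemmas h1norm_triangle_mid = H1.nrm_triangle_mid[unfolded H1_nrm]
lemmas h1norm_scale = H1.nrm_scale[unfolded H1_nrm]
lemmas h1norm_minus_commute = H1.nrm_minus_commute[unfolded H1_nrm]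
lemmas form1_self = H1.B_self[unfolded H1_nrm]

lemma l2norm_le_h1norm: "l2norm u \<le> h1norm u"
  by (rule power2_le_imp_le) (auto simp: h1norm_sq h1norm_nonneg sum_nonneg)

lemma l2norm_wgrad_le_h1norm: assumes "e \<in> Basis" shows "l2norm (wgrad e u) \<le> h1norm u"
proof (rule power2_le_imp_le)
  have "(l2norm (wgrad e u))\<^sup>2 \<le> (\<Sum>e\<in>Basis. (l2norm (wgrad e u))\<^sup>2)"
    using assms by (intro member_le_sum) auto
  also have "\<dots> \<le> (h1norm u)\<^sup>2" by (simp add: h1norm_sq)
  finally show "(l2norm (wgrad e u))\<^sup>2 \<le> (h1norm u)\<^sup>2" .
qed (rule h1norm_nonneg)

text \<open>For a fixed test function both sides of the defining identity are continuous in L^2, by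
  Cauchy-Schwarz.\<close>

lemma weak_partial_limit:
  assumes u: "\<And>n. L2 (u n)" "L2 v" "(\<lambda>n. l2norm (\<lambda>x. u n x - v x)) \<longlonglongrightarrow> 0"
    and g: "\<And>n. L2 (g n)" "L2 h" "(\<lambda>n. l2norm (\<lambda>x. g n x - h x)) \<longlonglongrightarrow> 0"
    and wp: "\<And>n. weak_partial e (u n) (g n)"
  shows "weak_partial e v h"
  unfolding weak_partial_def
proof safe
  fix \<phi> assume \<phi>: "test_fn UNIV \<phi>"
  have lim: "(\<lambda>n. integral\<^sup>L lborel (\<lambda>x. w n x * \<psi> x)) \<longlonglongrightarrow> integral\<^sup>L lborel (\<lambda>x. z x * \<psi> x)"
    if w: "\<And>n. L2 (w n)" and z: "L2 z" and lim: "(\<lambda>n. l2norm (\<lambda>x. w n x - z x)) \<longlonglongrightarrow> 0" and \<psi>: "L2 \<psi>" for w z \<psi>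
  proof -
    have "(\<lambda>n. l2inner (\<lambda>x. w n x - z x) (\<lambda>x. cnj (\<psi> x))) \<longlonglongrightarrow> 0"
    proof (rule tendsto_norm_zero_cancel, rule tendsto_sandwich[where f="\<lambda>_. 0"])
      show "\<forall>\<^sub>F n in sequentially. norm (l2inner (\<lambda>x. w n x - z x) (\<lambda>x. cnj (\<psi> x))) \<le>
          l2norm (\<lambda>x. w n x - z x) * l2norm (\<lambda>x. cnj (\<psi> x))"
        by (intro always_eventually allI l2_Cauchy_Schwarz L2_diff L2_cnj w z \<psi>)
      show "(\<lambda>n. l2norm (\<lambda>x. w n x - z x) * l2norm (\<lambda>x. cnj (\<psi> x))) \<longlonglongrightarrow> 0"
        using tendsto_mult[OF lim tendsto_const] by simp
    qed auto
    moreover have "l2inner (\<lambda>x. w n x - z x) (\<lambda>x. cnj (\<psi> x)) =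
        integral\<^sup>L lborel (\<lambda>x. w n x * \<psi> x) - integral\<^sup>L lborel (\<lambda>x. z x * \<psi> x)" for n
      using w z \<psi> by (simp add: l2inner_def left_diff_distrib L2_prod_integrable)
    ultimately show ?thesis by (simp add: LIM_zero_cancel)
  qed
  have "(\<lambda>n. integral\<^sup>L lborel (\<lambda>x. u n x * pd e \<phi> x)) \<longlonglongrightarrow> integral\<^sup>L lborel (\<lambda>x. v x * pd e \<phi> x)"
    by (rule lim[OF u L2_pd_test_fn[OF \<phi>]])
  moreover have "(\<lambda>n. - integral\<^sup>L lborel (\<lambda>x. g n x * \<phi> x)) \<longlonglongrightarrow> - integral\<^sup>L lborel (\<lambda>x. h x * \<phi> x)"
    by (intro tendsto_minus lim[OF g L2_test_fn[OF \<phi>]])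
  moreover have "integral\<^sup>L lborel (\<lambda>x. u n x * pd e \<phi> x) = - integral\<^sup>L lborel (\<lambda>x. g n x * \<phi> x)" for n
    using wp \<phi> by (simp add: weak_partial_def)
  ultimately show "integral\<^sup>L lborel (\<lambda>x. v x * pd e \<phi> x) = - integral\<^sup>L lborel (\<lambda>x. h x * \<phi> x)"
    using LIMSEQ_unique by auto
qed

lemma H1_complete:
  assumes u: "\<And>n. H1 (u n)"
    and cauchy: "\<And>e. 0 < e \<Longrightarrow> \<exists>N. \<forall>m\<ge>N. \<forall>n\<ge>N. h1norm (\<lambda>x. u m x - u n x) < e"
  shows "\<exists>f. H1 f \<and> (\<lambda>n. h1norm (\<lambda>x. u n x - f x)) \<longlonglongrightarrow> 0"
proof -
  have "\<exists>f. L2 f \<and> (\<lambda>n. l2norm (\<lambda>x. u n x - f x)) \<longlonglongrightarrow> 0"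
  proof (rule L2_complete)
    show "L2 (u n)" for n by (rule H1_L2[OF u])
    show "\<exists>N. \<forall>m\<ge>N. \<forall>n\<ge>N. l2norm (\<lambda>x. u m x - u n x) < e" if "0 < e" for e
      using cauchy[OF that] le_less_trans[OF l2norm_le_h1norm] by blast
  qed
  then obtain f where f: "L2 f" "(\<lambda>n. l2norm (\<lambda>x. u n x - f x)) \<longlonglongrightarrow> 0" by blast
  have wgd: "l2norm (wgrad e (\<lambda>x. u m x - v x)) = l2norm (\<lambda>x. wgrad e (u m) x - wgrad e v x)"
    if "e \<in> Basis" "H1 v" for e m v
    using wgrad_diff[OF u that(2,1)] by (intro l2norm_cong_AE L2_diff wgrad H1_diff u that)
  have "\<exists>g. L2 g \<and> (\<lambda>n. l2norm (\<lambda>x. wgrad e (u n) x - g x)) \<longlonglongrightarrow> 0" if e: "e \<in> Basis" for e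
  proof (rule L2_complete)
    show "L2 (wgrad e (u n))" for n by (rule wgrad[OF u e])
    fix c :: real assume "0 < c"
    from cauchy[OF this] obtain N where N: "\<And>m n. N \<le> m \<Longrightarrow> N \<le> n \<Longrightarrow> h1norm (\<lambda>x. u m x - u n x) < c" by blast
    have "l2norm (\<lambda>x. wgrad e (u m) x - wgrad e (u n) x) < c" if "N \<le> m" "N \<le> n" for m n
      using N[OF that] l2norm_wgrad_le_h1norm[OF e, of "\<lambda>x. u m x - u n x"] wgd[OF e u[of n], of m] by linarith
    then show "\<exists>N. \<forall>m\<ge>N. \<forall>n\<ge>N. l2norm (\<lambda>x. wgrad e (u m) x - wgrad e (u n) x) < c" by blast
  qed
  then have "\<forall>e\<in>Basis. \<exists>g. L2 g \<and> (\<lambda>n. l2norm (\<lambda>x. wgrad e (u n) x - g x)) \<longlonglongrightarrow> 0" by (rule ballI)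
  from bchoice[OF this] obtain g where
    "\<forall>e\<in>Basis. L2 (g e) \<and> (\<lambda>n. l2norm (\<lambda>x. wgrad e (u n) x - g e x)) \<longlonglongrightarrow> 0" ..
  then have g: "L2 (g e)" "(\<lambda>n. l2norm (\<lambda>x. wgrad e (u n) x - g e x)) \<longlonglongrightarrow> 0" if "e \<in> Basis" for e
    using that by blast+
  have wp: "weak_partial e f (g e)" if "e \<in> Basis" for e
    by (rule weak_partial_limit[OF H1_L2[OF u] f wgrad(1)[OF u that] g(1)[OF that] g(2)[OF that] wgrad(2)[OF u that]])
  have "H1 f" using f(1) g(1) wp by (auto simp: H1_def)
  moreover have "(\<lambda>n. h1norm (\<lambda>x. u n x - f x)) \<longlonglongrightarrow> 0"
  proof -
    have "l2norm (wgrad e (\<lambda>x. u n x - f x)) = l2norm (\<lambda>x. wgrad e (u n) x - g e x)" if e: "e \<in> Basis" for e n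
      unfolding wgd[OF e \<open>H1 f\<close>] using wgrad_AE_eq[OF g(1) wp, OF e e]
      by (intro l2norm_cong_AE L2_diff wgrad u e g(1) \<open>H1 f\<close>) auto
    then have "h1norm (\<lambda>x. u n x - f x) = sqrt ((l2norm (\<lambda>x. u n x - f x))\<^sup>2 +
        (\<Sum>e\<in>Basis. (l2norm (\<lambda>x. wgrad e (u n) x - g e x))\<^sup>2))" for n
      by (simp add: h1norm_def)
    moreover have "(\<lambda>n. sqrt ((l2norm (\<lambda>x. u n x - f x))\<^sup>2 +
        (\<Sum>e\<in>Basis. (l2norm (\<lambda>x. wgrad e (u n) x - g e x))\<^sup>2))) \<longlonglongrightarrow> sqrt (0\<^sup>2 + (\<Sum>e\<in>(Basis::pt set). 0\<^sup>2))"
      by (intro tendsto_intros f g)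
    ultimately show ?thesis by simp
  qed
  ultimately show ?thesis by blast
qed

text \<open>The Leibniz rule, obtained by pairing \<open>u\<close> with the test function
  \<open>\<theta> x * \<phi> x\<close>.\<close>

lemma weak_partial_smooth_mult:
  assumes \<theta>: "smooth \<theta>" and "L2 u" "L2 g" "weak_partial e u g"
  shows "weak_partial e (\<lambda>x. \<theta> x * u x) (\<lambda>x. \<theta> x * g x + pd e \<theta> x * u x)"
  unfolding weak_partial_def
proof safe
  fix \<phi> assume \<phi>: "test_fn UNIV \<phi>"
  have t: "test_fn UNIV (\<lambda>x. \<theta> x * \<phi> x)" "test_fn UNIV (\<lambda>x. \<theta> x * pd e \<phi> x)" "test_fn UNIV (\<lambda>x. pd e \<theta> x * \<phi> x)"
    using \<theta> \<phi> by (auto intro!: test_fn_smooth_mult smooth_pd test_fn_pd)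
  note int = L2_prod_integrable[OF assms(2) L2_test_fn[OF t(2)]] L2_prod_integrable[OF assms(2) L2_test_fn[OF t(3)]]
    L2_prod_integrable[OF assms(3) L2_test_fn[OF t(1)]]
  have "pd e (\<lambda>x. \<theta> x * \<phi> x) x = \<theta> x * pd e \<phi> x + pd e \<theta> x * \<phi> x" for x
    using \<theta> \<phi> by (intro pd_mult smooth_differentiable) (auto dest: test_fn_smooth)
  moreover have "integral\<^sup>L lborel (\<lambda>x. u x * pd e (\<lambda>x. \<theta> x * \<phi> x) x) = - integral\<^sup>L lborel (\<lambda>x. g x * (\<theta> x * \<phi> x))"
    using assms(4) t(1) unfolding weak_partial_def by blast
  ultimately have "integral\<^sup>L lborel (\<lambda>x. u x * (\<theta> x * pd e \<phi> x) + u x * (pd e \<theta> x * \<phi> x)) =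
      - integral\<^sup>L lborel (\<lambda>x. g x * (\<theta> x * \<phi> x))"
    by (simp only: distrib_left)
  then have "integral\<^sup>L lborel (\<lambda>x. u x * (\<theta> x * pd e \<phi> x)) =
      - (integral\<^sup>L lborel (\<lambda>x. g x * (\<theta> x * \<phi> x)) + integral\<^sup>L lborel (\<lambda>x. u x * (pd e \<theta> x * \<phi> x)))"
    using int by (simp add: eq_neg_iff_add_eq_0 algebra_simps)
  also have "\<dots> = - integral\<^sup>L lborel (\<lambda>x. g x * (\<theta> x * \<phi> x) + u x * (pd e \<theta> x * \<phi> x))"
    using int by simp
  finally show "integral\<^sup>L lborel (\<lambda>x. \<theta> x * u x * pd e \<phi> x) = - integral\<^sup>L lborel (\<lambda>x. (\<theta> x * g x + pd e \<theta> x * u x) * \<phi> x)"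
    by (simp add: algebra_simps)
qed

section \<open>Multiplication of Sobolev functions by smooth factors\<close>

definition C1_bounded :: "real \<Rightarrow> fn \<Rightarrow> bool" where
  "C1_bounded C \<theta> \<longleftrightarrow> smooth \<theta> \<and> (\<forall>x. norm (\<theta> x) \<le> C) \<and> (\<forall>e\<in>Basis. \<forall>x. norm (pd e \<theta> x) \<le> C)"

lemma smooth_measurable: "smooth f \<Longrightarrow> f \<in> borel_measurable borel"
  by (intro borel_measurable_continuous_onI smooth_continuous_on)

lemma
  assumes \<theta>: "C1_bounded C \<theta>" and u: "H1 u"
  shows H1_mult: "H1 (\<lambda>x. \<theta> x * u x)"
    and wgrad_mult: "\<And>e. e \<in> Basis \<Longrightarrow>
      AE x in lborel. wgrad e (\<lambda>x. \<theta> x * u x) x = \<theta> x * wgrad e u x + pd e \<theta> x * u x"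
    and h1norm_mult: "h1norm (\<lambda>x. \<theta> x * u x) \<le> 3 * C * h1norm u"
proof -
  have sm: "smooth \<theta>" and b: "\<And>x. norm (\<theta> x) \<le> C" "\<And>e x. e \<in> Basis \<Longrightarrow> norm (pd e \<theta> x) \<le> C"
    using \<theta> by (auto simp: C1_bounded_def)
  have C: "0 \<le> C" using b(1) norm_ge_zero order_trans by blast
  have L: "L2 (\<lambda>x. \<theta> x * v x)" if "L2 v" for v
    by (rule L2_mult_bounded[OF that smooth_measurable[OF sm] b(1)])
  have Lp: "L2 (\<lambda>x. pd e \<theta> x * v x)" if "L2 v" "e \<in> Basis" for v e
    by (rule L2_mult_bounded[OF that(1) smooth_measurable[OF smooth_pd[OF sm]] b(2)[OF that(2)]])
  have L2w: "L2 (\<lambda>x. \<theta> x * wgrad e u x + pd e \<theta> x * u x)" if "e \<in> Basis" for e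
    using that u by (intro L2_add L Lp wgrad H1_L2)
  have wp: "weak_partial e (\<lambda>x. \<theta> x * u x) (\<lambda>x. \<theta> x * wgrad e u x + pd e \<theta> x * u x)" if "e \<in> Basis" for e
    using that u by (intro weak_partial_smooth_mult sm wgrad H1_L2)
  show H: "H1 (\<lambda>x. \<theta> x * u x)"
    unfolding H1_def using L2w wp L[OF H1_L2[OF u]] by blast
  show AE: "AE x in lborel. wgrad e (\<lambda>x. \<theta> x * u x) x = \<theta> x * wgrad e u x + pd e \<theta> x * u x" if "e \<in> Basis" for e
    by (rule wgrad_AE_eq[OF L2w wp]) fact+
  have n1: "l2norm (\<lambda>x. \<theta> x * u x) \<le> C * h1norm u"
  proof -
    have "l2norm (\<lambda>x. \<theta> x * u x) \<le> C * l2norm u"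
      using b(1) by (intro l2norm_mono L H1_L2 u C) (auto simp: norm_mult intro!: mult_right_mono)
    also have "\<dots> \<le> C * h1norm u" by (intro mult_left_mono l2norm_le_h1norm C)
    finally show ?thesis .
  qed
  have n2: "l2norm (wgrad e (\<lambda>x. \<theta> x * u x)) \<le> 2 * C * h1norm u" if e: "e \<in> Basis" for e
  proof -
    have "l2norm (wgrad e (\<lambda>x. \<theta> x * u x)) = l2norm (\<lambda>x. \<theta> x * wgrad e u x + pd e \<theta> x * u x)"
      using AE[OF e] by (intro l2norm_cong_AE L2w wgrad H e) auto
    also have "\<dots> \<le> l2norm (\<lambda>x. \<theta> x * wgrad e u x) + l2norm (\<lambda>x. pd e \<theta> x * u x)"
      using u e by (intro l2norm_triangle L Lp wgrad H1_L2)
    also have "\<dots> \<le> C * l2norm (wgrad e u) + C * l2norm u"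
      using b(1) b(2)[OF e] u e
      by (intro add_mono l2norm_mono L Lp wgrad H1_L2 C) (auto simp: norm_mult intro!: mult_right_mono)
    also have "\<dots> \<le> C * h1norm u + C * h1norm u"
      by (intro add_mono mult_left_mono l2norm_le_h1norm l2norm_wgrad_le_h1norm e C)
    finally show ?thesis by simp
  qed
  show "h1norm (\<lambda>x. \<theta> x * u x) \<le> 3 * C * h1norm u"
  proof (rule power2_le_imp_le)
    \<comment> \<open>One value term and two gradient terms, the plane having two basis directions:
      C^2 + 2 (2 C)^2 = (3 C)^2.\<close>
    have "(h1norm (\<lambda>x. \<theta> x * u x))\<^sup>2 \<le> (C * h1norm u)\<^sup>2 + (\<Sum>e\<in>(Basis::pt set). (2 * C * h1norm u)\<^sup>2)"
      unfolding h1norm_sq by (intro add_mono sum_mono power_mono n1 n2 l2norm_nonneg)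
    also have "\<dots> = (3 * C * h1norm u)\<^sup>2" by (simp add: power_mult_distrib)
    finally show "(h1norm (\<lambda>x. \<theta> x * u x))\<^sup>2 \<le> (3 * C * h1norm u)\<^sup>2" .
  qed (simp add: C h1norm_nonneg)
qed

lemma weak_partial_test_fn:
  assumes f: "test_fn U f" shows "weak_partial e f (pd e f)"
  unfolding weak_partial_def
proof safe
  fix \<phi> assume \<phi>: "test_fn UNIV \<phi>"
  have f: "test_fn UNIV f" using test_fn_mono[OF f] by simp
  have "pd e (\<lambda>x. f x * \<phi> x) x = f x * pd e \<phi> x + pd e f x * \<phi> x" for x
    using f \<phi> by (intro pd_mult smooth_differentiable) (auto dest: test_fn_smooth)
  then have "integral\<^sup>L lborel (\<lambda>x. f x * pd e \<phi> x + pd e f x * \<phi> x) = 0"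
    using integral_pd_test_fn[OF test_fn_smooth_mult[OF test_fn_smooth[OF f] \<phi>], of e]
    by (metis (no_types, lifting) ext)
  then show "integral\<^sup>L lborel (\<lambda>x. f x * pd e \<phi> x) = - integral\<^sup>L lborel (\<lambda>x. pd e f x * \<phi> x)"
    using f \<phi> by (simp add: L2_prod_integrable L2_test_fn L2_pd_test_fn eq_neg_iff_add_eq_0)
qed

lemma H1_test_fn: "test_fn U f \<Longrightarrow> H1 f"
  unfolding H1_def using L2_test_fn L2_pd_test_fn weak_partial_test_fn by blast

lemma wgrad_test_fn: "test_fn U f \<Longrightarrow> AE x in lborel. wgrad e f x = pd e f x"
  by (intro wgrad_AE_eq L2_pd_test_fn weak_partial_test_fn)

section \<open>The space \<open>H\<^sup>1\<^sub>0\<close>\<close>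

lemma h1norm_0: "h1norm (\<lambda>x. 0) = 0"
  using h1norm_scale[OF H1_test_fn[OF test_fn_0], of 0] by simp

lemma H10_H1: "H10 Y u \<Longrightarrow> H1 u" by (simp add: H10_def)

text \<open>Trading the approximating sequence for an epsilon spares diagonal sequences in the
  closure properties below.\<close>

lemma H10_iff: "H10 Y u \<longleftrightarrow> H1 u \<and> (\<forall>e>0. \<exists>\<phi>. test_fn Y \<phi> \<and> h1norm (\<lambda>x. u x - \<phi> x) < e)"
proof safe
  fix e :: real assume "H10 Y u" "0 < e"
  then obtain \<phi> where \<phi>: "\<And>n. test_fn Y (\<phi> n)" "(\<lambda>n. h1norm (\<lambda>x. u x - \<phi> n x)) \<longlonglongrightarrow> 0"
    by (auto simp: H10_def)
  from order_tendstoD(2)[OF \<phi>(2) \<open>0 < e\<close>] obtain n where "h1norm (\<lambda>x. u x - \<phi> n x) < e"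
    by (auto simp: eventually_sequentially)
  then show "\<exists>\<phi>. test_fn Y \<phi> \<and> h1norm (\<lambda>x. u x - \<phi> x) < e" using \<phi>(1) by blast
next
  assume u: "H1 u" and *: "\<forall>e>0. \<exists>\<phi>. test_fn Y \<phi> \<and> h1norm (\<lambda>x. u x - \<phi> x) < e"
  have "\<exists>\<phi>. test_fn Y \<phi> \<and> h1norm (\<lambda>x. u x - \<phi> x) < 1 / real (Suc n)" for n
    using * by simp
  then obtain \<phi> where \<phi>: "\<And>n. test_fn Y (\<phi> n)" "\<And>n. h1norm (\<lambda>x. u x - \<phi> n x) < 1 / real (Suc n)" by metis
  have "(\<lambda>n. h1norm (\<lambda>x. u x - \<phi> n x)) \<longlonglongrightarrow> 0"
    by (rule tendsto_sandwich[OF _ _ tendsto_const LIMSEQ_inverse_real_of_nat[unfolded inverse_eq_divide]])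
      (intro always_eventually allI h1norm_nonneg less_imp_le[OF \<phi>(2)])+
  then show "H10 Y u" using u \<phi>(1) by (auto simp: H10_def)
qed (simp add: H10_def)

lemma H10_test_fn: "test_fn Y f \<Longrightarrow> H10 Y f"
  by (auto simp: H10_iff H1_test_fn h1norm_0 intro!: exI[of _ f])

lemma H10_closed:
  assumes "H1 f" and *: "\<And>e. 0 < e \<Longrightarrow> \<exists>u. H10 Y u \<and> h1norm (\<lambda>x. f x - u x) < e"
  shows "H10 Y f"
  unfolding H10_iff
proof (intro conjI allI impI)
  fix e :: real assume e: "0 < e"
  obtain u where u: "H10 Y u" "h1norm (\<lambda>x. f x - u x) < e/2" using *[of "e/2"] e by auto
  obtain \<phi> where \<phi>: "test_fn Y \<phi>" "h1norm (\<lambda>x. u x - \<phi> x) < e/2"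
    using u(1) e unfolding H10_iff by (meson half_gt_zero)
  have "h1norm (\<lambda>x. f x - \<phi> x) < e"
    using h1norm_triangle_mid[OF assms(1) H10_H1[OF u(1)] H1_test_fn[OF \<phi>(1)]] u(2) \<phi>(2) by simp
  then show "\<exists>\<phi>. test_fn Y \<phi> \<and> h1norm (\<lambda>x. f x - \<phi> x) < e" using \<phi>(1) by blast
qed fact

lemma H10_add: assumes "H10 Y u" "H10 Y v" shows "H10 Y (\<lambda>x. u x + v x)"
  unfolding H10_iff
proof (intro conjI allI impI)
  fix e :: real assume e: "0 < e"
  obtain \<phi> where \<phi>: "test_fn Y \<phi>" "h1norm (\<lambda>x. u x - \<phi> x) < e/2"
    using assms(1) e unfolding H10_iff by (meson half_gt_zero)
  obtain \<psi> where \<psi>: "test_fn Y \<psi>" "h1norm (\<lambda>x. v x - \<psi> x) < e/2"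
    using assms(2) e unfolding H10_iff by (meson half_gt_zero)
  have "h1norm (\<lambda>x. (u x - \<phi> x) + (v x - \<psi> x)) \<le> h1norm (\<lambda>x. u x - \<phi> x) + h1norm (\<lambda>x. v x - \<psi> x)"
    using assms \<phi>(1) \<psi>(1) by (intro h1norm_triangle H1_diff H10_H1 H1_test_fn)
  then have "h1norm (\<lambda>x. u x + v x - (\<phi> x + \<psi> x)) < e" using \<phi>(2) \<psi>(2) by (simp add: algebra_simps)
  then show "\<exists>\<phi>. test_fn Y \<phi> \<and> h1norm (\<lambda>x. u x + v x - \<phi> x) < e"
    using test_fn_add[OF \<phi>(1) \<psi>(1)] by blast
qed (intro H1_add H10_H1[OF assms(1)] H10_H1[OF assms(2)])

text \<open>Multipliers may be supported in \<open>Y\<close> while the function itself is unrestricted, which is how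
  \<open>H\<^sup>1\<close> functions are cut off away from the obstacle.\<close>

lemma H10_mult:
  assumes \<theta>: "C1_bounded C \<theta>" and u: "H10 U u"
    and Y: "\<And>\<phi>. test_fn U \<phi> \<Longrightarrow> test_fn Y (\<lambda>x. \<theta> x * \<phi> x)"
  shows "H10 Y (\<lambda>x. \<theta> x * u x)"
  unfolding H10_iff
proof (intro conjI allI impI)
  fix e :: real assume e: "0 < e"
  have C: "0 \<le> C" using \<theta> norm_ge_zero order_trans unfolding C1_bounded_def by blast
  \<comment> \<open>Multiplication costs a factor 3 C; the added 1 keeps the divisor positive when C
    is 0.\<close>
  obtain \<phi> where \<phi>: "test_fn U \<phi>" "h1norm (\<lambda>x. u x - \<phi> x) < e / (3 * C + 1)"
    using u e C unfolding H10_iff by (meson add_nonneg_pos divide_pos_pos mult_nonneg_nonneg zero_le_numeral zero_less_one)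
  have "h1norm (\<lambda>x. \<theta> x * (u x - \<phi> x)) \<le> 3 * C * h1norm (\<lambda>x. u x - \<phi> x)"
    using \<phi>(1) u by (intro h1norm_mult[OF \<theta>] H1_diff H10_H1 H1_test_fn)
  also have "\<dots> \<le> (3 * C + 1) * h1norm (\<lambda>x. u x - \<phi> x)" by (simp add: distrib_right h1norm_nonneg)
  also have "\<dots> < e" using \<phi>(2) C by (simp add: field_simps)
  finally have "h1norm (\<lambda>x. \<theta> x * u x - \<theta> x * \<phi> x) < e" by (simp add: algebra_simps)
  then show "\<exists>\<phi>. test_fn Y \<phi> \<and> h1norm (\<lambda>x. \<theta> x * u x - \<phi> x) < e" using Y[OF \<phi>(1)] by blast
qed (intro H1_mult[OF \<theta>] H10_H1[OF u])

lemma C1_bounded_const: "C1_bounded (norm c) (\<lambda>x. c)"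
  by (auto simp: C1_bounded_def smooth_const)

lemma H10_scale: "H10 Y u \<Longrightarrow> H10 Y (\<lambda>x. c * u x)"
  by (rule H10_mult[OF C1_bounded_const]) (auto intro: test_fn_scale)

interpretation H10: psd_form "H10 Y" form1 for Y
  by unfold_locales (auto intro!: H10_add H10_scale H1.B_add H1.B_scale H1.B_sym H1.B_pos dest: H10_H1)

lemma H10_nrm [simp]: "H10.nrm = h1norm"
  by (auto simp: H10.nrm_def form1_def l2inner_self h1norm_def simp del: of_real_power)

lemma H10_complete:
  assumes u: "\<And>n. H10 Y (u n)"
    and cauchy: "\<And>e. 0 < e \<Longrightarrow> \<exists>N. \<forall>m\<ge>N. \<forall>n\<ge>N. h1norm (\<lambda>x. u m x - u n x) < e"
  shows "\<exists>f. H10 Y f \<and> (\<lambda>n. h1norm (\<lambda>x. u n x - f x)) \<longlonglongrightarrow> 0"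
proof -
  obtain f where f: "H1 f" "(\<lambda>n. h1norm (\<lambda>x. u n x - f x)) \<longlonglongrightarrow> 0"
    using H1_complete[OF H10_H1[OF u] cauchy] by blast
  have "H10 Y f"
  proof (rule H10_closed[OF f(1)])
    fix e :: real assume "0 < e"
    from order_tendstoD(2)[OF f(2) this] obtain n where "h1norm (\<lambda>x. u n x - f x) < e"
      by (auto simp: eventually_sequentially)
    then show "\<exists>u. H10 Y u \<and> h1norm (\<lambda>x. f x - u x) < e"
      using u h1norm_minus_commute[OF H10_H1[OF u] f(1)] by metis
  qed
  then show ?thesis using f(2) by blast
qed

section \<open>Riesz representation in the energy spaces\<close>

lemma l2inner_functional:
  assumes f: "L2 f"
  shows "H1 u \<Longrightarrow> H1 v \<Longrightarrow> l2inner f (\<lambda>x. u x + v x) = l2inner f u + l2inner f v"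
    and "H1 u \<Longrightarrow> l2inner f (\<lambda>x. c * u x) = cnj c * l2inner f u"
    and "H1 u \<Longrightarrow> cmod (l2inner f u) \<le> l2norm f * h1norm u"
proof -
  show "H1 u \<Longrightarrow> H1 v \<Longrightarrow> l2inner f (\<lambda>x. u x + v x) = l2inner f u + l2inner f v"
    by (intro L2.B_add_right[OF _ _ f] H1_L2)
  show "H1 u \<Longrightarrow> l2inner f (\<lambda>x. c * u x) = cnj c * l2inner f u"
    by (intro L2.B_scale_right[OF _ f] H1_L2)
  show "cmod (l2inner f u) \<le> l2norm f * h1norm u" if "H1 u"
  proof -
    have "cmod (l2inner f u) \<le> l2norm f * l2norm u" by (rule l2_Cauchy_Schwarz[OF f H1_L2[OF that]])
    also have "\<dots> \<le> l2norm f * h1norm u" by (intro mult_left_mono l2norm_le_h1norm l2norm_nonneg)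
    finally show ?thesis .
  qed
qed

lemma H1_Riesz:
  assumes "L2 f" shows "\<exists>u. H1 u \<and> (\<forall>v. H1 v \<longrightarrow> form1 u v = l2inner f v)"
  using l2inner_functional[OF assms] H1_complete
  by (intro H1.Riesz[OF H1_test_fn[OF test_fn_0], where C="l2norm f"]) (simp_all only: H1_nrm)

lemma H10_Riesz:
  assumes "L2 f" shows "\<exists>u. H10 Y u \<and> (\<forall>v. H10 Y v \<longrightarrow> form1 u v = l2inner f v)"
  using l2inner_functional(1)[OF assms H10_H1 H10_H1] l2inner_functional(2,3)[OF assms H10_H1] H10_complete
  by (intro H10.Riesz[OF H10_test_fn[OF test_fn_0], where C="l2norm f"]) (simp_all only: H10_nrm)

text \<open>Orthogonal projection onto \<open>H10 Y\<close>, as Riesz representation of the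
  functional that \<open>w\<close> induces there; \<open>H10 Y\<close> is closed in
  \<open>H1\<close>, hence complete.\<close>

lemma H10_projection:
  assumes w: "H1 w" shows "\<exists>u. H10 Y u \<and> (\<forall>v. H10 Y v \<longrightarrow> form1 u v = form1 w v)"
  using H1.B_add_right[OF H10_H1 H10_H1 w] H1.B_scale_right[OF H10_H1 w] form1_Cauchy_Schwarz[OF w H10_H1] H10_complete
  by (intro H10.Riesz[OF H10_test_fn[OF test_fn_0], where C="h1norm w"]) (simp_all only: H10_nrm)

section \<open>Density of test functions in \<open>H\<^sup>1\<close>\<close>

text \<open>The convolution of \<open>v\<close> with the reflection of \<open>\<psi>\<close>. In
  this form its value at x pairs \<open>v\<close> with a shifted test function, so orthogonality to
  test functions can be exploited at every x.\<close>

definition corr :: "fn \<Rightarrow> fn \<Rightarrow> pt \<Rightarrow> complex" where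
  "corr v \<psi> x = integral\<^sup>L lborel (\<lambda>y. v y * \<psi> (y - x))"

lemma test_fn_shift: "test_fn UNIV \<psi> \<Longrightarrow> test_fn UNIV (\<lambda>y. \<psi> (y - x))"
  using test_fn_translate[of \<psi> "- x"] by simp

lemma corr_integrable:
  assumes "L2 v" "test_fn UNIV \<psi>" shows "integrable lborel (\<lambda>y. v y * \<psi> (y - x))"
  by (intro L2_prod_integrable assms L2_test_fn[OF test_fn_shift])

lemma norm_integral_prod_le:
  assumes "L2 f" "L2 g" shows "norm (integral\<^sup>L lborel (\<lambda>x. f x * g x)) \<le> l2norm f * l2norm g"
  using l2_Cauchy_Schwarz[OF assms(1) L2_cnj[OF assms(2)]] by (simp add: l2inner_def l2norm_def)

lemma corr_continuous:
  assumes v: "L2 v" and \<psi>: "test_fn UNIV \<psi>"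
  shows "continuous_on UNIV (corr v \<psi>)"
proof (rule continuous_at_imp_continuous_on, rule ballI)
  fix x :: pt
  obtain L where L: "0 \<le> L" "\<And>x w. norm (\<psi> (x + w) - \<psi> x) \<le> L * norm w"
    using test_fn_Lipschitz[OF \<psi>] by metis
  obtain B R where B: "0 \<le> R" "\<And>x. R < norm x \<Longrightarrow> \<psi> x = 0"
    using test_fn_bounds[OF \<psi>] by metis
  \<comment> \<open>For x' within distance 1 of x, this ball contains the supports of both shifted
    copies of \<open>\<psi>\<close>.\<close>
  let ?I = "\<lambda>y::pt. indicator (cball 0 (R + norm x + 1)) y :: complex"
  define c where "c = l2norm v * (L * l2norm ?I)"
  have est: "norm (corr v \<psi> x' - corr v \<psi> x) \<le> c * norm (x' - x)" if x': "dist x' x < 1" for x' :: pt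
  proof -
    have "l2norm (\<lambda>y. \<psi> (y - x') - \<psi> (y - x)) \<le> (L * norm (x' - x)) * l2norm ?I"
    proof (rule l2norm_mono[OF L2_indicator_cball])
      show "L2 (\<lambda>y. \<psi> (y - x') - \<psi> (y - x))" by (intro L2_diff L2_test_fn[OF test_fn_shift[OF \<psi>]])
      show "norm (\<psi> (y - x') - \<psi> (y - x)) \<le> (L * norm (x' - x)) * norm (?I y)" for y
      proof (cases "norm y \<le> R + norm x + 1")
        case True
        have "norm (\<psi> ((y - x) + (x - x')) - \<psi> (y - x)) \<le> L * norm (x - x')" by (rule L(2))
        then show ?thesis using True by (simp add: norm_minus_commute)
      next
        case False
        have "norm x' \<le> norm x + 1" using x' norm_triangle_ineq2[of x' x] by (simp add: dist_norm)
        then have "R < norm (y - x')" "R < norm (y - x)"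
          using False norm_triangle_ineq2[of y x'] norm_triangle_ineq2[of y x] by linarith+
        then show ?thesis using B L(1) by (simp add: mult_nonneg_nonneg)
      qed
    qed (use L in auto)
    moreover have "corr v \<psi> x' - corr v \<psi> x = integral\<^sup>L lborel (\<lambda>y. v y * (\<psi> (y - x') - \<psi> (y - x)))"
      unfolding corr_def right_diff_distrib
      by (rule Bochner_Integration.integral_diff[symmetric]) (intro corr_integrable v \<psi>)+
    moreover have "norm (integral\<^sup>L lborel (\<lambda>y. v y * (\<psi> (y - x') - \<psi> (y - x)))) \<le> l2norm v * l2norm (\<lambda>y. \<psi> (y - x') - \<psi> (y - x))"
      by (intro norm_integral_prod_le v L2_diff L2_test_fn[OF test_fn_shift[OF \<psi>]])
    ultimately have "norm (corr v \<psi> x' - corr v \<psi> x) \<le> l2norm v * ((L * norm (x' - x)) * l2norm ?I)"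
      by (auto intro: order_trans mult_left_mono l2norm_nonneg)
    then show ?thesis by (simp add: c_def mult_ac)
  qed
  have "(corr v \<psi> \<longlongrightarrow> corr v \<psi> x) (at x)"
  proof (rule LIM_zero_cancel, rule tendsto_norm_zero_cancel, rule tendsto_sandwich[where f="\<lambda>_. 0"])
    show "\<forall>\<^sub>F x' in at x. norm (corr v \<psi> x' - corr v \<psi> x) \<le> c * norm (x' - x)"
      unfolding eventually_at using est by (intro exI[of _ 1]) auto
    have "((\<lambda>x'. c * norm (x' - x)) \<longlongrightarrow> c * norm (x - x)) (at x)" by (intro tendsto_intros)
    then show "((\<lambda>x'. c * norm (x' - x)) \<longlongrightarrow> 0) (at x)" by simp
  qed auto
  then show "isCont (corr v \<psi>) x" by (simp add: isCont_def)
qed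

text \<open>Far out, the shifted \<open>\<psi>\<close> meets only the part of \<open>v\<close>
  outside a large ball, and that tail is small in L^2.\<close>

lemma corr_vanishes_at_infinity:
  assumes v: "L2 v" and \<psi>: "test_fn UNIV \<psi>" and e: "0 < e"
  shows "\<exists>R. \<forall>x. R < norm x \<longrightarrow> norm (corr v \<psi> x) < e"
proof -
  note [measurable] = L2_measurable[OF v]
  let ?v = "\<lambda>n y. indicator (- cball 0 (real n)) y * v y :: complex"
  have Lv: "L2 (?v n)" for n
    by (rule L2_mult_bounded[OF v, where C=1]) (auto simp: indicator_def)
  have "(\<lambda>n. integral\<^sup>L lborel (\<lambda>y. (norm (?v n y))\<^sup>2)) \<longlonglongrightarrow> integral\<^sup>L lborel (\<lambda>y::pt. 0::real)"
  proof (rule integral_dominated_convergence[OF _ _ L2_integrable_sq[OF v]])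
    show "AE y in lborel. (\<lambda>n. (norm (?v n y))\<^sup>2) \<longlonglongrightarrow> 0"
    proof (rule AE_I2, rule tendsto_eventually)
      fix y :: pt
      obtain N where "norm y \<le> real N" using real_arch_simple by blast
      then show "\<forall>\<^sub>F n in sequentially. (norm (?v n y))\<^sup>2 = 0"
        unfolding eventually_sequentially by (intro exI[of _ N]) (auto simp: indicator_def)
    qed
    show "AE y in lborel. norm ((norm (?v n y))\<^sup>2) \<le> (norm (v y))\<^sup>2" for n
      by (rule AE_I2) (auto simp: indicator_def)
  qed auto
  then have "(\<lambda>n. sqrt (integral\<^sup>L lborel (\<lambda>y. (norm (?v n y))\<^sup>2)) * l2norm \<psi>) \<longlonglongrightarrow> sqrt 0 * l2norm \<psi>"
    by (intro tendsto_intros) simp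
  then have "(\<lambda>n. l2norm (?v n) * l2norm \<psi>) \<longlonglongrightarrow> 0" by (simp add: l2norm_def)
  from order_tendstoD(2)[OF this e] obtain n where n: "l2norm (?v n) * l2norm \<psi> < e"
    by (auto simp: eventually_sequentially)
  obtain B R where B: "0 \<le> R" "\<And>x. R < norm x \<Longrightarrow> \<psi> x = 0"
    using test_fn_bounds[OF \<psi>] by metis
  have "norm (corr v \<psi> x) < e" if x: "real n + R < norm x" for x
  proof -
    have "v y * \<psi> (y - x) = ?v n y * \<psi> (y - x)" for y
    proof (cases "norm y \<le> real n")
      case True
      then have "R < norm (y - x)" using x norm_triangle_ineq2[of x y] by (simp add: norm_minus_commute)
      then show ?thesis using B by simp
    qed (simp add: indicator_def)
    then have "corr v \<psi> x = integral\<^sup>L lborel (\<lambda>y. ?v n y * \<psi> (y - x))" by (simp only: corr_def)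
    moreover have "norm (integral\<^sup>L lborel (\<lambda>y. ?v n y * \<psi> (y - x))) \<le> l2norm (?v n) * l2norm (\<lambda>y. \<psi> (y - x))"
      by (intro norm_integral_prod_le Lv L2_test_fn[OF test_fn_shift[OF \<psi>]])
    moreover have "l2norm (\<lambda>y. \<psi> (y - x)) = l2norm \<psi>"
      using l2norm_translate[OF L2_test_fn[OF \<psi>], of "- x"] by simp
    ultimately show ?thesis using n by simp
  qed
  then show ?thesis by blast
qed

text \<open>Real test functions, so that Taylor's theorem with Lagrange remainder applies.\<close>

lemma second_difference:
  fixes p :: "pt \<Rightarrow> real" and z e :: pt
  defines "\<psi> \<equiv> (\<lambda>x. complex_of_real (p x))"
  assumes \<psi>: "smooth \<psi>"
  shows "\<exists>s t. \<bar>s\<bar> \<le> \<bar>h\<bar> \<and> \<bar>t\<bar> \<le> \<bar>h\<bar> \<and> \<psi> (z + h *\<^sub>R e) + \<psi> (z - h *\<^sub>R e) - 2 * \<psi> z =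
    of_real (h\<^sup>2 / 2) * (pd e (pd e \<psi>) (z + s *\<^sub>R e) + pd e (pd e \<psi>) (z + t *\<^sub>R e))"
proof -
  have line: "((\<lambda>t. Re (f (z + t *\<^sub>R e))) has_real_derivative Re (pd e f (z + t *\<^sub>R e))) (at t)"
    if f: "smooth f" for f t
  proof -
    have 1: "((\<lambda>t. z + t *\<^sub>R e) has_derivative (\<lambda>t. t *\<^sub>R e)) (at t)" by (auto intro!: derivative_eq_intros)
    have D: "(f has_derivative (\<lambda>v. pd v f y)) (at y)" for y
      using has_derivative_pd[OF smooth_differentiable[OF f]] .
    have "((\<lambda>t. Re (f (z + t *\<^sub>R e))) has_derivative (\<lambda>s. Re (pd (s *\<^sub>R e) f (z + t *\<^sub>R e)))) (at t)"
      by (rule bounded_linear.has_derivative[OF bounded_linear_Re has_derivative_compose[OF 1 D]])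
    moreover have "pd (s *\<^sub>R e) f y = s *\<^sub>R pd e f y" for s y
      using linear_scale[OF has_derivative_linear[OF D]] .
    ultimately show ?thesis by (simp add: has_field_derivative_def mult_commute_abs)
  qed
  have "cnj (pd e (pd e \<psi>) x) = pd e (pd e \<psi>) x" for x
    using \<psi> by (intro cnj_pd smooth_pd) (auto simp: \<psi>_def)
  then have r2: "pd e (pd e \<psi>) x = of_real (Re (pd e (pd e \<psi>) x))" for x
    by (metis Reals_cnj_iff of_real_Re)
  define D where "D = (\<lambda>m t. Re (((pd e ^^ m) \<psi>) (z + t *\<^sub>R e)))"
  have sm: "smooth ((pd e ^^ m) \<psi>)" for m by (induction m) (auto simp: \<psi> smooth_pd)
  have DD: "(D m has_real_derivative D (Suc m) t) (at t)" for m t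
    unfolding D_def using line[OF sm, of m t] by simp
  have T: "\<exists>t. \<bar>t\<bar> \<le> \<bar>h\<bar> \<and> D 0 h = D 0 0 + D 1 0 * h + D 2 t / 2 * h\<^sup>2" for h
    using Maclaurin_bi_le[of D "D 0" 2 h] DD by (simp add: numeral_2_eq_2)
  obtain s where s: "\<bar>s\<bar> \<le> \<bar>h\<bar>" "D 0 h = D 0 0 + D 1 0 * h + D 2 s / 2 * h\<^sup>2" using T by blast
  obtain t where t: "\<bar>t\<bar> \<le> \<bar>-h\<bar>" "D 0 (-h) = D 0 0 + D 1 0 * (-h) + D 2 t / 2 * (-h)\<^sup>2" using T by blast
  \<comment> \<open>Expanding at h and at -h cancels the first-order term. The remainders sit at two
    unrelated points, which is harmless for bounds and limits.\<close>
  have eq: "D 0 h + D 0 (-h) - 2 * D 0 0 = h\<^sup>2 / 2 * (D 2 s + D 2 t)"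
    using s(2) t(2) by (simp add: algebra_simps)
  have D0: "\<psi> (z + h *\<^sub>R e) = of_real (D 0 h)" for h by (simp add: D_def \<psi>_def)
  have D2: "pd e (pd e \<psi>) (z + h *\<^sub>R e) = of_real (D 2 h)" for h
    using r2 by (simp add: D_def numeral_2_eq_2)
  have "\<psi> (z + h *\<^sub>R e) + \<psi> (z - h *\<^sub>R e) - 2 * \<psi> z = of_real (D 0 h + D 0 (-h) - 2 * D 0 0)"
    using D0[of h] D0[of "-h"] D0[of 0] by simp
  also have "\<dots> = of_real (h\<^sup>2 / 2) * (pd e (pd e \<psi>) (z + s *\<^sub>R e) + pd e (pd e \<psi>) (z + t *\<^sub>R e))"
    unfolding eq D2 by simp
  finally show ?thesis using s(1) t(1) by auto
qed

text \<open>The maximum principle needs the Laplacian of \<open>corr v \<psi>\<close> only through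
  second differences at a single point. Those of \<open>\<psi>\<close> are bounded, have bounded
  support and converge, so dominated convergence suffices, without any differentiability of
  \<open>corr v \<psi>\<close>.\<close>

lemma corr_second_difference_tendsto:
  fixes p :: "pt \<Rightarrow> real"
  defines "\<psi> \<equiv> (\<lambda>x. complex_of_real (p x))"
  assumes v: "L2 v" and \<psi>: "test_fn UNIV \<psi>"
  shows "(\<lambda>n. of_real ((real (Suc n))\<^sup>2) * (corr v \<psi> (x + (1 / real (Suc n)) *\<^sub>R e) +
    corr v \<psi> (x - (1 / real (Suc n)) *\<^sub>R e) - 2 * corr v \<psi> x)) \<longlonglongrightarrow> corr v (pd e (pd e \<psi>)) x"
proof -
  note [measurable] = L2_measurable[OF v] test_fn_measurable[OF test_fn_shift[OF \<psi>]]
    test_fn_measurable[OF test_fn_shift[OF test_fn_pd[OF test_fn_pd[OF \<psi>]]]]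
  define P where "P = pd e (pd e \<psi>)"
  have P: "test_fn UNIV P" unfolding P_def by (intro test_fn_pd \<psi>)
  obtain B R where B: "0 \<le> B" "0 \<le> R" "\<And>x. norm (P x) \<le> B" "\<And>x. R < norm x \<Longrightarrow> P x = 0"
    using test_fn_bounds[OF P] by metis
  define h where "h n = 1 / real (Suc n)" for n
  have h: "0 < h n" "h n \<le> 1" for n by (auto simp: h_def)
  have h0: "h \<longlonglongrightarrow> 0" unfolding h_def by (rule LIMSEQ_inverse_real_of_nat[unfolded inverse_eq_divide])
  have hs: "(real (Suc n))\<^sup>2 = 1 / (h n)\<^sup>2" for n by (simp add: h_def power_divide)
  define Q where "Q n z = of_real (1 / (h n)\<^sup>2) * (\<psi> (z + h n *\<^sub>R e) + \<psi> (z - h n *\<^sub>R e) - 2 * \<psi> z)" for n z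
  have "\<exists>s t. \<bar>s\<bar> \<le> h n \<and> \<bar>t\<bar> \<le> h n \<and> Q n z = (P (z + s *\<^sub>R e) + P (z + t *\<^sub>R e)) / 2" for n z
  proof -
    obtain s t where st: "\<bar>s\<bar> \<le> \<bar>h n\<bar>" "\<bar>t\<bar> \<le> \<bar>h n\<bar>" "\<psi> (z + h n *\<^sub>R e) + \<psi> (z - h n *\<^sub>R e) - 2 * \<psi> z =
        of_real ((h n)\<^sup>2 / 2) * (P (z + s *\<^sub>R e) + P (z + t *\<^sub>R e))"
      using second_difference[of p "h n" z e] test_fn_smooth[OF \<psi>] unfolding P_def \<psi>_def by blast
    have "Q n z = (P (z + s *\<^sub>R e) + P (z + t *\<^sub>R e)) / 2"
      unfolding Q_def st(3) using h(1)[of n] by simp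
    then show ?thesis using st(1,2) h(1)[of n] by auto
  qed
  \<comment> \<open>The intermediate points are chosen with no measurability in z. They serve only
    for pointwise bounds and limits; measurability is read off from the definition of
    \<open>Q\<close>.\<close>
  then obtain s t where st: "\<And>n z. \<bar>s n z\<bar> \<le> h n" "\<And>n z. \<bar>t n z\<bar> \<le> h n"
    "\<And>n z. Q n z = (P (z + s n z *\<^sub>R e) + P (z + t n z *\<^sub>R e)) / 2" by metis
  have lim1: "(\<lambda>n. P (z + c n *\<^sub>R e)) \<longlonglongrightarrow> P z" if "\<And>n. \<bar>c n\<bar> \<le> h n" for c z
  proof -
    have "c \<longlonglongrightarrow> 0" by (rule Lim_null_comparison[OF _ h0]) (use that in simp)
    then have "(\<lambda>n. z + c n *\<^sub>R e) \<longlonglongrightarrow> z + 0 *\<^sub>R e" by (intro tendsto_intros)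
    moreover have "isCont P z" using smooth_continuous_on[OF test_fn_smooth[OF P], of UNIV] by (simp add: continuous_on_eq_continuous_at)
    ultimately show ?thesis by (intro isCont_tendsto_compose[of z P]) simp_all
  qed
  have Qlim: "(\<lambda>n. Q n z) \<longlonglongrightarrow> P z" for z
  proof -
    have "(\<lambda>n. (P (z + s n z *\<^sub>R e) + P (z + t n z *\<^sub>R e)) / 2) \<longlonglongrightarrow> (P z + P z) / 2"
      by (intro tendsto_intros lim1 st) simp
    then show ?thesis by (simp add: st(3))
  qed
  have Qb: "norm (Q n z) \<le> B * indicator (cball 0 (R + norm e)) z" for n z
  proof (cases "norm z \<le> R + norm e")
    case True
    have "norm (Q n z) \<le> (norm (P (z + s n z *\<^sub>R e)) + norm (P (z + t n z *\<^sub>R e))) / 2"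
      unfolding st(3) by (simp add: norm_divide norm_triangle_ineq)
    also have "\<dots> \<le> (B + B) / 2" by (intro divide_right_mono add_mono B) simp
    finally show ?thesis using True by simp
  next
    case False
    have "R < norm (z + c *\<^sub>R e)" if "\<bar>c\<bar> \<le> h n" for c
    proof -
      have "\<bar>c\<bar> \<le> 1" using that h(2)[of n] by simp
      then have "norm (c *\<^sub>R e) \<le> norm e" by (simp add: mult_left_le_one_le)
      then show ?thesis using False norm_diff_ineq[of z "c *\<^sub>R e"] by linarith
    qed
    then have "P (z + s n z *\<^sub>R e) = 0" "P (z + t n z *\<^sub>R e) = 0" using st(1,2) B(4) by auto
    then show ?thesis using st(3)[of n z] False by simp
  qed
  have "(\<lambda>n. integral\<^sup>L lborel (\<lambda>y. v y * Q n (y - x))) \<longlonglongrightarrow> integral\<^sup>L lborel (\<lambda>y. v y * P (y - x))"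
  proof (rule integral_dominated_convergence)
    let ?I = "\<lambda>y::pt. indicator (cball 0 (R + norm e)) (y - x) :: complex"
    have "L2 ?I" using L2_translate[OF L2_indicator_cball, of "R + norm e" "- x"] by simp
    then show "integrable lborel (\<lambda>y. B * norm (v y * ?I y))"
      by (intro integrable_mult_right integrable_norm L2_prod_integrable v)
    show "AE y in lborel. (\<lambda>n. v y * Q n (y - x)) \<longlonglongrightarrow> v y * P (y - x)"
      by (intro AE_I2 tendsto_intros Qlim)
    show "AE y in lborel. norm (v y * Q n (y - x)) \<le> B * norm (v y * ?I y)" for n
    proof (rule AE_I2)
      fix y
      have "norm (v y) * norm (Q n (y - x)) \<le> norm (v y) * (B * indicator (cball 0 (R + norm e)) (y - x))"
        by (intro mult_left_mono Qb) simp
      then show "norm (v y * Q n (y - x)) \<le> B * norm (v y * ?I y)"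
        by (cases "norm (y - x) \<le> R + norm e") (auto simp: norm_mult indicator_def mult_ac)
    qed
    show "(\<lambda>y. v y * Q n (y - x)) \<in> borel_measurable lborel" for n
    proof -
      have "Q n \<in> borel_measurable borel"
        unfolding Q_def using test_fn_measurable[OF test_fn_translate[OF \<psi>, of "h n *\<^sub>R e"]]
          test_fn_measurable[OF test_fn_shift[OF \<psi>, of "h n *\<^sub>R e"]] test_fn_measurable[OF \<psi>] by measurable
      then show ?thesis by measurable
    qed
    show "(\<lambda>y. v y * P (y - x)) \<in> borel_measurable lborel"
      using test_fn_measurable[OF P] by measurable
  qed
  moreover have "integral\<^sup>L lborel (\<lambda>y. v y * Q n (y - x)) =
      of_real (1 / (h n)\<^sup>2) * (corr v \<psi> (x + h n *\<^sub>R e) + corr v \<psi> (x - h n *\<^sub>R e) - 2 * corr v \<psi> x)" for n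
  proof -
    have "v y * Q n (y - x) = of_real (1 / (h n)\<^sup>2) *
        (v y * \<psi> (y - (x - h n *\<^sub>R e)) + v y * \<psi> (y - (x + h n *\<^sub>R e)) - 2 * (v y * \<psi> (y - x)))" for y
      by (simp add: Q_def algebra_simps)
    then have "integral\<^sup>L lborel (\<lambda>y. v y * Q n (y - x)) = integral\<^sup>L lborel (\<lambda>y. of_real (1 / (h n)\<^sup>2) *
        (v y * \<psi> (y - (x - h n *\<^sub>R e)) + v y * \<psi> (y - (x + h n *\<^sub>R e)) - 2 * (v y * \<psi> (y - x))))" by simp
    also have "\<dots> = of_real (1 / (h n)\<^sup>2) * (corr v \<psi> (x - h n *\<^sub>R e) + corr v \<psi> (x + h n *\<^sub>R e) - 2 * corr v \<psi> x)"
      unfolding corr_def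
      by (subst integral_mult_right_zero, subst Bochner_Integration.integral_diff,
          (intro Bochner_Integration.integrable_add integrable_mult_right corr_integrable v \<psi>)+,
          subst Bochner_Integration.integral_add, (intro corr_integrable v \<psi>)+, subst integral_mult_right_zero) simp
    finally show ?thesis by (simp add: add.commute)
  qed
  ultimately show ?thesis unfolding hs by (simp add: corr_def P_def h_def)
qed

text \<open>As \<open>corr v \<psi>\<close> vanishes at infinity, a positive value of its real part forces a maximum, where the
  Laplacian, hence \<open>corr v \<psi>\<close> itself, has nonpositive real part.\<close>

lemma corr_maximum_principle:
  fixes p :: "pt \<Rightarrow> real"
  defines "\<psi> \<equiv> (\<lambda>x. complex_of_real (p x))"
  assumes v: "L2 v" and \<psi>: "test_fn UNIV \<psi>"
    and eq: "\<And>x. corr v \<psi> x = (\<Sum>e\<in>Basis. corr v (pd e (pd e \<psi>)) x)"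
  shows "Re (corr v \<psi> x) \<le> 0"
proof (rule ccontr)
  assume "\<not> ?thesis"
  then have pos: "0 < Re (corr v \<psi> x)" by simp
  let ?S = "{y. Re (corr v \<psi> x) \<le> Re (corr v \<psi> y)}"
  have cont: "continuous_on A (\<lambda>y. Re (corr v \<psi> y))" for A
    using continuous_on_subset[OF corr_continuous[OF v \<psi>]] by (intro continuous_intros) auto
  have "closed ?S" by (intro closed_Collect_le continuous_on_const cont)
  moreover have "bounded ?S"
  proof -
    obtain R where R: "\<And>y. R < norm y \<Longrightarrow> norm (corr v \<psi> y) < Re (corr v \<psi> x)"
      using corr_vanishes_at_infinity[OF v \<psi> pos] by blast
    have "norm y \<le> R" if "y \<in> ?S" for y
      using R[of y] that complex_Re_le_cmod[of "corr v \<psi> y"] by force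
    then show ?thesis unfolding bounded_iff by blast
  qed
  ultimately have "compact ?S" by (simp add: compact_eq_bounded_closed)
  then obtain m where m: "m \<in> ?S" "\<And>y. y \<in> ?S \<Longrightarrow> Re (corr v \<psi> y) \<le> Re (corr v \<psi> m)"
    using continuous_attains_sup[of ?S "\<lambda>y. Re (corr v \<psi> y)"] cont by auto
  have max: "Re (corr v \<psi> y) \<le> Re (corr v \<psi> m)" for y
    using m(1) m(2)[of y] by (cases "y \<in> ?S") auto
  have "Re (corr v (pd e (pd e \<psi>)) m) \<le> 0" for e
  proof (rule LIMSEQ_le_const2)
    show "(\<lambda>n. Re (of_real ((real (Suc n))\<^sup>2) * (corr v \<psi> (m + (1 / real (Suc n)) *\<^sub>R e) +
        corr v \<psi> (m - (1 / real (Suc n)) *\<^sub>R e) - 2 * corr v \<psi> m))) \<longlonglongrightarrow> Re (corr v (pd e (pd e \<psi>)) m)"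
      using \<psi> unfolding \<psi>_def by (intro tendsto_Re corr_second_difference_tendsto[OF v])
    have "Re (of_real a * z) = a * Re z" for a z by simp
    moreover have "(real (Suc n))\<^sup>2 * Re (corr v \<psi> (m + (1 / real (Suc n)) *\<^sub>R e) +
        corr v \<psi> (m - (1 / real (Suc n)) *\<^sub>R e) - 2 * corr v \<psi> m) \<le> 0" for n
      using max[of "m + (1 / real (Suc n)) *\<^sub>R e"] max[of "m - (1 / real (Suc n)) *\<^sub>R e"]
      by (intro mult_nonneg_nonpos) auto
    ultimately show "\<exists>N. \<forall>n\<ge>N. Re (of_real ((real (Suc n))\<^sup>2) * (corr v \<psi> (m + (1 / real (Suc n)) *\<^sub>R e) +
        corr v \<psi> (m - (1 / real (Suc n)) *\<^sub>R e) - 2 * corr v \<psi> m)) \<le> 0"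
      by presburger
  qed
  then have "Re (corr v \<psi> m) \<le> 0" unfolding eq by (simp add: sum_nonpos)
  moreover have "Re (corr v \<psi> x) \<le> Re (corr v \<psi> m)" by (rule max)
  ultimately show False using pos by linarith
qed

lemma corr_scale: "corr (\<lambda>x. c * v x) \<psi> x = c * corr v \<psi> x"
  by (simp add: corr_def mult.assoc)

lemma H1_orthogonal_test_fns:
  assumes v: "H1 v" and ortho: "\<And>\<phi>. test_fn UNIV \<phi> \<Longrightarrow> form1 v \<phi> = 0"
  shows "h1norm v = 0"
proof -
  have L: "L2 v" by (rule H1_L2[OF v])
  have eq: "corr v (\<lambda>x. complex_of_real (p x)) x = (\<Sum>e\<in>Basis. corr v (pd e (pd e (\<lambda>x. complex_of_real (p x)))) x)"
    if p: "test_fn UNIV (\<lambda>x. complex_of_real (p x))" for p x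
  proof -
    let ?p = "\<lambda>x. complex_of_real (p x)"
    let ?q = "\<lambda>y. ?p (y - x)"
    have pdq: "pd e (\<lambda>y. f (y - x)) = (\<lambda>y. pd e f (y - x))" if "smooth f" for f e
      using pd_translate[OF that, of e "- x"] by simp
    have sm: "smooth ?p" by (rule test_fn_smooth[OF p])
    have q: "test_fn UNIV ?q" by (rule test_fn_shift[OF p])
    have cnjq: "cnj (pd e ?q y) = pd e ?q y" for e y
      by (rule cnj_pd[OF test_fn_smooth[OF q]]) simp
    have "l2inner (wgrad e v) (wgrad e ?q) = - corr v (pd e (pd e ?p)) x" if e: "e \<in> Basis" for e
    proof -
      have "l2inner (wgrad e v) (wgrad e ?q) = l2inner (wgrad e v) (pd e ?q)"
        using wgrad_test_fn[OF q] by (intro l2inner_cong_AE wgrad v e H1_test_fn[OF q] L2_pd_test_fn[OF q]) auto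
      also have "\<dots> = integral\<^sup>L lborel (\<lambda>y. wgrad e v y * pd e ?q y)"
        by (simp add: l2inner_def cnjq)
      also have "\<dots> = - integral\<^sup>L lborel (\<lambda>y. v y * pd e (pd e ?q) y)"
        using wgrad(2)[OF v e, unfolded weak_partial_def, rule_format, OF test_fn_pd[OF q, of e]] by simp
      also have "pd e (pd e ?q) = (\<lambda>y. pd e (pd e ?p) (y - x))"
        unfolding pdq[OF sm] pdq[OF smooth_pd[OF sm]] ..
      finally show ?thesis by (simp add: corr_def)
    qed
    moreover have "l2inner v ?q = corr v ?p x" by (simp add: l2inner_def corr_def)
    ultimately show ?thesis using ortho[OF q] by (simp add: form1_def sum_negf)
  qed
  \<comment> \<open>The maximum principle applies to c v for every complex c. Taking c to be the
    conjugate of the value of the correlation at 0 turns the left side into its squared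
    modulus.\<close>
  have le: "Re (c * corr v (\<lambda>x. complex_of_real (p x)) x) \<le> 0"
    if p: "test_fn UNIV (\<lambda>x. complex_of_real (p x))" for p x c
    using corr_maximum_principle[OF L2_scale[OF L, of c] p, of x] eq[OF p]
    by (simp add: corr_scale sum_distrib_left)
  have "AE x in lborel. v x = 0"
  proof (rule L2_eq_0I[OF L])
    fix p assume p: "test_fn UNIV (\<lambda>x. complex_of_real (p x))"
    have "corr v (\<lambda>x. complex_of_real (p x)) 0 = 0"
      using le[OF p, of "cnj (corr v (\<lambda>x. complex_of_real (p x)) 0)" 0]
      by (simp add: complex_norm_square[symmetric] mult.commute complex_eq_0 power2_eq_square[symmetric])
    then show "integral\<^sup>L lborel (\<lambda>x. v x * complex_of_real (p x)) = 0" by (simp add: corr_def)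
  qed
  then have 0: "AE x in lborel. 0 = v x" by auto
  have "l2norm v = l2norm (\<lambda>x. 0)" using 0 by (intro l2norm_cong_AE L L2_0) auto
  moreover have "l2norm (wgrad e v) = l2norm (\<lambda>x. 0)" if e: "e \<in> Basis" for e
  proof (rule l2norm_cong_AE[OF wgrad(1)[OF v e] L2_0])
    have "weak_partial e v (\<lambda>x. 0)"
      by (rule weak_partial_cong_AE[OF L2_0 L 0]) (simp add: weak_partial_def)
    then show "AE x in lborel. wgrad e v x = 0" by (rule wgrad_AE_eq[OF L2_0])
  qed
  ultimately show ?thesis by (simp add: h1norm_def l2norm_def)
qed

text \<open>The difference of \<open>w\<close> and its projection onto \<open>H10 UNIV\<close> is
  orthogonal to all test functions, so \<open>w\<close> has distance zero from that closed
  space.\<close>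

lemma H1_imp_H10_UNIV:
  assumes w: "H1 w" shows "H10 UNIV w"
proof -
  obtain u where u: "H10 UNIV u" "\<And>v. H10 UNIV v \<Longrightarrow> form1 u v = form1 w v"
    using H10_projection[OF w] by blast
  have "h1norm (\<lambda>x. w x - u x) = 0"
  proof (rule H1_orthogonal_test_fns[OF H1_diff[OF w H10_H1[OF u(1)]]])
    fix \<phi> assume \<phi>: "test_fn UNIV \<phi>"
    show "form1 (\<lambda>x. w x - u x) \<phi> = 0"
      using u(2)[OF H10_test_fn[OF \<phi>]] by (simp add: H1.B_diff w H10_H1[OF u(1)] H1_test_fn[OF \<phi>])
  qed
  then show ?thesis using u(1) by (intro H10_closed[OF w]) auto
qed

section \<open>Localised energy estimates for the free resolvent\<close>

text \<open>\<open>Rfree\<close> is a Hilbert choice, so \<open>Rfree f - Rfree g\<close> need not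
  be the function chosen for \<open>f - g\<close>. Estimates for all weak solutions apply to such
  differences as well.\<close>

definition free_sol :: "fn \<Rightarrow> fn \<Rightarrow> bool" where
  "free_sol f w \<longleftrightarrow> H1 w \<and> (\<forall>v. H1 v \<longrightarrow> form1 w v = l2inner f v)"

lemma free_sol_Rfree: "L2 f \<Longrightarrow> free_sol f (Rfree f)"
  unfolding free_sol_def Rfree_def by (rule someI_ex[OF H1_Riesz])

lemma free_sol_H1: "free_sol f w \<Longrightarrow> H1 w"
  by (simp add: free_sol_def)

lemma free_sol_diff:
  "L2 f \<Longrightarrow> L2 g \<Longrightarrow> free_sol f w \<Longrightarrow> free_sol g z \<Longrightarrow> free_sol (\<lambda>x. f x - g x) (\<lambda>x. w x - z x)"
  by (auto simp: free_sol_def H1_diff H1.B_diff L2.B_diff H1_L2)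

lemma Re_l2inner_eq:
  assumes "L2 f" "L2 g" shows "Re (l2inner f g) = integral\<^sup>L lborel (\<lambda>x. Re (f x * cnj (g x)))"
  unfolding l2inner_def by (intro integral_Re[symmetric] L2_prod_integrable L2_cnj assms)

text \<open>For real \<open>\<eta>\<close>, |grad(\<eta> w)|^2 equals the real part of grad w paired
  with grad(\<eta>^2 w), plus |grad \<eta>|^2 |w|^2: the cross terms match exactly, so grad \<eta>
  multiplies only w itself.\<close>

lemma Caccioppoli:
  assumes \<eta>: "C1_bounded C \<eta>" and real: "\<And>x. cnj (\<eta> x) = \<eta> x" and w: "H1 w"
  shows "(h1norm (\<lambda>x. \<eta> x * w x))\<^sup>2 = Re (form1 w (\<lambda>x. \<eta> x * (\<eta> x * w x))) +
    (\<Sum>e\<in>Basis. (l2norm (\<lambda>x. pd e \<eta> x * w x))\<^sup>2)"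
proof -
  have sm: "smooth \<eta>" and b: "\<And>x. norm (\<eta> x) \<le> C" "\<And>e x. e \<in> Basis \<Longrightarrow> norm (pd e \<eta> x) \<le> C"
    using \<eta> by (auto simp: C1_bounded_def)
  have L: "L2 (\<lambda>x. \<eta> x * v x)" if "L2 v" for v
    by (rule L2_mult_bounded[OF that smooth_measurable[OF sm] b(1)])
  have Lp: "L2 (\<lambda>x. pd e \<eta> x * v x)" if "L2 v" "e \<in> Basis" for v e
    by (rule L2_mult_bounded[OF that(1) smooth_measurable[OF smooth_pd[OF sm]] b(2)[OF that(2)]])
  note w1 = H1_mult[OF \<eta> w] and w2 = H1_mult[OF \<eta> H1_mult[OF \<eta> w]]
  have "(l2norm (\<lambda>x. \<eta> x * w x))\<^sup>2 = Re (l2inner w (\<lambda>x. \<eta> x * (\<eta> x * w x)))"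
  proof -
    have "complex_of_real ((l2norm (\<lambda>x. \<eta> x * w x))\<^sup>2) = l2inner w (\<lambda>x. \<eta> x * (\<eta> x * w x))"
      unfolding l2inner_self[symmetric] by (simp add: l2inner_def real mult_ac)
    then show ?thesis by (metis Re_complex_of_real)
  qed
  moreover have "(l2norm (wgrad e (\<lambda>x. \<eta> x * w x)))\<^sup>2 =
      Re (l2inner (wgrad e w) (wgrad e (\<lambda>x. \<eta> x * (\<eta> x * w x)))) + (l2norm (\<lambda>x. pd e \<eta> x * w x))\<^sup>2"
    if e: "e \<in> Basis" for e
  proof -
    \<comment> \<open>Here h, d, D and u stand for \<open>\<eta>\<close>, its partial derivative,
      the weak derivative of w and w itself.\<close>
    have pt: "(norm (h * D + d * u))\<^sup>2 = Re (D * cnj (h * (h * D + d * u) + d * (h * u))) + (norm (d * u))\<^sup>2"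
      if "cnj h = h" "cnj d = d" for h d D u :: complex
    proof -
      have "Im h = 0" "Im d = 0" using that by (auto simp: complex_eq_iff)
      then show ?thesis unfolding cmod_power2 by (simp add: power2_eq_square algebra_simps)
    qed
    have rp: "cnj (pd e \<eta> x) = pd e \<eta> x" for x by (rule cnj_pd[OF sm real])
    have 1: "integrable lborel (\<lambda>x. Re (wgrad e w x * cnj (wgrad e (\<lambda>x. \<eta> x * (\<eta> x * w x)) x)))"
      by (intro integrable_Re L2_prod_integrable L2_cnj wgrad w w2 e)
    have 2: "integrable lborel (\<lambda>x. (norm (pd e \<eta> x * w x))\<^sup>2)"
      by (intro L2_integrable_sq Lp H1_L2 w e)
    have "integral\<^sup>L lborel (\<lambda>x. (norm (wgrad e (\<lambda>x. \<eta> x * w x) x))\<^sup>2) =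
      integral\<^sup>L lborel (\<lambda>x. Re (wgrad e w x * cnj (wgrad e (\<lambda>x. \<eta> x * (\<eta> x * w x)) x)) + (norm (pd e \<eta> x * w x))\<^sup>2)"
    proof (rule integral_cong_AE)
      show "AE x in lborel. (norm (wgrad e (\<lambda>x. \<eta> x * w x) x))\<^sup>2 =
          Re (wgrad e w x * cnj (wgrad e (\<lambda>x. \<eta> x * (\<eta> x * w x)) x)) + (norm (pd e \<eta> x * w x))\<^sup>2"
        using wgrad_mult[OF \<eta> w e] wgrad_mult[OF \<eta> w1 e]
      proof eventually_elim
        case (elim x)
        show ?case unfolding elim(2) unfolding elim(1) by (rule pt[OF real rp])
      qed
      show "(\<lambda>x. (norm (wgrad e (\<lambda>x. \<eta> x * w x) x))\<^sup>2) \<in> borel_measurable lborel"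
        by (intro borel_measurable_integrable L2_integrable_sq wgrad w1 e)
      show "(\<lambda>x. Re (wgrad e w x * cnj (wgrad e (\<lambda>x. \<eta> x * (\<eta> x * w x)) x)) + (norm (pd e \<eta> x * w x))\<^sup>2) \<in> borel_measurable lborel"
        by (intro borel_measurable_integrable Bochner_Integration.integrable_add 1 2)
    qed
    then show ?thesis
      unfolding l2norm_sq Re_l2inner_eq[OF wgrad(1)[OF w e] wgrad(1)[OF w2 e]] using 1 2 by simp
  qed
  ultimately show ?thesis by (simp add: h1norm_sq form1_def sum.distrib)
qed

lemma Caccioppoli_free_sol:
  assumes \<eta>: "C1_bounded C \<eta>" and real: "\<And>x. cnj (\<eta> x) = \<eta> x" and f: "L2 f" and w: "free_sol f w"
  shows "(h1norm (\<lambda>x. \<eta> x * w x))\<^sup>2 \<le> l2norm (\<lambda>x. \<eta> x * f x) * l2norm (\<lambda>x. \<eta> x * w x) +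
    (\<Sum>e\<in>Basis. (l2norm (\<lambda>x. pd e \<eta> x * w x))\<^sup>2)"
proof -
  have L: "L2 (\<lambda>x. \<eta> x * v x)" if "L2 v" for v
    by (rule L2_mult_bounded[OF that, where C=C]) (use \<eta> in \<open>auto simp: C1_bounded_def smooth_measurable\<close>)
  have H: "H1 w" using w by (rule free_sol_H1)
  have "form1 w (\<lambda>x. \<eta> x * (\<eta> x * w x)) = l2inner f (\<lambda>x. \<eta> x * (\<eta> x * w x))"
    using w H1_mult[OF \<eta> H1_mult[OF \<eta> H]] by (simp add: free_sol_def)
  \<comment> \<open>Sharing the two factors \<open>\<eta>\<close> between f and w leaves f weighted
    too, so only the data that \<open>\<eta>\<close> sees enter.\<close>
  also have "\<dots> = l2inner (\<lambda>x. \<eta> x * f x) (\<lambda>x. \<eta> x * w x)"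
    by (simp add: l2inner_def real mult_ac)
  also have "Re \<dots> \<le> l2norm (\<lambda>x. \<eta> x * f x) * l2norm (\<lambda>x. \<eta> x * w x)"
    using complex_Re_le_cmod l2_Cauchy_Schwarz[OF L[OF f] L[OF H1_L2[OF H]]] order_trans by blast
  finally show ?thesis unfolding Caccioppoli[OF \<eta> real H] by simp
qed

text \<open>The logarithmic gradient of the weight is at most \<open>m * \<rho>\<close>, so for small \<open>\<rho>\<close> the gradient term in
  the Caccioppoli estimate is absorbed on the left.\<close>

definition weight :: "nat \<Rightarrow> real \<Rightarrow> pt \<Rightarrow> complex" where
  "weight m \<rho> x = inverse (1 + complex_of_real (\<rho>\<^sup>2 * (norm x)\<^sup>2)) ^ m"

lemma weight_of_real: "weight m \<rho> x = complex_of_real (inverse (1 + \<rho>\<^sup>2 * (norm x)\<^sup>2) ^ m)"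
  by (simp add: weight_def)

lemma norm_weight: "norm (weight m \<rho> x) = inverse (1 + \<rho>\<^sup>2 * (norm x)\<^sup>2) ^ m"
  unfolding weight_of_real norm_of_real by (simp add: add_nonneg_nonneg)

lemma norm_weight_le_1: "norm (weight m \<rho> x) \<le> 1"
  unfolding norm_weight by (intro power_le_one) (auto simp: inverse_le_1_iff add_nonneg_nonneg)

lemma smooth_weight: "smooth (weight m \<rho>)"
proof -
  have "1 + complex_of_real (\<rho>\<^sup>2 * (norm x)\<^sup>2) \<noteq> 0" for x :: pt
  proof -
    have "1 + \<rho>\<^sup>2 * (norm x)\<^sup>2 > 0" by (simp add: add_pos_nonneg)
    then show ?thesis by (metis of_real_1 of_real_add of_real_eq_0_iff less_irrefl)
  qed
  moreover have "smooth (\<lambda>x. 1 + complex_of_real (\<rho>\<^sup>2 * (norm x)\<^sup>2))"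
    unfolding of_real_mult by (intro smooth_add smooth_const smooth_mult smooth_norm_square)
  ultimately show ?thesis unfolding weight_def[abs_def] by (intro smooth_power smooth_inverse)
qed

lemma norm_pd_weight:
  assumes "0 \<le> \<rho>" "e \<in> Basis"
  shows "norm (pd e (weight m \<rho>) x) \<le> real m * \<rho> * norm (weight m \<rho> x)"
proof (induction m)
  case 0
  have "weight 0 \<rho> = (\<lambda>x. 1)" by (auto simp: weight_def)
  then show ?case by simp
next
  case (Suc m)
  let ?g = "\<lambda>x::pt. 1 + complex_of_real (\<rho>\<^sup>2 * (norm x)\<^sup>2)"
  let ?r = "1 + \<rho>\<^sup>2 * (norm x)\<^sup>2"
  have r: "0 < ?r" by (simp add: add_pos_nonneg)
  have g: "?g x = of_real ?r" by simp
  have w1: "weight 1 \<rho> x = inverse (?g x)" for x by (simp add: weight_def)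
  have "((\<lambda>x. \<rho>\<^sup>2 * (x \<bullet> x)) has_derivative (\<lambda>v. \<rho>\<^sup>2 * (2 * (x \<bullet> v)))) (at x)"
    by (auto intro!: derivative_eq_intros simp: inner_commute)
  from has_derivative_add[OF has_derivative_const bounded_linear.has_derivative[OF bounded_linear_of_real this]]
  have dg: "(?g has_derivative (\<lambda>v. 0 + complex_of_real (\<rho>\<^sup>2 * (2 * (x \<bullet> v))))) (at x)"
    by (simp add: power2_norm_eq_inner)
  have pdg: "pd e ?g x = complex_of_real (\<rho>\<^sup>2 * (2 * (x \<bullet> e)))" using pd_eqI[OF dg] by simp
  \<comment> \<open>2 t \<le> 1 + t^2 at t = \<rho> |x|: the partial derivatives of 1 + \<rho>^2
    |x|^2 are at most \<rho> times that function.\<close>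
  have "\<rho> * (2 * (\<rho> * norm x)) \<le> \<rho> * ?r"
    using sum_squares_bound[of 1 "\<rho> * norm x"] assms(1) by (intro mult_left_mono) (auto simp: power_mult_distrib)
  moreover have "\<rho>\<^sup>2 * (2 * \<bar>x \<bullet> e\<bar>) \<le> \<rho>\<^sup>2 * (2 * norm x)"
    using assms(2) by (intro mult_left_mono) (auto simp: Basis_le_norm)
  ultimately have ng: "norm (pd e ?g x) \<le> \<rho> * ?r"
    unfolding pdg norm_of_real by (simp add: abs_mult power2_eq_square mult_ac)
  have "pd e (weight 1 \<rho>) x = - (pd e ?g x * (inverse (?g x) * inverse (?g x)))"
    unfolding w1[abs_def]
    by (rule pd_inverse) (use dg r g in \<open>auto simp: differentiable_def simp del: of_real_add\<close>)
  then have "norm (pd e (weight 1 \<rho>) x) = norm (pd e ?g x) * (inverse ?r * inverse ?r)"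
    using r unfolding g by (simp add: norm_mult norm_inverse del: of_real_add of_real_mult of_real_power)
  also have "\<dots> \<le> \<rho> * ?r * (inverse ?r * inverse ?r)" using r by (intro mult_right_mono ng) simp
  also have "\<dots> = \<rho> * inverse ?r" using r by simp
  finally have n1: "norm (pd e (weight 1 \<rho>) x) \<le> \<rho> * inverse ?r" .
  have "weight (Suc m) \<rho> = (\<lambda>x. weight 1 \<rho> x * weight m \<rho> x)" by (auto simp: weight_def)
  then have "pd e (weight (Suc m) \<rho>) x = weight 1 \<rho> x * pd e (weight m \<rho>) x + pd e (weight 1 \<rho>) x * weight m \<rho> x"
    using pd_mult[OF smooth_differentiable smooth_differentiable, OF smooth_weight smooth_weight] by simp
  then have "norm (pd e (weight (Suc m) \<rho>) x) \<le> norm (weight 1 \<rho> x) * norm (pd e (weight m \<rho>) x) + norm (pd e (weight 1 \<rho>) x) * norm (weight m \<rho> x)"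
    by (metis norm_mult norm_triangle_ineq)
  also have "\<dots> \<le> inverse ?r * (real m * \<rho> * norm (weight m \<rho> x)) + \<rho> * inverse ?r * norm (weight m \<rho> x)"
    using Suc.IH n1 r by (intro add_mono mult_mono) (auto simp: norm_weight intro: mult_nonneg_nonneg assms)
  also have "\<dots> = real (Suc m) * \<rho> * norm (weight (Suc m) \<rho> x)"
    by (simp add: norm_weight algebra_simps)
  finally show ?case .
qed

lemma cnj_weight: "cnj (weight m \<rho> x) = weight m \<rho> x"
  unfolding weight_of_real by simp

text \<open>Let A and F be the weighted norms of w and f. With m \<rho> at most 1/4 the two gradient
  terms cost 2 (A/4)^2 = A^2/8, which leaves 7/8 A^2 \<le> F A; the resulting factor 8/7 is rounded
  up to 2.\<close>

lemma weighted_bound: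
  assumes \<rho>: "0 \<le> \<rho>" "real m * \<rho> \<le> 1 / 4" and f: "L2 f" and w: "free_sol f w"
  shows "l2norm (\<lambda>x. weight m \<rho> x * w x) \<le> 2 * l2norm (\<lambda>x. weight m \<rho> x * f x)"
proof -
  have pdw: "norm (pd e (weight m \<rho>) x) \<le> 1 / 4 * norm (weight m \<rho> x)" if "e \<in> Basis" for e x
    using norm_pd_weight[OF \<rho>(1) that, of m x] mult_right_mono[OF \<rho>(2) norm_ge_zero[of "weight m \<rho> x"]] by linarith
  have \<eta>: "C1_bounded 1 (weight m \<rho>)"
    unfolding C1_bounded_def
  proof (intro conjI ballI allI)
    fix e x assume "e \<in> (Basis :: pt set)"
    from pdw[OF this, of x] show "norm (pd e (weight m \<rho>) x) \<le> 1" using norm_weight_le_1[of m \<rho> x] by linarith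
  qed (auto simp: smooth_weight norm_weight_le_1)
  let ?A = "l2norm (\<lambda>x. weight m \<rho> x * w x)" and ?F = "l2norm (\<lambda>x. weight m \<rho> x * f x)"
  have Lw: "L2 w" using w by (intro H1_L2 free_sol_H1)
  have L: "L2 (\<lambda>x. weight m \<rho> x * w x)"
    by (rule L2_mult_bounded[OF Lw smooth_measurable[OF smooth_weight] norm_weight_le_1])
  have "(l2norm (\<lambda>x. pd e (weight m \<rho>) x * w x))\<^sup>2 \<le> (1 / 4 * ?A)\<^sup>2" if e: "e \<in> Basis" for e
  proof (intro power_mono l2norm_nonneg l2norm_mono[OF L])
    show "L2 (\<lambda>x. pd e (weight m \<rho>) x * w x)"
      using \<eta> e by (intro L2_mult_bounded[OF Lw smooth_measurable[OF smooth_pd[OF smooth_weight]], where C=1]) (auto simp: C1_bounded_def)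
    show "norm (pd e (weight m \<rho>) x * w x) \<le> 1 / 4 * norm (weight m \<rho> x * w x)" for x
      using mult_right_mono[OF pdw[OF e, of x] norm_ge_zero[of "w x"]] by (simp add: norm_mult)
  qed simp
  then have "(\<Sum>e\<in>Basis. (l2norm (\<lambda>x. pd e (weight m \<rho>) x * w x))\<^sup>2) \<le> (\<Sum>e\<in>(Basis :: pt set). (1 / 4 * ?A)\<^sup>2)"
    by (rule sum_mono)
  also have "\<dots> = ?A\<^sup>2 / 8" by (simp add: power_divide)
  finally have "(h1norm (\<lambda>x. weight m \<rho> x * w x))\<^sup>2 \<le> ?F * ?A + ?A\<^sup>2 / 8"
    using Caccioppoli_free_sol[OF \<eta> cnj_weight f w] by linarith
  moreover have "?A\<^sup>2 \<le> (h1norm (\<lambda>x. weight m \<rho> x * w x))\<^sup>2"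
    by (intro power_mono l2norm_le_h1norm l2norm_nonneg)
  ultimately have "7 / 8 * ?A * ?A \<le> ?F * ?A" by (simp add: power2_eq_square)
  then have "?A = 0 \<or> 7 / 8 * ?A \<le> ?F"
    using l2norm_nonneg[of "\<lambda>x. weight m \<rho> x * w x"] mult_right_le_imp_le[of "7 / 8 * ?A" ?A ?F] by fastforce
  then show ?thesis using l2norm_nonneg[of "\<lambda>x. weight m \<rho> x * w x"] l2norm_nonneg[of "\<lambda>x. weight m \<rho> x * f x"] by auto
qed

section \<open>Local energy of free solutions\<close>

definition loc_norm :: "real \<Rightarrow> fn \<Rightarrow> real" where
  "loc_norm R f = l2norm (\<lambda>x. indicator (cball 0 R) x * f x)"

lemma L2_indicator_mult: "L2 f \<Longrightarrow> S \<in> sets borel \<Longrightarrow> L2 (\<lambda>x. indicator S x * f x)"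
  by (rule L2_mult_bounded[where C=1]) (auto simp: indicator_def)

lemma loc_norm_le:
  assumes "L2 f" "L2 g" "0 \<le> C" "\<And>x. norm x \<le> R \<Longrightarrow> norm (f x) \<le> C * norm (g x)"
  shows "loc_norm R f \<le> C * l2norm g"
  unfolding loc_norm_def
proof (rule l2norm_mono)
  show "norm (indicator (cball 0 R) x * f x) \<le> C * norm (g x)" for x
    using assms(3,4) by (cases "norm x \<le> R") (auto simp: indicator_def)
qed (use assms in \<open>auto intro: L2_indicator_mult\<close>)

lemma cutoff_C1_bounded:
  assumes "0 \<le> R"
  obtains C where "0 \<le> C" "C1_bounded C (\<lambda>x. complex_of_real (cutoff R x))"
proof -
  note t = test_fn_cutoff[OF assms]
  have "\<exists>B\<ge>0. \<forall>x. norm (pd e (\<lambda>x. complex_of_real (cutoff R x)) x) \<le> B" for e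
    using test_fn_bounds[OF test_fn_pd[OF t, of e]] by metis
  then obtain B where B: "\<And>e. 0 \<le> B e" "\<And>e x. norm (pd e (\<lambda>x. complex_of_real (cutoff R x)) x) \<le> B e" by metis
  have "B e \<le> sum B Basis" if "e \<in> Basis" for e using that B by (intro member_le_sum) auto
  then have "norm (pd e (\<lambda>x. complex_of_real (cutoff R x)) x) \<le> 1 + sum B Basis" if "e \<in> Basis" for e x
    using B(2)[of e x] that by fastforce
  moreover have "norm (complex_of_real (cutoff R x)) \<le> 1 + sum B Basis" for x
    using step_nonneg step_le_1 sum_nonneg[of Basis B] B(1) by (simp add: cutoff_def add_increasing2)
  ultimately show ?thesis using that[of "1 + sum B Basis"] sum_nonneg[of Basis B] B(1)
    by (simp add: C1_bounded_def smooth_cutoff)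
qed

text \<open>The bound is kept as a product: its factor \<open>loc_norm (R + 1) w\<close> makes the
  energy small as soon as w is small in L^2 near the obstacle while f stays bounded there, which is
  what drives compactness.\<close>

lemma cutoff_energy:
  assumes R: "0 \<le> R"
  shows "\<exists>C\<ge>0. \<forall>f w. L2 f \<longrightarrow> free_sol f w \<longrightarrow>
    (h1norm (\<lambda>x. complex_of_real (cutoff R x) * w x))\<^sup>2 \<le> C * ((loc_norm (R + 1) f + loc_norm (R + 1) w) * loc_norm (R + 1) w)"
proof -
  let ?\<chi> = "\<lambda>x. complex_of_real (cutoff R x)"
  obtain C where C: "0 \<le> C" "C1_bounded C ?\<chi>" using cutoff_C1_bounded[OF R] by blast
  have out: "?\<chi> x = 0" "pd e ?\<chi> x = 0" if "x \<notin> cball 0 (R + 1)" for x e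
  proof -
    have t: "test_fn (cball 0 (R + 1)) ?\<chi>"
      by (rule test_fnI[of _ "cball 0 (R + 1)"]) (auto simp: smooth_cutoff cutoff_eq_0 R)
    show "?\<chi> x = 0" "pd e ?\<chi> x = 0" using test_fn_outside[OF t that] test_fn_outside[OF test_fn_pd[OF t] that] by auto
  qed
  have est: "(h1norm (\<lambda>x. ?\<chi> x * w x))\<^sup>2 \<le> (1 + 2 * C\<^sup>2) * ((loc_norm (R + 1) f + loc_norm (R + 1) w) * loc_norm (R + 1) w)"
    if f: "L2 f" and w: "free_sol f w" for f w
  proof -
    let ?I = "\<lambda>v x. indicator (cball 0 (R + 1)) x * v x :: complex"
    have Lw: "L2 w" using w by (intro H1_L2 free_sol_H1)
    have LI: "L2 (?I v)" if "L2 v" for v using that by (intro L2_indicator_mult) auto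
    have c: "l2norm (\<lambda>x. ?\<chi> x * v x) \<le> loc_norm (R + 1) v" if v: "L2 v" for v
      unfolding loc_norm_def
    proof (rule l2norm_mono[OF LI[OF v], of _ 1, simplified])
      show "L2 (\<lambda>x. ?\<chi> x * v x)"
        using C by (intro L2_mult_bounded[OF v smooth_measurable, where C=C]) (auto simp: C1_bounded_def)
      show "norm (?\<chi> x * v x) \<le> norm (?I v x)" for x
        using step_nonneg step_le_1 out(1)[of x] by (auto simp: norm_mult cutoff_def indicator_def mult_left_le_one_le)
    qed
    have p: "l2norm (\<lambda>x. pd e ?\<chi> x * w x) \<le> C * loc_norm (R + 1) w" if e: "e \<in> Basis" for e
      unfolding loc_norm_def
    proof (rule l2norm_mono[OF LI[OF Lw] _ _ C(1)])
      show "L2 (\<lambda>x. pd e ?\<chi> x * w x)"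
        using C e by (intro L2_mult_bounded[OF Lw smooth_measurable[OF smooth_pd], where C=C]) (auto simp: C1_bounded_def)
      show "norm (pd e ?\<chi> x * w x) \<le> C * norm (?I w x)" for x
        using C e out(2)[of x] by (cases "x \<in> cball 0 (R + 1)") (auto simp: C1_bounded_def norm_mult intro!: mult_right_mono)
    qed
    have n: "0 \<le> loc_norm (R + 1) v" for v by (simp add: loc_norm_def l2norm_nonneg)
    have "(h1norm (\<lambda>x. ?\<chi> x * w x))\<^sup>2 \<le> l2norm (\<lambda>x. ?\<chi> x * f x) * l2norm (\<lambda>x. ?\<chi> x * w x) +
        (\<Sum>e\<in>Basis. (l2norm (\<lambda>x. pd e ?\<chi> x * w x))\<^sup>2)"
      by (rule Caccioppoli_free_sol[OF C(2) _ f w]) simp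
    also have "\<dots> \<le> loc_norm (R + 1) f * loc_norm (R + 1) w + (\<Sum>e\<in>(Basis::pt set). (C * loc_norm (R + 1) w)\<^sup>2)"
      by (intro add_mono mult_mono sum_mono power_mono c p f Lw l2norm_nonneg n)
    also have "\<dots> = loc_norm (R + 1) f * loc_norm (R + 1) w + 2 * C\<^sup>2 * (loc_norm (R + 1) w * loc_norm (R + 1) w)"
      by (simp add: power_mult_distrib power2_eq_square)
    also have "\<dots> \<le> (1 + 2 * C\<^sup>2) * ((loc_norm (R + 1) f + loc_norm (R + 1) w) * loc_norm (R + 1) w)"
      using n[of f] n[of w] by (simp add: algebra_simps mult_nonneg_nonneg)
    finally show ?thesis .
  qed
  show ?thesis using est by (intro exI[of _ "1 + 2 * C\<^sup>2"]) (auto simp: add_nonneg_nonneg)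
qed

section \<open>Rellich compactness\<close>

text \<open>Telescoping over n equal steps, whose contributions agree by translation
  invariance.\<close>

lemma l2norm_translate_multiple:
  assumes u: "L2 u"
  shows "l2norm (\<lambda>x. u (x + real n *\<^sub>R z) - u x) \<le> real n * l2norm (\<lambda>x. u (x + z) - u x)"
proof (induction n)
  case 0 then show ?case by (simp add: l2norm_def)
next
  case (Suc n)
  note L = L2_translate[OF u]
  have "l2norm (\<lambda>x. u (x + real (Suc n) *\<^sub>R z) - u x) \<le>
      l2norm (\<lambda>x. u (x + real (Suc n) *\<^sub>R z) - u (x + real n *\<^sub>R z)) + l2norm (\<lambda>x. u (x + real n *\<^sub>R z) - u x)"
    by (intro l2norm_triangle_mid L u)
  also have "l2norm (\<lambda>x. u (x + real (Suc n) *\<^sub>R z) - u (x + real n *\<^sub>R z)) = l2norm (\<lambda>x. u (x + z) - u x)"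
    using l2norm_translate[where u="\<lambda>x. u (x + z) - u x" and c="real n *\<^sub>R z", OF L2_diff[OF L u]]
    by (simp add: algebra_simps)
  finally show ?case using Suc.IH by (simp add: algebra_simps)
qed

text \<open>Subdividing the step into \<open>n\<close> equal pieces bounds the left side by the \<open>L\<^sup>2\<close> norm of a
  difference quotient, for every \<open>n\<close>.\<close>

lemma l2norm_translate_test_fn:
  assumes f: "test_fn UNIV f"
  shows "l2norm (\<lambda>x. f (x + z) - f x) \<le> l2norm (pd z f)"
proof -
  note L = L2_test_fn[OF f]
  note [measurable] = test_fn_measurable[OF f] test_fn_measurable[OF test_fn_pd[OF f]]
  obtain B R where B: "0 \<le> B" "\<And>n x. norm (of_nat (Suc n) * (f (x + (1 / real (Suc n)) *\<^sub>R z) - f x))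
      \<le> B * indicator (cball 0 R) x"
    using difference_quotient_bound[OF f] by metis
  let ?q = "\<lambda>n x. of_nat (Suc n) * (f (x + (1 / real (Suc n)) *\<^sub>R z) - f x)"
  have le: "l2norm (\<lambda>x. f (x + z) - f x) \<le> l2norm (?q n)" for n
  proof -
    have "l2norm (\<lambda>x. f (x + real (Suc n) *\<^sub>R ((1 / real (Suc n)) *\<^sub>R z)) - f x) \<le>
        real (Suc n) * l2norm (\<lambda>x. f (x + (1 / real (Suc n)) *\<^sub>R z) - f x)"
      by (rule l2norm_translate_multiple[OF L])
    also have "\<dots> = l2norm (?q n)"
      using l2norm_scale[OF L2_diff[OF L2_translate[OF L] L], of "of_nat (Suc n)" "(1 / real (Suc n)) *\<^sub>R z"]
      by (simp del: of_nat_Suc)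
    finally show ?thesis by simp
  qed
  have "(\<lambda>n. integral\<^sup>L lborel (\<lambda>x. (norm (?q n x))\<^sup>2)) \<longlonglongrightarrow> integral\<^sup>L lborel (\<lambda>x. (norm (pd z f x))\<^sup>2)"
  proof (rule integral_dominated_convergence)
    show "integrable lborel (\<lambda>x::pt. B\<^sup>2 * indicator (cball 0 R) x)"
      by (intro integrable_mult_right integrable_indicator_cball)
    show "AE x in lborel. (\<lambda>n. (norm (?q n x))\<^sup>2) \<longlonglongrightarrow> (norm (pd z f x))\<^sup>2"
      by (intro AE_I2 tendsto_intros difference_quotient_tendsto test_fn_smooth[OF f])
    show "AE x in lborel. norm ((norm (?q n x))\<^sup>2) \<le> B\<^sup>2 * indicator (cball 0 R) x" for n
    proof (rule AE_I2)
      fix x show "norm ((norm (?q n x))\<^sup>2) \<le> B\<^sup>2 * indicator (cball 0 R) x"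
        using power_mono[OF B(2)[of n x] norm_ge_zero, of 2]
        by (cases "norm x \<le> R") (simp_all add: power_mult_distrib)
    qed
  qed auto
  then have "(\<lambda>n. l2norm (?q n)) \<longlonglongrightarrow> l2norm (pd z f)" unfolding l2norm_def by (rule tendsto_real_sqrt)
  then show ?thesis using le by (intro LIMSEQ_le_const) auto
qed

text \<open>Density reduces this to test functions. The factor 2 counts the coordinate directions
  into which \<open>pd z\<close> is expanded, each contributing at most |z| times the
  \<open>h1norm\<close>.\<close>

lemma l2norm_translate_H1:
  assumes u: "H1 u"
  shows "l2norm (\<lambda>x. u (x + z) - u x) \<le> 2 * norm z * h1norm u"
proof (rule field_le_epsilon)
  fix e :: real assume e: "0 < e"
  \<comment> \<open>Replacing u by \<open>\<phi>\<close> costs d for each of the two copies of u and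
    2 |z| d for the energy, in total d (2 + 2 |z|) = e.\<close>
  define d where "d = e / (2 + 2 * norm z)"
  have d: "0 < d" using e by (simp add: d_def add_pos_nonneg)
  obtain \<phi> where \<phi>: "test_fn UNIV \<phi>" "h1norm (\<lambda>x. u x - \<phi> x) < d"
    using H1_imp_H10_UNIV[OF u] d unfolding H10_iff by blast
  note Lu = H1_L2[OF u] and Lp = L2_test_fn[OF \<phi>(1)] and Hp = H1_test_fn[OF \<phi>(1)]
  have 0: "l2norm (\<lambda>x. u x - \<phi> x) \<le> d" using l2norm_le_h1norm[of "\<lambda>x. u x - \<phi> x"] \<phi>(2) by linarith
  have "l2norm (pd z \<phi>) \<le> 2 * norm z * h1norm \<phi>"
  proof -
    have pz: "pd z \<phi> x = (\<Sum>e\<in>Basis. of_real (z \<bullet> e) * pd e \<phi> x)" for x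
      by (subst pd_Basis_sum[OF smooth_differentiable[OF test_fn_smooth[OF \<phi>(1)]]]) (simp only: scaleR_conv_of_real)
    have "L2 (\<lambda>x. \<Sum>e\<in>A. of_real (z \<bullet> e) * pd e \<phi> x) \<and>
        l2norm (\<lambda>x. \<Sum>e\<in>A. of_real (z \<bullet> e) * pd e \<phi> x) \<le> real (card A) * (norm z * h1norm \<phi>)"
      if "finite A" "A \<subseteq> Basis" for A
      using that
    proof (induction A)
      case empty then show ?case by (simp add: l2norm_def L2_0)
    next
      case (insert e A)
      then have e: "e \<in> Basis" by simp
      have Le: "L2 (\<lambda>x. of_real (z \<bullet> e) * pd e \<phi> x)" by (intro L2_scale L2_pd_test_fn[OF \<phi>(1)])
      have "l2norm (\<lambda>x. of_real (z \<bullet> e) * pd e \<phi> x) = \<bar>z \<bullet> e\<bar> * l2norm (wgrad e \<phi>)"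
        using l2norm_scale[OF L2_pd_test_fn[OF \<phi>(1)], of "of_real (z \<bullet> e)" e]
          l2norm_cong_AE[OF wgrad(1)[OF Hp e] L2_pd_test_fn[OF \<phi>(1)] wgrad_test_fn[OF \<phi>(1)]] by simp
      also have "\<dots> \<le> norm z * h1norm \<phi>"
        by (intro mult_mono Basis_le_norm e l2norm_wgrad_le_h1norm l2norm_nonneg norm_ge_zero)
      finally show ?case
        using insert l2norm_triangle[OF Le, of "\<lambda>x. \<Sum>e\<in>A. of_real (z \<bullet> e) * pd e \<phi> x"]
        by (auto simp: distrib_right intro!: L2_add Le)
    qed
    from this[of Basis] show ?thesis unfolding pz[abs_def] by simp
  qed
  with l2norm_translate_test_fn[OF \<phi>(1), of z] have 1: "l2norm (\<lambda>x. \<phi> (x + z) - \<phi> x) \<le> 2 * norm z * h1norm \<phi>" by linarith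
  have "h1norm \<phi> \<le> h1norm u + d"
    using h1norm_triangle_diff[OF u H1_diff[OF u Hp]] \<phi>(2) by simp
  then have 2: "2 * norm z * h1norm \<phi> \<le> 2 * norm z * (h1norm u + d)" by (intro mult_left_mono) auto
  have "l2norm (\<lambda>x. u (x + z) - u x) = l2norm (\<lambda>x. ((u (x + z) - \<phi> (x + z)) + (\<phi> (x + z) - \<phi> x)) - (u x - \<phi> x))"
    by simp
  also have "\<dots> \<le> l2norm (\<lambda>x. (u (x + z) - \<phi> (x + z)) + (\<phi> (x + z) - \<phi> x)) + l2norm (\<lambda>x. u x - \<phi> x)"
    by (intro l2norm_triangle_diff L2_add L2_diff L2_translate Lu Lp)
  also have "l2norm (\<lambda>x. (u (x + z) - \<phi> (x + z)) + (\<phi> (x + z) - \<phi> x)) \<le>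
      l2norm (\<lambda>x. u (x + z) - \<phi> (x + z)) + l2norm (\<lambda>x. \<phi> (x + z) - \<phi> x)"
    by (intro l2norm_triangle L2_diff L2_translate Lu Lp)
  also have "l2norm (\<lambda>x. u (x + z) - \<phi> (x + z)) = l2norm (\<lambda>x. u x - \<phi> x)"
    by (rule l2norm_translate[OF L2_diff[OF Lu Lp]])
  finally have "l2norm (\<lambda>x. u (x + z) - u x) \<le> d + 2 * norm z * (h1norm u + d) + d"
    using 0 1 2 by linarith
  also have "\<dots> = 2 * norm z * h1norm u + d * (2 + 2 * norm z)" by (simp add: algebra_simps)
  also have "d * (2 + 2 * norm z) = e"
  proof -
    have "2 + 2 * norm z \<noteq> 0" using norm_ge_zero[of z] by linarith
    then show ?thesis unfolding d_def by (rule nonzero_eq_divide_eq[THEN iffD1, OF _ refl])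
  qed
  finally show "l2norm (\<lambda>x. u (x + z) - u x) \<le> 2 * norm z * h1norm u + e" .
qed

section \<open>Grid cells, the Friedrichs inequality and Rellich's theorem\<close>

definition cell :: "real \<Rightarrow> int \<times> int \<Rightarrow> pt set" where
  "cell h k = {x. \<lfloor>x $ 1 / h\<rfloor> = fst k \<and> \<lfloor>x $ 2 / h\<rfloor> = snd k}"

lemma floor_divide_eq_iff:
  assumes "0 < h" shows "\<lfloor>t / h\<rfloor> = k \<longleftrightarrow> of_int k * h \<le> t \<and> t < of_int k * h + h"
  using assms by (simp add: floor_eq_iff field_simps)

text \<open>An open and a closed box of equal volume sandwich the half-open cell, which gives its
  measure.\<close>

lemma cell_bounds:
  assumes h: "0 < h"
  shows "box (vector [of_int (fst k) * h, of_int (snd k) * h]) (vector [of_int (fst k) * h + h, of_int (snd k) * h + h]) \<subseteq> cell h k"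
    and "cell h k \<subseteq> cbox (vector [of_int (fst k) * h, of_int (snd k) * h]) (vector [of_int (fst k) * h + h, of_int (snd k) * h + h])"
  using h by (auto simp: cell_def floor_divide_eq_iff mem_box_cart forall_2)

lemma cell_measurable [measurable]: "cell h k \<in> sets borel"
proof -
  have [measurable]: "(\<lambda>x::pt. x $ i) \<in> borel_measurable borel" for i
    by (intro borel_measurable_continuous_onI continuous_intros)
  have "{x \<in> space borel. \<lfloor>x $ 1 / h\<rfloor> = fst k \<and> \<lfloor>(x::pt) $ 2 / h\<rfloor> = snd k} \<in> sets borel" by measurable
  then show ?thesis by (simp add: cell_def)
qed

lemma emeasure_cell:
  assumes h: "0 < h" shows "emeasure lborel (cell h k) = ennreal (h\<^sup>2)"
proof -
  let ?a = "vector [of_int (fst k) * h, of_int (snd k) * h] :: pt"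
  let ?b = "vector [of_int (fst k) * h + h, of_int (snd k) * h + h] :: pt"
  have B: "(Basis :: pt set) = {axis 1 1, axis 2 (1::real)}" and B2: "axis 1 (1::real) \<noteq> (axis 2 1 :: pt)"
    by (auto simp: Basis_vec_def axis_eq_axis UNIV_2)
  have le: "?a \<bullet> b \<le> ?b \<bullet> b" if "b \<in> Basis" for b
  proof -
    have "b = axis 1 1 \<or> b = axis 2 1" using that B by blast
    then show ?thesis using h by (auto simp: inner_axis)
  qed
  have p: "(\<Prod>b\<in>Basis. (?b - ?a) \<bullet> b) = h\<^sup>2"
    unfolding B using B2 by (simp add: inner_axis power2_eq_square)
  have "emeasure lborel (box ?a ?b) = ennreal (h\<^sup>2)" "emeasure lborel (cbox ?a ?b) = ennreal (h\<^sup>2)"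
    using emeasure_lborel_box[OF le] emeasure_lborel_cbox[OF le] p by auto
  moreover have "emeasure lborel (box ?a ?b) \<le> emeasure lborel (cell h k)"
    by (intro emeasure_mono cell_bounds h) simp
  moreover have "emeasure lborel (cell h k) \<le> emeasure lborel (cbox ?a ?b)"
    by (intro emeasure_mono cell_bounds h) simp
  ultimately show ?thesis by (simp add: antisym)
qed

lemma L2_indicator_cell: assumes "0 < h" shows "L2 (\<lambda>x. indicator (cell h k) x)"
proof -
  have "bounded (cell h k)" using cell_bounds(2)[OF assms] bounded_cbox bounded_subset by blast
  then obtain R where "\<And>x. R < norm x \<Longrightarrow> x \<notin> cell h k" unfolding bounded_iff by (meson not_le)
  then show ?thesis by (intro L2_bounded_support[where B=1 and R=R]) (auto simp: indicator_def)
qed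

definition cell_int :: "real \<Rightarrow> int \<times> int \<Rightarrow> fn \<Rightarrow> complex" where
  "cell_int h k u = integral\<^sup>L lborel (\<lambda>x. indicator (cell h k) x * u x)"

text \<open>Expanding the square over Q x Q: the pair differences integrate to 2 |Q| times the
  integral of |u|^2, minus twice the squared modulus of the integral of u. As \<open>ennreal\<close>
  subtraction is truncated, the last term is moved to the other side.\<close>

lemma cell_variance:
  assumes h: "0 < h" and u: "L2 u"
  shows "ennreal (2 * h\<^sup>2 * (l2norm (\<lambda>x. indicator (cell h k) x * u x))\<^sup>2) =
    (\<integral>\<^sup>+x. \<integral>\<^sup>+y. indicator (cell h k) x * indicator (cell h k) y * ennreal ((norm (u x - u y))\<^sup>2) \<partial>lborel \<partial>lborel)
    + ennreal (2 * (norm (cell_int h k u))\<^sup>2)"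
proof -
  let ?Q = "cell h k"
  note [measurable] = L2_measurable[OF u]
  let ?w = "\<lambda>x. indicator ?Q x * u x :: complex"
  have Lw: "L2 ?w" by (rule L2_indicator_mult[OF u]) simp
  define A where "A = (l2norm ?w)\<^sup>2"
  define c where "c = cell_int h k u"
  have Iw: "integrable lborel ?w"
    using L2_prod_integrable[OF L2_indicator_cell[OF h] u] .
  have I2: "integrable lborel (\<lambda>x. (norm (?w x))\<^sup>2)" by (rule L2_integrable_sq[OF Lw])
  have I1: "integrable lborel (indicat_real ?Q)"
    by (intro integrable_real_indicator) (simp_all add: emeasure_cell[OF h])
  have m1: "integral\<^sup>L lborel (indicat_real ?Q) = h\<^sup>2"
    by (simp add: measure_def emeasure_cell[OF h])
  have A: "integral\<^sup>L lborel (\<lambda>x. (norm (?w x))\<^sup>2) = A" by (simp add: A_def l2norm_sq)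
  have c: "integral\<^sup>L lborel ?w = c" by (simp add: c_def cell_int_def)
  have pt: "indicat_real ?Q y * (norm (a - u y))\<^sup>2 =
      indicat_real ?Q y * (norm a)\<^sup>2 - 2 * Re (cnj a * ?w y) + (norm (?w y))\<^sup>2" for a y
    by (cases "y \<in> ?Q"; simp add: cmod_power2; simp add: power2_eq_square algebra_simps)
  have Ia: "integrable lborel (\<lambda>y. indicat_real ?Q y * (norm (a - u y))\<^sup>2)"
    and inner: "integral\<^sup>L lborel (\<lambda>y. indicat_real ?Q y * (norm (a - u y))\<^sup>2) = h\<^sup>2 * (norm a)\<^sup>2 - 2 * Re (cnj a * c) + A" for a
  proof -
    have 1: "integrable lborel (\<lambda>y. indicat_real ?Q y * (norm a)\<^sup>2)" by (intro integrable_mult_left I1)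
    have 2: "integrable lborel (\<lambda>y. 2 * Re (cnj a * ?w y))" by (intro integrable_mult_right integrable_Re Iw)
    show "integrable lborel (\<lambda>y. indicat_real ?Q y * (norm (a - u y))\<^sup>2)"
      unfolding pt by (intro Bochner_Integration.integrable_add Bochner_Integration.integrable_diff 1 2 I2)
    have "integral\<^sup>L lborel (\<lambda>y. Re (cnj a * ?w y)) = Re (cnj a * c)"
      using integral_Re[OF integrable_mult_right[OF Iw, of "cnj a"]] c by (simp only: integral_mult_right_zero)
    then show "integral\<^sup>L lborel (\<lambda>y. indicat_real ?Q y * (norm (a - u y))\<^sup>2) = h\<^sup>2 * (norm a)\<^sup>2 - 2 * Re (cnj a * c) + A"
      unfolding pt using 1 2 I2 m1 A by (simp only: Bochner_Integration.integral_add Bochner_Integration.integral_diff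
          Bochner_Integration.integrable_diff integral_mult_left_zero integral_mult_right_zero)
  qed
  have outer_pt: "indicat_real ?Q x * (h\<^sup>2 * (norm (u x))\<^sup>2 - 2 * Re (cnj (u x) * c) + A) =
      h\<^sup>2 * (norm (?w x))\<^sup>2 - 2 * Re (cnj c * ?w x) + A * indicat_real ?Q x" for x
    by (simp add: indicator_def)
  have 1: "integrable lborel (\<lambda>x. h\<^sup>2 * (norm (?w x))\<^sup>2)" by (intro integrable_mult_right I2)
  have 2: "integrable lborel (\<lambda>x. 2 * Re (cnj c * ?w x))" by (intro integrable_mult_right integrable_Re Iw)
  have 3: "integrable lborel (\<lambda>x. A * indicat_real ?Q x)" by (intro integrable_mult_right I1)
  have Io: "integrable lborel (\<lambda>x. indicat_real ?Q x * (h\<^sup>2 * (norm (u x))\<^sup>2 - 2 * Re (cnj (u x) * c) + A))"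
    unfolding outer_pt by (intro Bochner_Integration.integrable_add Bochner_Integration.integrable_diff 1 2 3)
  have "integral\<^sup>L lborel (\<lambda>x. Re (cnj c * ?w x)) = Re (cnj c * c)"
    using integral_Re[OF integrable_mult_right[OF Iw, of "cnj c"]] c by (simp only: integral_mult_right_zero)
  moreover have "Re (cnj c * c) = (norm c)\<^sup>2" unfolding cmod_power2 by (simp add: power2_eq_square)
  ultimately have outer: "integral\<^sup>L lborel (\<lambda>x. indicat_real ?Q x * (h\<^sup>2 * (norm (u x))\<^sup>2 - 2 * Re (cnj (u x) * c) + A)) =
      h\<^sup>2 * A - 2 * (norm c)\<^sup>2 + A * h\<^sup>2"
    unfolding outer_pt using 1 2 3 m1 A by (simp only: Bochner_Integration.integral_add Bochner_Integration.integral_diff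
          Bochner_Integration.integrable_diff integral_mult_left_zero integral_mult_right_zero)
  have nn: "0 \<le> h\<^sup>2 * (norm a)\<^sup>2 - 2 * Re (cnj a * c) + A" for a
    unfolding inner[symmetric] by (intro Bochner_Integration.integral_nonneg) simp
  have "(\<integral>\<^sup>+x. \<integral>\<^sup>+y. indicator ?Q x * indicator ?Q y * ennreal ((norm (u x - u y))\<^sup>2) \<partial>lborel \<partial>lborel) =
      (\<integral>\<^sup>+x. indicator ?Q x * ennreal (h\<^sup>2 * (norm (u x))\<^sup>2 - 2 * Re (cnj (u x) * c) + A) \<partial>lborel)"
  proof (rule nn_integral_cong)
    fix x
    have "(\<integral>\<^sup>+y. indicator ?Q x * indicator ?Q y * ennreal ((norm (u x - u y))\<^sup>2) \<partial>lborel) =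
        indicator ?Q x * (\<integral>\<^sup>+y. ennreal (indicat_real ?Q y * (norm (u x - u y))\<^sup>2) \<partial>lborel)"
      by (subst nn_integral_cmult[symmetric], simp, intro nn_integral_cong) (simp add: ennreal_mult'' ennreal_indicator mult.assoc)
    also have "(\<integral>\<^sup>+y. ennreal (indicat_real ?Q y * (norm (u x - u y))\<^sup>2) \<partial>lborel) = ennreal (h\<^sup>2 * (norm (u x))\<^sup>2 - 2 * Re (cnj (u x) * c) + A)"
      unfolding inner[symmetric] by (intro nn_integral_eq_integral Ia) auto
    finally show "(\<integral>\<^sup>+y. indicator ?Q x * indicator ?Q y * ennreal ((norm (u x - u y))\<^sup>2) \<partial>lborel) =
        indicator ?Q x * ennreal (h\<^sup>2 * (norm (u x))\<^sup>2 - 2 * Re (cnj (u x) * c) + A)" .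
  qed
  also have "\<dots> = (\<integral>\<^sup>+x. ennreal (indicat_real ?Q x * (h\<^sup>2 * (norm (u x))\<^sup>2 - 2 * Re (cnj (u x) * c) + A)) \<partial>lborel)"
    by (intro nn_integral_cong) (simp add: ennreal_mult' ennreal_indicator)
  also have "\<dots> = ennreal (h\<^sup>2 * A - 2 * (norm c)\<^sup>2 + A * h\<^sup>2)"
    unfolding outer[symmetric] by (intro nn_integral_eq_integral Io AE_I2 mult_nonneg_nonneg nn) simp
  finally have eq: "(\<integral>\<^sup>+x. \<integral>\<^sup>+y. indicator ?Q x * indicator ?Q y * ennreal ((norm (u x - u y))\<^sup>2) \<partial>lborel \<partial>lborel) =
      ennreal (h\<^sup>2 * A - 2 * (norm c)\<^sup>2 + A * h\<^sup>2)" .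
  have "0 \<le> h\<^sup>2 * A - 2 * (norm c)\<^sup>2 + A * h\<^sup>2"
    unfolding outer[symmetric] by (intro Bochner_Integration.integral_nonneg mult_nonneg_nonneg nn) simp
  then show ?thesis
    unfolding eq A_def[symmetric] c_def[symmetric] by (subst ennreal_plus[symmetric]) (auto simp: algebra_simps)
qed

text \<open>The floors make the cells half-open, so they partition the plane and a point determines
  its index.\<close>

lemma cell_iff: "x \<in> cell h k \<longleftrightarrow> k = (\<lfloor>x $ 1 / h\<rfloor>, \<lfloor>x $ 2 / h\<rfloor>)"
  by (auto simp: cell_def prod_eq_iff)

text \<open>The cells are disjoint, and those indexed by \<open>F\<close> cover the ball that
  carries u.\<close>

lemma sum_cells_l2norm:
  assumes h: "0 < h" and u: "L2 u" and R: "\<And>x. R < norm x \<Longrightarrow> u x = 0" "0 \<le> R"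
    and F: "F = {- \<lceil>R / h\<rceil> - 1..\<lceil>R / h\<rceil> + 1} \<times> {- \<lceil>R / h\<rceil> - 1..\<lceil>R / h\<rceil> + 1}"
  shows "(l2norm u)\<^sup>2 = (\<Sum>k\<in>F. (l2norm (\<lambda>x. indicator (cell h k) x * u x))\<^sup>2)"
proof -
  have "(\<Sum>k\<in>F. (l2norm (\<lambda>x. indicator (cell h k) x * u x))\<^sup>2) =
      integral\<^sup>L lborel (\<lambda>x. \<Sum>k\<in>F. (norm (indicator (cell h k) x * u x))\<^sup>2)"
    unfolding l2norm_sq by (intro Bochner_Integration.integral_sum[symmetric] L2_integrable_sq L2_indicator_mult u) simp
  also have "(\<lambda>x. \<Sum>k\<in>F. (norm (indicator (cell h k) x * u x))\<^sup>2) = (\<lambda>x. (norm (u x))\<^sup>2)"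
  proof
    fix x :: pt
    let ?k = "(\<lfloor>x $ 1 / h\<rfloor>, \<lfloor>x $ 2 / h\<rfloor>)"
    have "(norm (indicator (cell h k) x * u x))\<^sup>2 = (if k = ?k then (norm (u x))\<^sup>2 else 0)" for k
      by (simp add: indicator_def cell_iff)
    then have eq: "(\<Sum>k\<in>F. (norm (indicator (cell h k) x * u x))\<^sup>2) = (if ?k \<in> F then (norm (u x))\<^sup>2 else 0)"
      by (simp add: F)
    show "(\<Sum>k\<in>F. (norm (indicator (cell h k) x * u x))\<^sup>2) = (norm (u x))\<^sup>2"
    proof (cases "norm x \<le> R")
      case True
      have "\<lfloor>x $ i / h\<rfloor> \<in> {- \<lceil>R / h\<rceil> - 1..\<lceil>R / h\<rceil> + 1}" for i
      proof -
        have "\<bar>x $ i\<bar> \<le> R" using True component_le_norm_cart order_trans by blast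
        then have "\<bar>x $ i / h\<bar> \<le> R / h" using h by (simp add: divide_right_mono)
        then have "x $ i / h \<le> R / h" "- (R / h) \<le> x $ i / h" by linarith+
        then show ?thesis unfolding atLeastAtMost_iff by linarith
      qed
      then show ?thesis unfolding eq by (simp add: F)
    next
      case False
      then show ?thesis unfolding eq using R by simp
    qed
  qed
  finally show ?thesis by (simp add: l2norm_sq)
qed

lemma norm_diff_cell:
  assumes h: "0 < h" and "x \<in> cell h k" "y \<in> cell h k"
  shows "norm (y - x) \<le> 2 * h"
proof -
  have "\<bar>(y - x) $ i\<bar> \<le> h" for i
    using assms exhaust_2[of i] by (auto simp: cell_def floor_divide_eq_iff)
  then have "(\<Sum>i\<in>UNIV. \<bar>(y - x) $ i\<bar>) \<le> (\<Sum>i\<in>(UNIV :: 2 set). h)" by (rule sum_mono)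
  then show ?thesis using norm_le_l1_cart[of "y - x"] by simp
qed

text \<open>Substituting y = z + x and exchanging the integrals leaves the translation estimate with
  |z| \<le> 2 h: at most (4 h)^2 times the squared \<open>h1norm\<close>, integrated over a disc of
  area 4 pi h^2.\<close>

lemma difference_integral_le:
  assumes h: "0 < h" and u: "H1 u"
  shows "(\<integral>\<^sup>+x. \<integral>\<^sup>+y. indicator (cball 0 (2 * h)) (y - x) * ennreal ((norm (u x - u y))\<^sup>2) \<partial>lborel \<partial>lborel)
    \<le> ennreal (64 * pi * h ^ 4 * (h1norm u)\<^sup>2)"
proof -
  note [measurable] = L2_measurable[OF H1_L2[OF u]]
  let ?B = "cball 0 (2 * h) :: pt set"
  have "(\<integral>\<^sup>+x. \<integral>\<^sup>+y. indicator ?B (y - x) * ennreal ((norm (u x - u y))\<^sup>2) \<partial>lborel \<partial>lborel) =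
      (\<integral>\<^sup>+x. \<integral>\<^sup>+z. indicator ?B z * ennreal ((norm (u x - u (z + x)))\<^sup>2) \<partial>lborel \<partial>lborel)"
  proof (rule nn_integral_cong)
    fix x :: pt
    have [measurable]: "(\<lambda>y. indicator ?B (y - x) :: ennreal) \<in> borel_measurable borel"
      by (rule measurable_compose[where N=borel]) (simp_all add: borel_measurable_indicator)
    have m: "(\<lambda>y. indicator ?B (y - x) * ennreal ((norm (u x - u y))\<^sup>2)) \<in> borel_measurable borel" by measurable
    show "(\<integral>\<^sup>+y. indicator ?B (y - x) * ennreal ((norm (u x - u y))\<^sup>2) \<partial>lborel) =
        (\<integral>\<^sup>+z. indicator ?B z * ennreal ((norm (u x - u (z + x)))\<^sup>2) \<partial>lborel)"
      using nn_integral_translate[OF m, of x] by simp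
  qed
  also have "\<dots> = (\<integral>\<^sup>+z. \<integral>\<^sup>+x. indicator ?B z * ennreal ((norm (u x - u (z + x)))\<^sup>2) \<partial>lborel \<partial>lborel)"
  proof (rule lborel_pair.Fubini'[symmetric])
    have [measurable]: "(\<lambda>p. indicator ?B (snd p) :: ennreal) \<in> borel_measurable (borel \<Otimes>\<^sub>M borel)"
      by (rule measurable_compose[OF measurable_snd borel_measurable_indicator]) simp
    have "(\<lambda>p. indicator ?B (snd p) * ennreal ((norm (u (fst p) - u (snd p + fst p)))\<^sup>2)) \<in> borel_measurable (borel \<Otimes>\<^sub>M borel)"
      by measurable
    then show "(\<lambda>(x, z). indicator ?B z * ennreal ((norm (u x - u (z + x)))\<^sup>2)) \<in> borel_measurable (lborel \<Otimes>\<^sub>M lborel)"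
      by (simp add: case_prod_unfold cong: measurable_cong_sets sets_pair_measure_cong)
  qed
  also have "\<dots> \<le> (\<integral>\<^sup>+z. ennreal ((4 * h * h1norm u)\<^sup>2) * indicator ?B z \<partial>lborel)"
  proof (rule nn_integral_mono)
    fix z
    show "(\<integral>\<^sup>+x. indicator ?B z * ennreal ((norm (u x - u (z + x)))\<^sup>2) \<partial>lborel) \<le> ennreal ((4 * h * h1norm u)\<^sup>2) * indicator ?B z"
    proof (cases "z \<in> ?B")
      case True
      have L: "L2 (\<lambda>x. u (x + z) - u x)" by (intro L2_diff L2_translate H1_L2 u)
      have "(\<integral>\<^sup>+x. indicator ?B z * ennreal ((norm (u x - u (z + x)))\<^sup>2) \<partial>lborel) = ennreal ((l2norm (\<lambda>x. u (x + z) - u x))\<^sup>2)"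
        using True nn_integral_sq[OF L] by (simp add: norm_minus_commute add.commute)
      also have "\<dots> \<le> ennreal ((4 * h * h1norm u)\<^sup>2)"
      proof (intro ennreal_leI power_mono l2norm_nonneg)
        have "l2norm (\<lambda>x. u (x + z) - u x) \<le> 2 * norm z * h1norm u" by (rule l2norm_translate_H1[OF u])
        also have "\<dots> \<le> 2 * (2 * h) * h1norm u" using True by (intro mult_right_mono mult_left_mono h1norm_nonneg) auto
        finally show "l2norm (\<lambda>x. u (x + z) - u x) \<le> 4 * h * h1norm u" by simp
      qed
      finally show ?thesis using True by simp
    qed simp
  qed
  also have "\<dots> = ennreal ((4 * h * h1norm u)\<^sup>2) * emeasure lborel ?B"
    by (rule nn_integral_cmult_indicator) simp
  also have "emeasure lborel ?B = ennreal (pi * (2 * h)\<^sup>2)"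
    using h by (simp add: emeasure_cball unit_ball_vol_2)
  also have "ennreal ((4 * h * h1norm u)\<^sup>2) * ennreal (pi * (2 * h)\<^sup>2) = ennreal (64 * pi * h ^ 4 * (h1norm u)\<^sup>2)"
  proof -
    have "ennreal ((4 * h * h1norm u)\<^sup>2) * ennreal (pi * (2 * h)\<^sup>2) = ennreal ((4 * h * h1norm u)\<^sup>2 * (pi * (2 * h)\<^sup>2))"
      by (rule ennreal_mult[symmetric]) auto
    then show ?thesis by (simp add: power_mult_distrib power4_eq_xxxx power2_eq_square mult_ac)
  qed
  finally show ?thesis .
qed

text \<open>The variance identity is summed over cells. Two points of one cell are at distance at
  most 2 h and share no other cell, so all pair differences together are covered by a single use of
  \<open>difference_integral_le\<close>; dividing by 2 h^2 gives the constants. \<open>F\<close>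
  depends on h and R only, so one finite set of cell integrals serves all functions.\<close>

lemma Friedrichs_inequality:
  assumes h: "0 < h" and R: "0 \<le> R"
  shows "\<exists>F. finite F \<and> (\<forall>u. H1 u \<longrightarrow> (\<forall>x. R < norm x \<longrightarrow> u x = 0) \<longrightarrow>
    (l2norm u)\<^sup>2 \<le> 32 * pi * h\<^sup>2 * (h1norm u)\<^sup>2 + (\<Sum>k\<in>F. (norm (cell_int h k u))\<^sup>2) / h\<^sup>2)"
proof -
  define F where F: "F = {- \<lceil>R / h\<rceil> - 1..\<lceil>R / h\<rceil> + 1} \<times> {- \<lceil>R / h\<rceil> - 1..\<lceil>R / h\<rceil> + 1}"
  have fin: "finite F" by (simp add: F)
  have "(l2norm u)\<^sup>2 \<le> 32 * pi * h\<^sup>2 * (h1norm u)\<^sup>2 + (\<Sum>k\<in>F. (norm (cell_int h k u))\<^sup>2) / h\<^sup>2"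
    if u: "H1 u" and out: "\<And>x. R < norm x \<Longrightarrow> u x = 0" for u
  proof -
    note L = H1_L2[OF u]
    note [measurable] = L2_measurable[OF L]
    define S where "S = (\<Sum>k\<in>F. (norm (cell_int h k u))\<^sup>2)"
    have S: "0 \<le> S" unfolding S_def by (intro sum_nonneg) simp
    let ?D = "\<lambda>k x y. indicator (cell h k) x * indicator (cell h k) y * ennreal ((norm (u x - u y))\<^sup>2)"
    have "ennreal (2 * h\<^sup>2 * (l2norm u)\<^sup>2) = (\<Sum>k\<in>F. ennreal (2 * h\<^sup>2 * (l2norm (\<lambda>x. indicator (cell h k) x * u x))\<^sup>2))"
    proof -
      have "2 * h\<^sup>2 * (l2norm u)\<^sup>2 = (\<Sum>k\<in>F. 2 * h\<^sup>2 * (l2norm (\<lambda>x. indicator (cell h k) x * u x))\<^sup>2)"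
        using sum_cells_l2norm[OF h L out R F] by (simp only: sum_distrib_left)
      then show ?thesis by (subst sum_ennreal) (simp_all only: mult_nonneg_nonneg zero_le_power2 zero_le_numeral)
    qed
    also have "\<dots> = (\<Sum>k\<in>F. (\<integral>\<^sup>+x. \<integral>\<^sup>+y. ?D k x y \<partial>lborel \<partial>lborel)) + (\<Sum>k\<in>F. ennreal (2 * (norm (cell_int h k u))\<^sup>2))"
      unfolding cell_variance[OF h L] by (rule sum.distrib)
    also have "(\<Sum>k\<in>F. ennreal (2 * (norm (cell_int h k u))\<^sup>2)) = ennreal (2 * S)"
      by (simp add: S_def sum_distrib_left)
    also have "(\<Sum>k\<in>F. (\<integral>\<^sup>+x. \<integral>\<^sup>+y. ?D k x y \<partial>lborel \<partial>lborel)) = (\<integral>\<^sup>+x. \<integral>\<^sup>+y. (\<Sum>k\<in>F. ?D k x y) \<partial>lborel \<partial>lborel)"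
      by (simp add: nn_integral_sum)
    also have "\<dots> \<le> (\<integral>\<^sup>+x. \<integral>\<^sup>+y. indicator (cball 0 (2 * h)) (y - x) * ennreal ((norm (u x - u y))\<^sup>2) \<partial>lborel \<partial>lborel)"
    proof (intro nn_integral_mono)
      fix x y :: pt
      let ?k = "(\<lfloor>x $ 1 / h\<rfloor>, \<lfloor>x $ 2 / h\<rfloor>)"
      have "(\<Sum>k\<in>F. ?D k x y) \<le> (\<Sum>k\<in>F. if k = ?k then indicator (cball 0 (2 * h)) (y - x) * ennreal ((norm (u x - u y))\<^sup>2) else 0)"
      proof (rule sum_mono)
        fix k
        show "?D k x y \<le> (if k = ?k then indicator (cball 0 (2 * h)) (y - x) * ennreal ((norm (u x - u y))\<^sup>2) else 0)"
        proof (cases "x \<in> cell h k \<and> y \<in> cell h k")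
          case True
          moreover from this have "y - x \<in> cball 0 (2 * h)" using norm_diff_cell[OF h, of x k y] by simp
          moreover have "k = ?k" using True cell_iff by blast
          ultimately show ?thesis by simp
        qed auto
      qed
      also have "\<dots> \<le> indicator (cball 0 (2 * h)) (y - x) * ennreal ((norm (u x - u y))\<^sup>2)"
        using fin by simp
      finally show "(\<Sum>k\<in>F. ?D k x y) \<le> indicator (cball 0 (2 * h)) (y - x) * ennreal ((norm (u x - u y))\<^sup>2)" .
    qed
    also have "\<dots> \<le> ennreal (64 * pi * h ^ 4 * (h1norm u)\<^sup>2)" by (rule difference_integral_le[OF h u])
    finally have "ennreal (2 * h\<^sup>2 * (l2norm u)\<^sup>2) \<le> ennreal (64 * pi * h ^ 4 * (h1norm u)\<^sup>2) + ennreal (2 * S)"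
      by (simp add: add_right_mono)
    also have "\<dots> = ennreal (64 * pi * h ^ 4 * (h1norm u)\<^sup>2 + 2 * S)" using S by (intro ennreal_plus[symmetric]) auto
    finally have "2 * h\<^sup>2 * (l2norm u)\<^sup>2 \<le> 64 * pi * h ^ 4 * (h1norm u)\<^sup>2 + 2 * S"
      using S by (subst (asm) ennreal_le_iff) auto
    then have "h\<^sup>2 * (l2norm u)\<^sup>2 \<le> h\<^sup>2 * (32 * pi * h\<^sup>2 * (h1norm u)\<^sup>2 + S / h\<^sup>2)"
      using h by (simp add: algebra_simps power4_eq_xxxx power2_eq_square)
    then show ?thesis using h by (simp add: S_def)
  qed
  then show ?thesis using fin by blast
qed

lemma cell_int_diff:
  assumes "0 < h" "L2 u" "L2 v"
  shows "cell_int h k (\<lambda>x. u x - v x) = cell_int h k u - cell_int h k v"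
  using assms by (simp add: cell_int_def right_diff_distrib L2_prod_integrable L2_indicator_cell)

lemma norm_cell_int_le:
  assumes "0 < h" "L2 u" shows "norm (cell_int h k u) \<le> h * l2norm u"
proof -
  have "(\<lambda>x. (norm (indicator (cell h k) x :: complex))\<^sup>2) = indicat_real (cell h k)"
    by (auto simp: indicator_def)
  then have "l2norm (\<lambda>x. indicator (cell h k) x) = h"
    using assms(1) by (simp add: l2norm_def measure_def emeasure_cell)
  then show ?thesis using norm_integral_prod_le[OF L2_indicator_cell[OF assms(1)] assms(2), of k]
    by (simp add: cell_int_def)
qed

text \<open>The integrals over all cells of all grids of mesh 1/(j + 1) are countably many bounded
  sequences, so one subsequence makes all of them converge. A fine grid makes the energy term of
  \<open>Friedrichs_inequality\<close> small, and the finitely many remaining cell integrals are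
  Cauchy.\<close>

theorem Rellich:
  assumes u: "\<And>n. H1 (u n)" and C: "\<And>n. h1norm (u n) \<le> C"
    and out: "\<And>n x. R < norm x \<Longrightarrow> u n x = 0" and R: "0 \<le> R"
  shows "\<exists>r. strict_mono (r :: nat \<Rightarrow> nat) \<and>
    (\<forall>e>0. \<exists>N. \<forall>m\<ge>N. \<forall>n\<ge>N. l2norm (\<lambda>x. u (r m) x - u (r n) x) < e)"
proof -
  note L = H1_L2[OF u]
  have C0: "0 \<le> C" using C[of 0] h1norm_nonneg order_trans by blast
  define H where "H j = 1 / real (Suc j)" for j
  have H: "0 < H j" "H j \<le> 1" for j by (auto simp: H_def)
  obtain r where r: "strict_mono r" "\<And>p. \<exists>l. (\<lambda>n. cell_int (H (fst p)) (snd p) (u (r n))) \<longlonglongrightarrow> l"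
  proof (rule function_convergent_subsequence[of UNIV "\<lambda>n p. cell_int (H (fst p)) (snd p) (u n)" C])
    fix n and p :: "nat \<times> int \<times> int"
    have "norm (cell_int (H (fst p)) (snd p) (u n)) \<le> H (fst p) * l2norm (u n)" by (rule norm_cell_int_le[OF H(1) L])
    also have "\<dots> \<le> 1 * h1norm (u n)" by (intro mult_mono H l2norm_le_h1norm l2norm_nonneg) simp
    finally show "norm (cell_int (H (fst p)) (snd p) (u n)) \<le> C" using C[of n] by simp
  qed (use that in auto)
  have "\<exists>N. \<forall>m\<ge>N. \<forall>n\<ge>N. l2norm (\<lambda>x. u (r m) x - u (r n) x) < e" if e: "0 < e" for e
  proof -
    have "(\<lambda>j. 32 * pi * (H j)\<^sup>2 * (2 * C)\<^sup>2) \<longlonglongrightarrow> 32 * pi * 0\<^sup>2 * (2 * C)\<^sup>2"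
      unfolding H_def by (intro tendsto_intros LIMSEQ_inverse_real_of_nat[unfolded inverse_eq_divide])
    then have "(\<lambda>j. 32 * pi * (H j)\<^sup>2 * (2 * C)\<^sup>2) \<longlonglongrightarrow> 0" by simp
    from order_tendstoD(2)[OF this, of "e\<^sup>2 / 2"] e obtain j where j: "32 * pi * (H j)\<^sup>2 * (2 * C)\<^sup>2 < e\<^sup>2 / 2"
      by (auto simp: eventually_sequentially)
    obtain F where F: "finite F" "\<And>u. H1 u \<Longrightarrow> (\<And>x. R < norm x \<Longrightarrow> u x = 0) \<Longrightarrow>
        (l2norm u)\<^sup>2 \<le> 32 * pi * (H j)\<^sup>2 * (h1norm u)\<^sup>2 + (\<Sum>k\<in>F. (norm (cell_int (H j) k u))\<^sup>2) / (H j)\<^sup>2"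
      using Friedrichs_inequality[OF H(1)[of j] R] by blast
    define a where "a n k = cell_int (H j) k (u (r n))" for n k
    have "\<exists>l. (\<lambda>n. a n k) \<longlonglongrightarrow> l" for k using r(2)[of "(j, k)"] by (simp add: a_def)
    then obtain l where l: "\<And>k. (\<lambda>n. a n k) \<longlonglongrightarrow> l k" by metis
    have "(\<lambda>n. \<Sum>k\<in>F. (norm (a n k - l k))\<^sup>2) \<longlonglongrightarrow> (\<Sum>k\<in>F. (norm (l k - l k))\<^sup>2)"
      by (intro tendsto_intros l)
    then have "(\<lambda>n. \<Sum>k\<in>F. (norm (a n k - l k))\<^sup>2) \<longlonglongrightarrow> 0" by simp
    \<comment> \<open>Each of the two indices will contribute twice this amount, half of (H j)^2 e^2
      in total.\<close>
    moreover have "0 < (H j)\<^sup>2 * e\<^sup>2 / 8" using e H(1)[of j] by simp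
    ultimately have "\<forall>\<^sub>F n in sequentially. (\<Sum>k\<in>F. (norm (a n k - l k))\<^sup>2) < (H j)\<^sup>2 * e\<^sup>2 / 8"
      by (rule order_tendstoD(2))
    then obtain N where N: "\<And>n. N \<le> n \<Longrightarrow> (\<Sum>k\<in>F. (norm (a n k - l k))\<^sup>2) < (H j)\<^sup>2 * e\<^sup>2 / 8"
      unfolding eventually_sequentially by blast
    have "l2norm (\<lambda>x. u (r m) x - u (r n) x) < e" if mn: "N \<le> m" "N \<le> n" for m n
    proof -
      let ?w = "\<lambda>x. u (r m) x - u (r n) x"
      have "(norm (cell_int (H j) k ?w))\<^sup>2 \<le> 2 * (norm (a m k - l k))\<^sup>2 + 2 * (norm (a n k - l k))\<^sup>2" for k
      proof -
        have "cell_int (H j) k ?w = (a m k - l k) - (a n k - l k)"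
          by (simp add: cell_int_diff[OF H(1) L L] a_def)
        then have "norm (cell_int (H j) k ?w) \<le> norm (a m k - l k) + norm (a n k - l k)"
          by (metis norm_triangle_ineq4)
        then have "(norm (cell_int (H j) k ?w))\<^sup>2 \<le> (norm (a m k - l k) + norm (a n k - l k))\<^sup>2"
          by (intro power_mono) auto
        then show ?thesis using sum_squares_bound[of "norm (a m k - l k)" "norm (a n k - l k)"] by (simp add: power2_sum)
      qed
      then have "(\<Sum>k\<in>F. (norm (cell_int (H j) k ?w))\<^sup>2) \<le> (\<Sum>k\<in>F. 2 * (norm (a m k - l k))\<^sup>2 + 2 * (norm (a n k - l k))\<^sup>2)"
        by (rule sum_mono)
      also have "\<dots> = 2 * (\<Sum>k\<in>F. (norm (a m k - l k))\<^sup>2) + 2 * (\<Sum>k\<in>F. (norm (a n k - l k))\<^sup>2)"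
        by (simp add: sum.distrib sum_distrib_left)
      also have "\<dots> < (H j)\<^sup>2 * e\<^sup>2 / 2" using N[OF mn(1)] N[OF mn(2)] by linarith
      finally have "(\<Sum>k\<in>F. (norm (cell_int (H j) k ?w))\<^sup>2) / (H j)\<^sup>2 < e\<^sup>2 / 2"
        using H(1)[of j] by (simp add: field_simps)
      moreover have "(l2norm ?w)\<^sup>2 \<le> 32 * pi * (H j)\<^sup>2 * (h1norm ?w)\<^sup>2 + (\<Sum>k\<in>F. (norm (cell_int (H j) k ?w))\<^sup>2) / (H j)\<^sup>2"
        by (rule F(2)) (auto intro: H1_diff u simp: out)
      moreover have "32 * pi * (H j)\<^sup>2 * (h1norm ?w)\<^sup>2 \<le> 32 * pi * (H j)\<^sup>2 * (2 * C)\<^sup>2"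
      proof (intro mult_left_mono power_mono h1norm_nonneg)
        show "h1norm ?w \<le> 2 * C" using h1norm_triangle_diff[OF u u, of "r m" "r n"] C[of "r m"] C[of "r n"] by linarith
      qed simp
      ultimately have "(l2norm ?w)\<^sup>2 < e\<^sup>2" using j by linarith
      then show ?thesis using e by (simp add: power2_less_imp_less)
    qed
    then show ?thesis by blast
  qed
  then show ?thesis using r(1) by blast
qed

section \<open>The resolvent difference\<close>

text \<open>The approximating test functions vanish outside Y, and so does their limit, up to a null
  set. This removes the indicator from the definition of \<open>RDir\<close>, whose equation is
  tested only against \<open>H10 Y\<close>.\<close>

lemma H10_vanishes_outside:
  assumes v: "H10 Y v" and Y: "Y \<in> sets borel"
  shows "AE x in lborel. x \<notin> Y \<longrightarrow> v x = 0"
proof -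
  have Y': "- Y \<in> sets borel" using Y by auto
  have L: "L2 (\<lambda>x. indicator (- Y) x * v x)" by (intro L2_indicator_mult H1_L2 H10_H1[OF v] Y')
  have "l2norm (\<lambda>x. indicator (- Y) x * v x) \<le> 0"
  proof (rule field_le_epsilon)
    fix e :: real assume "0 < e"
    then obtain \<phi> where \<phi>: "test_fn Y \<phi>" "h1norm (\<lambda>x. v x - \<phi> x) < e" using v unfolding H10_iff by blast
    have Ld: "L2 (\<lambda>x. v x - \<phi> x)" by (intro L2_diff H1_L2 H10_H1[OF v] H1_test_fn[OF \<phi>(1)])
    have "l2norm (\<lambda>x. indicator (- Y) x * v x) \<le> 1 * l2norm (\<lambda>x. v x - \<phi> x)"
      by (rule l2norm_mono[OF Ld L]) (auto simp: indicator_def test_fn_outside[OF \<phi>(1)])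
    then show "l2norm (\<lambda>x. indicator (- Y) x * v x) \<le> 0 + e"
      using l2norm_le_h1norm[of "\<lambda>x. v x - \<phi> x"] \<phi>(2) by linarith
  qed
  then have "AE x in lborel. indicator (- Y) x * v x = 0"
    using l2norm_nonneg by (intro l2norm_eq_0D L antisym)
  then show ?thesis by eventually_elim (auto simp: indicator_def)
qed

text \<open>Couples the Dirichlet and the free weak solution for the same data f. As with
  \<open>free_sol\<close>, this relation passes to differences, while the chosen resolvents are
  linear only almost everywhere.\<close>

definition obstacle_sol :: "pt set \<Rightarrow> fn \<Rightarrow> fn \<Rightarrow> fn \<Rightarrow> bool" where
  "obstacle_sol Y f u w \<longleftrightarrow> H10 Y u \<and> (\<forall>v. H10 Y v \<longrightarrow> form1 u v = l2inner f v) \<and> free_sol f w"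

lemma obstacle_sol_resolvents:
  assumes f: "L2 f" and Y: "Y \<in> sets borel"
  shows "obstacle_sol Y f (RDir Y f) (Rfree f)"
proof -
  have eq: "integral\<^sup>L lborel (\<lambda>x. indicator Y x * f x * cnj (v x)) = l2inner f v" if v: "H10 Y v" for v
    unfolding l2inner_def
  proof (rule integral_cong_AE)
    have Lv: "L2 (\<lambda>x. cnj (v x))" by (intro L2_cnj H1_L2 H10_H1[OF v])
    show "(\<lambda>x. f x * cnj (v x)) \<in> borel_measurable lborel"
      by (intro borel_measurable_integrable L2_prod_integrable f Lv)
    show "(\<lambda>x. indicator Y x * f x * cnj (v x)) \<in> borel_measurable lborel"
      by (intro borel_measurable_integrable L2_prod_integrable L2_indicator_mult f Lv Y)
    show "AE x in lborel. indicator Y x * f x * cnj (v x) = f x * cnj (v x)"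
      using H10_vanishes_outside[OF v Y] by eventually_elim (auto simp: indicator_def)
  qed
  have "\<exists>u. H10 Y u \<and> (\<forall>v. H10 Y v \<longrightarrow> form1 u v = integral\<^sup>L lborel (\<lambda>x. indicator Y x * f x * cnj (v x)))"
    using H10_Riesz[OF f] eq by metis
  from someI_ex[OF this] show ?thesis
    using eq free_sol_Rfree[OF f] unfolding obstacle_sol_def RDir_def[symmetric] by auto
qed

lemma obstacle_sol_diff:
  assumes "L2 f" "L2 f'" "obstacle_sol Y f u w" "obstacle_sol Y f' u' w'"
  shows "obstacle_sol Y (\<lambda>x. f x - f' x) (\<lambda>x. u x - u' x) (\<lambda>x. w x - w' x)"
  using assms
  by (auto simp: obstacle_sol_def H10.diff H10.B_diff L2.B_diff H1_L2 H10_H1 intro!: free_sol_diff)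

lemma obstacle_sol_H1: "obstacle_sol Y f u w \<Longrightarrow> H1 u" "obstacle_sol Y f u w \<Longrightarrow> H1 w"
  by (auto simp: obstacle_sol_def H10_H1 free_sol_H1)

lemma obstacle_sol_orthogonal:
  assumes "obstacle_sol Y f u w" "H10 Y v"
  shows "form1 (\<lambda>x. u x - w x) v = 0"
  using assms obstacle_sol_H1[OF assms(1)] H10_H1[OF assms(2)]
  by (simp add: H1.B_diff) (simp add: obstacle_sol_def free_sol_def)

text \<open>The equation for w' turns the L^2 pairing into a form pairing with w'. Writing w' as u'
  minus the second difference loses u', to which the first difference is orthogonal. Both the
  symmetry and the duality bound come from this identity.\<close>

lemma l2inner_resolvent_difference:
  assumes "L2 g" and f: "obstacle_sol Y f u w" and g: "obstacle_sol Y g u' w'"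
  shows "l2inner (\<lambda>x. u x - w x) g = - form1 (\<lambda>x. u x - w x) (\<lambda>x. u' x - w' x)"
proof -
  let ?z = "\<lambda>x. u x - w x"
  have z: "H1 ?z" by (intro H1_diff obstacle_sol_H1[OF f])
  note H = obstacle_sol_H1[OF g]
  have "l2inner ?z g = cnj (l2inner g ?z)" by (rule L2.B_sym[OF H1_L2[OF z] assms(1)])
  also have "l2inner g ?z = form1 w' ?z" using g z by (simp add: obstacle_sol_def free_sol_def)
  also have "cnj (form1 w' ?z) = form1 ?z w'" by (rule H1.B_sym[OF z H(2), symmetric])
  also have "\<dots> = form1 ?z u' - form1 ?z (\<lambda>x. u' x - w' x)" by (simp add: H1.B_diff_right[OF H z])
  also have "form1 ?z u' = 0" using g by (intro obstacle_sol_orthogonal[OF f]) (simp add: obstacle_sol_def)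
  finally show ?thesis by simp
qed

text \<open>Both pairings equal minus the form of the two differences, and the form is
  Hermitian.\<close>

lemma resolvent_difference_symmetric:
  assumes "L2 f" "L2 g" and f: "obstacle_sol Y f u w" and g: "obstacle_sol Y g u' w'"
  shows "l2inner (\<lambda>x. u x - w x) g = l2inner f (\<lambda>x. u' x - w' x)"
proof -
  have z: "H1 (\<lambda>x. u x - w x)" and z': "H1 (\<lambda>x. u' x - w' x)"
    by (intro H1_diff obstacle_sol_H1[OF f] obstacle_sol_H1[OF g])+
  have "l2inner f (\<lambda>x. u' x - w' x) = cnj (l2inner (\<lambda>x. u' x - w' x) f)" by (rule L2.B_sym[OF assms(1) H1_L2[OF z']])
  also have "\<dots> = - cnj (form1 (\<lambda>x. u' x - w' x) (\<lambda>x. u x - w x))"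
    by (simp add: l2inner_resolvent_difference[OF assms(1) g f])
  also have "\<dots> = - form1 (\<lambda>x. u x - w x) (\<lambda>x. u' x - w' x)" by (subst H1.B_sym[OF z z']) simp
  finally show ?thesis by (simp add: l2inner_resolvent_difference[OF assms(2) f g])
qed

text \<open>Only the part of the free solution near \<open>K\<close> matters, because \<open>(1 - cutoff R) w\<close> lies in
  \<open>H\<^sup>1\<^sub>0(- K)\<close>.\<close>

lemma h1norm_resolvent_difference_le:
  assumes R: "0 \<le> R" and K: "K \<subseteq> ball 0 R" and f: "obstacle_sol (- K) f u w"
  shows "h1norm (\<lambda>x. u x - w x) \<le> h1norm (\<lambda>x. complex_of_real (cutoff R x) * w x)"
proof -
  let ?\<chi> = "\<lambda>x. complex_of_real (cutoff R x)" and ?z = "\<lambda>x. u x - w x"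
  note H = obstacle_sol_H1[OF f]
  have z: "H1 ?z" by (intro H1_diff H)
  obtain C where C: "0 \<le> C" "C1_bounded C ?\<chi>" using cutoff_C1_bounded[OF R] by blast
  have C': "C1_bounded (1 + C) (\<lambda>x. 1 - ?\<chi> x)"
  proof -
    have "pd e (\<lambda>x. 1 - ?\<chi> x) x = - pd e ?\<chi> x" for e x
    proof -
      have "((\<lambda>x. 1 - ?\<chi> x) has_derivative (\<lambda>v. 0 - pd v ?\<chi> x)) (at x)"
        by (intro has_derivative_diff has_derivative_const has_derivative_pd smooth_differentiable smooth_cutoff)
      then show ?thesis by (subst pd_eqI) auto
    qed
    moreover have "norm (1 - ?\<chi> x) \<le> 1 + C" for x
      using C(2) norm_triangle_ineq4[of 1 "?\<chi> x"] unfolding C1_bounded_def by (metis add_left_mono norm_one order_trans)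
    ultimately show ?thesis using C by (auto simp: C1_bounded_def smooth_diff smooth_const smooth_cutoff add_increasing)
  qed
  have "H10 (- K) (\<lambda>x. (1 - ?\<chi> x) * w x)"
  proof (rule H10_mult[OF C' H1_imp_H10_UNIV[OF H(2)]])
    fix \<phi> assume \<phi>: "test_fn UNIV \<phi>"
    obtain S where S: "compact S" "\<And>x. x \<notin> S \<Longrightarrow> \<phi> x = 0" using test_fnE[OF \<phi>] by metis
    \<comment> \<open>1 - \<open>\<chi>\<close> vanishes on the ball containing K, so the product
      lives on the part of the support of \<open>\<phi>\<close> outside that open ball.\<close>
    show "test_fn (- K) (\<lambda>x. (1 - ?\<chi> x) * \<phi> x)"
    proof (rule test_fnI[where S="S \<inter> - ball 0 R"])
      show "(1 - ?\<chi> x) * \<phi> x = 0" if "x \<notin> S \<inter> - ball 0 R" for x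
        using that S(2) by (auto simp: cutoff_eq_1)
    qed (use S(1) K in \<open>auto simp: compact_imp_closed compact_imp_bounded bounded_Int intro!: closed_Int smooth_mult smooth_diff smooth_const smooth_cutoff test_fn_smooth[OF \<phi>]\<close>)
  qed
  from obstacle_sol_orthogonal[OF f this] have 0: "form1 ?z (\<lambda>x. (1 - ?\<chi> x) * w x) = 0" .
  have \<chi>w: "H1 (\<lambda>x. ?\<chi> x * w x)" by (rule H1_mult[OF C(2) H(2)])
  have "(\<lambda>x. (1 - ?\<chi> x) * w x) = (\<lambda>x. w x - ?\<chi> x * w x)" by (simp add: left_diff_distrib)
  with 0 have "form1 ?z w = form1 ?z (\<lambda>x. ?\<chi> x * w x)" by (simp add: H1.B_diff_right[OF H(2) \<chi>w z])
  moreover have "form1 ?z u = 0" using f by (intro obstacle_sol_orthogonal[OF f]) (simp add: obstacle_sol_def)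
  \<comment> \<open>z is orthogonal to u and to (1 - \<chi>) w, so of u - w only - \<chi> w remains
    in the second argument.\<close>
  ultimately have "form1 ?z ?z = - form1 ?z (\<lambda>x. ?\<chi> x * w x)" by (simp add: H1.B_diff_right[OF H z])
  moreover have "cmod (form1 ?z ?z) = h1norm ?z * h1norm ?z"
    unfolding form1_self[OF z] norm_of_real by (simp add: power2_eq_square)
  ultimately have *: "h1norm ?z * h1norm ?z \<le> h1norm ?z * h1norm (\<lambda>x. ?\<chi> x * w x)"
    using form1_Cauchy_Schwarz[OF z \<chi>w] by simp
  show ?thesis
  proof (cases "h1norm ?z = 0")
    case True
    then show ?thesis by (simp only: h1norm_nonneg)
  next
    case False
    then have "0 < h1norm ?z" using h1norm_nonneg[of ?z] by linarith
    with * show ?thesis by (rule mult_left_le_imp_le)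
  qed
qed

section \<open>Polynomial weights and the weighted bounds\<close>

lemma jb_pos: "0 < jb s x"
  unfolding jb_def powr_gt_zero
  using add_pos_nonneg[OF zero_less_one zero_le_power2[of "norm x"]] by (metis less_irrefl)

lemma jb_measurable: "jb s \<in> borel_measurable borel"
proof -
  have nz: "1 + (norm x)\<^sup>2 \<noteq> 0" for x :: pt
    using add_pos_nonneg[OF zero_less_one zero_le_power2[of "norm x"]] by (metis less_irrefl)
  show ?thesis
    unfolding jb_def[abs_def]
    by (intro borel_measurable_continuous_onI continuous_on_powr continuous_intros ballI nz)
qed

lemma jb_le: "0 < s \<Longrightarrow> norm x \<le> R \<Longrightarrow> jb s x \<le> (1 + R\<^sup>2) powr (s / 2)"
  unfolding jb_def by (intro powr_mono2 add_mono power_mono) auto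

text \<open>For m \<ge> s/2 the decay of the weight absorbs the growth of \<open>jb s\<close>; the
  quotient (1 + |x|^2) / (1 + \<rho>^2 |x|^2) is at most 1/\<rho>^2 because \<rho> \<le> 1.\<close>

lemma weight_jb_le:
  assumes "s / 2 \<le> real m" "0 < s" "0 < \<rho>" "\<rho> \<le> 1"
  shows "norm (weight m \<rho> x) * jb s x \<le> inverse (\<rho>\<^sup>2) ^ m"
proof -
  let ?n = "(norm x)\<^sup>2"
  have "jb s x \<le> (1 + ?n) powr real m" unfolding jb_def using assms by (intro powr_mono) auto
  also have "\<dots> = (1 + ?n) ^ m" by (rule powr_realpow) (simp add: add_pos_nonneg)
  finally have "norm (weight m \<rho> x) * jb s x \<le> inverse (1 + \<rho>\<^sup>2 * ?n) ^ m * (1 + ?n) ^ m"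
    unfolding norm_weight by (intro mult_left_mono) (auto simp: add_nonneg_nonneg)
  also have "\<dots> = ((1 + ?n) / (1 + \<rho>\<^sup>2 * ?n)) ^ m" by (simp add: power_divide divide_inverse power_mult_distrib power_inverse mult.commute)
  also have "\<dots> \<le> inverse (\<rho>\<^sup>2) ^ m"
  proof (rule power_mono)
    have "\<rho>\<^sup>2 \<le> 1" using assms by (simp add: power_le_one)
    then have "\<rho>\<^sup>2 * (1 + ?n) \<le> 1 + \<rho>\<^sup>2 * ?n" by (simp add: distrib_left)
    moreover have "0 < 1 + \<rho>\<^sup>2 * ?n" by (simp add: add_pos_nonneg)
    ultimately show "(1 + ?n) / (1 + \<rho>\<^sup>2 * ?n) \<le> inverse (\<rho>\<^sup>2)"
      using assms(3) by (simp add: field_simps)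
  qed (auto simp: add_nonneg_nonneg)
  finally show ?thesis .
qed

lemma loc_norm_bounds:
  assumes s: "0 < s" and R: "0 \<le> R"
  defines "f \<equiv> (\<lambda>g x. complex_of_real (jb s x) * g x)"
  shows "\<exists>c\<ge>0. \<forall>g w. L2 g \<longrightarrow> L2 (f g) \<longrightarrow> free_sol (f g) w \<longrightarrow>
    loc_norm R (f g) \<le> c * l2norm g \<and> loc_norm R w \<le> c * l2norm g"
proof -
  obtain m :: nat where m: "s / 2 \<le> real m" using real_arch_simple by blast
  \<comment> \<open>Keeps m \<rho> below 1/4, the smallness asked for by
    \<open>weighted_bound\<close>.\<close>
  define \<rho> where "\<rho> = 1 / (4 * (real m + 1))"
  have \<rho>: "0 < \<rho>" "\<rho> \<le> 1" "real m * \<rho> \<le> 1 / 4" by (auto simp: \<rho>_def field_simps)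
  \<comment> \<open>On the ball of radius R, \<open>c1\<close> bounds \<open>jb s\<close> and
    \<open>c2\<close> bounds the reciprocal of the weight; \<open>c3\<close> bounds the weight times
    \<open>jb s\<close> everywhere.\<close>
  define c1 where "c1 = (1 + R\<^sup>2) powr (s / 2)"
  define c2 where "c2 = (1 + \<rho>\<^sup>2 * R\<^sup>2) ^ m"
  define c3 where "c3 = inverse (\<rho>\<^sup>2) ^ m"
  have c: "0 \<le> c1" "0 \<le> c2" "0 \<le> c3" by (auto simp: c1_def c2_def c3_def add_nonneg_nonneg)
  have "loc_norm R (f g) \<le> c1 * l2norm g \<and> loc_norm R w \<le> (c2 * (2 * c3)) * l2norm g"
    if g: "L2 g" and fg: "L2 (f g)" and w: "free_sol (f g) w" for g w
  proof
    show "loc_norm R (f g) \<le> c1 * l2norm g"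
    proof (rule loc_norm_le[OF fg g c(1)])
      fix x :: pt assume "norm x \<le> R"
      from jb_le[OF s this] show "norm (f g x) \<le> c1 * norm (g x)"
        using jb_pos[of s x] by (simp add: f_def norm_mult c1_def mult_right_mono)
    qed
    have Lw: "L2 w" by (rule H1_L2[OF free_sol_H1[OF w]])
    have Lmult: "L2 (\<lambda>x. weight m \<rho> x * v x)" if "L2 v" for v
      by (rule L2_mult_bounded[OF that smooth_measurable[OF smooth_weight] norm_weight_le_1])
    have "loc_norm R w \<le> c2 * l2norm (\<lambda>x. weight m \<rho> x * w x)"
    proof (rule loc_norm_le[OF Lw Lmult[OF Lw] c(2)])
      fix x :: pt assume x: "norm x \<le> R"
      have p: "0 < 1 + \<rho>\<^sup>2 * (norm x)\<^sup>2" by (simp add: add_pos_nonneg)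
      have "(1 + \<rho>\<^sup>2 * (norm x)\<^sup>2) ^ m \<le> c2"
        unfolding c2_def using x by (intro power_mono add_mono mult_left_mono) auto
      then have "(1 + \<rho>\<^sup>2 * (norm x)\<^sup>2) ^ m * norm (weight m \<rho> x * w x) \<le> c2 * norm (weight m \<rho> x * w x)"
        by (rule mult_right_mono) simp
      moreover have "(1 + \<rho>\<^sup>2 * (norm x)\<^sup>2) ^ m * norm (weight m \<rho> x * w x) = norm (w x)"
        unfolding norm_mult norm_weight using p by (simp add: power_inverse)
      ultimately show "norm (w x) \<le> c2 * norm (weight m \<rho> x * w x)" by linarith
    qed
    also have "\<dots> \<le> c2 * (2 * (c3 * l2norm g))"
    proof (rule mult_left_mono[OF _ c(2)])
      have "l2norm (\<lambda>x. weight m \<rho> x * f g x) \<le> c3 * l2norm g"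
      proof (rule l2norm_mono[OF g Lmult[OF fg] _ c(3)])
        fix x
        have "norm (weight m \<rho> x * f g x) = norm (weight m \<rho> x) * jb s x * norm (g x)"
          using jb_pos[of s x] by (simp add: f_def norm_mult)
        also have "\<dots> \<le> c3 * norm (g x)"
          unfolding c3_def by (intro mult_right_mono weight_jb_le m s \<rho>) simp
        finally show "norm (weight m \<rho> x * f g x) \<le> c3 * norm (g x)" .
      qed
      then show "l2norm (\<lambda>x. weight m \<rho> x * w x) \<le> 2 * (c3 * l2norm g)"
        using weighted_bound[OF less_imp_le[OF \<rho>(1)] \<rho>(3) fg w] by linarith
    qed
    finally show "loc_norm R w \<le> (c2 * (2 * c3)) * l2norm g" by (simp add: mult_ac)
  qed
  moreover have "c1 * a \<le> max c1 (c2 * (2 * c3)) * a" "(c2 * (2 * c3)) * a \<le> max c1 (c2 * (2 * c3)) * a" if "0 \<le> a" for a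
    using that by (auto intro: mult_right_mono)
  ultimately show ?thesis
    using c l2norm_nonneg by (intro exI[of _ "max c1 (c2 * (2 * c3))"]) (meson max.coboundedI1 order_trans)
qed

text \<open>Two forms of one energy bound: the one containing the local norm of w serves
  compactness, the linear one boundedness.\<close>

lemma cutoff_free_sol_bounds:
  assumes s: "0 < s" and R: "0 \<le> R"
  defines "f \<equiv> (\<lambda>g x. complex_of_real (jb s x) * g x)"
  shows "\<exists>C\<ge>0. \<forall>g w. L2 g \<longrightarrow> L2 (f g) \<longrightarrow> free_sol (f g) w \<longrightarrow>
    (h1norm (\<lambda>x. complex_of_real (cutoff R x) * w x))\<^sup>2 \<le> C * l2norm g * loc_norm (R + 1) w \<and>
    h1norm (\<lambda>x. complex_of_real (cutoff R x) * w x) \<le> C * l2norm g"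
proof -
  have R1: "0 \<le> R + 1" using R by simp
  obtain c where c: "0 \<le> c" "\<And>g w. L2 g \<Longrightarrow> L2 (f g) \<Longrightarrow> free_sol (f g) w \<Longrightarrow>
      loc_norm (R + 1) (f g) \<le> c * l2norm g \<and> loc_norm (R + 1) w \<le> c * l2norm g"
    using loc_norm_bounds[OF s R1] unfolding f_def by blast
  obtain C where C: "0 \<le> C" "\<And>f w. L2 f \<Longrightarrow> free_sol f w \<Longrightarrow>
      (h1norm (\<lambda>x. complex_of_real (cutoff R x) * w x))\<^sup>2 \<le> C * ((loc_norm (R + 1) f + loc_norm (R + 1) w) * loc_norm (R + 1) w)"
    using cutoff_energy[OF R] by blast
  \<comment> \<open>The summands dominate the constants 2 c C and 2 c C c of the two bounds; the 1
    gives M \<le> M^2, so that a square root can be taken.\<close>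
  define M where "M = 2 * c * C + 2 * c * C * c + 1"
  have M: "0 \<le> M" "2 * c * C \<le> M" using c(1) C(1) by (auto simp: M_def)
  have "(h1norm (\<lambda>x. complex_of_real (cutoff R x) * w x))\<^sup>2 \<le> M * l2norm g * loc_norm (R + 1) w \<and>
      h1norm (\<lambda>x. complex_of_real (cutoff R x) * w x) \<le> M * l2norm g"
    if g: "L2 g" and fg: "L2 (f g)" and w: "free_sol (f g) w" for g w
  proof
    let ?l = "loc_norm (R + 1) w" and ?g = "l2norm g" and ?h = "h1norm (\<lambda>x. complex_of_real (cutoff R x) * w x)"
    have n: "0 \<le> ?l" "0 \<le> ?g" by (auto simp: loc_norm_def l2norm_nonneg)
    have l: "loc_norm (R + 1) (f g) \<le> c * ?g" "?l \<le> c * ?g" using c(2)[OF g fg w] by auto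
    have "?h\<^sup>2 \<le> C * ((loc_norm (R + 1) (f g) + ?l) * ?l)" by (rule C(2)[OF fg w])
    also have "\<dots> \<le> C * ((2 * c * ?g) * ?l)"
      using l n C(1) by (intro mult_left_mono mult_right_mono) auto
    finally have 1: "?h\<^sup>2 \<le> (2 * c * C) * ?g * ?l" by (simp add: mult_ac)
    also have "\<dots> \<le> M * ?g * ?l" using M n by (intro mult_right_mono) auto
    finally show "?h\<^sup>2 \<le> M * ?g * ?l" .
    have "?h\<^sup>2 \<le> (2 * c * C) * ?g * (c * ?g)"
      using 1 mult_left_mono[OF l(2), of "(2 * c * C) * ?g"] n c(1) C(1) by (auto intro: order_trans mult_nonneg_nonneg)
    also have "\<dots> = (2 * c * C * c) * ?g\<^sup>2" by (simp add: power2_eq_square mult_ac)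
    also have "\<dots> \<le> M\<^sup>2 * ?g\<^sup>2"
    proof (rule mult_right_mono)
      have m1: "1 \<le> M" "2 * c * C * c \<le> M" using c(1) C(1) by (auto simp: M_def)
      then show "2 * c * C * c \<le> M\<^sup>2"
        using mult_right_mono[OF m1(1) M(1)] unfolding power2_eq_square by linarith
    qed simp
    also have "\<dots> = (M * ?g)\<^sup>2" by (simp add: power_mult_distrib)
    finally show "?h \<le> M * ?g" by (rule power2_le_imp_le) (simp add: M n)
  qed
  then show ?thesis using M(1) by blast
qed

text \<open>Duality: test the resolvent difference against truncations of itself.\<close>

lemma weighted_resolvent_difference:
  assumes s: "0 < s" and K: "compact K" "K \<subseteq> ball 0 R" and R: "0 \<le> R"
  defines "f \<equiv> (\<lambda>g x. complex_of_real (jb s x) * g x)"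
  shows "\<exists>C\<ge>0. \<forall>g u w. L2 g \<longrightarrow> L2 (f g) \<longrightarrow> obstacle_sol (- K) (f g) u w \<longrightarrow>
    L2 (f (\<lambda>x. u x - w x)) \<and> l2norm (f (\<lambda>x. u x - w x)) \<le> C * h1norm (\<lambda>x. complex_of_real (cutoff R x) * w x)"
proof -
  obtain C where C: "0 \<le> C" "\<And>g w. L2 g \<Longrightarrow> L2 (f g) \<Longrightarrow> free_sol (f g) w \<Longrightarrow>
      h1norm (\<lambda>x. complex_of_real (cutoff R x) * w x) \<le> C * l2norm g"
    using cutoff_free_sol_bounds[OF s R] unfolding f_def by blast
  have Y: "- K \<in> sets borel" using K(1) by (simp add: borel_closed compact_imp_closed borel_comp)
  have "L2 (f (\<lambda>x. u x - w x)) \<and> l2norm (f (\<lambda>x. u x - w x)) \<le> C * h1norm (\<lambda>x. complex_of_real (cutoff R x) * w x)"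
    if g: "L2 g" and fg: "L2 (f g)" and o: "obstacle_sol (- K) (f g) u w" for g u w
  proof -
    let ?z = "\<lambda>x. u x - w x"
    let ?c = "C * h1norm (\<lambda>x. complex_of_real (cutoff R x) * w x)"
    have z: "H1 ?z" by (intro H1_diff obstacle_sol_H1[OF o])
    note [measurable] = L2_measurable[OF H1_L2[OF obstacle_sol_H1(1)[OF o]]]
      L2_measurable[OF H1_L2[OF obstacle_sol_H1(2)[OF o]]] jb_measurable
    have [measurable]: "(indicator (cball 0 (real N)) :: fn) \<in> borel_measurable borel" for N
      by (rule borel_measurable_indicator) simp
    \<comment> \<open>Truncation to a ball makes \<open>h N\<close> and \<open>f (h N)\<close>
      square integrable before anything is known about the weighted difference itself.\<close>
    define h where "h N x = indicator (cball 0 (real N)) x * f ?z x" for N x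
    have [measurable]: "h N \<in> borel_measurable borel" "f ?z \<in> borel_measurable borel" for N
      unfolding h_def f_def by measurable
    have Lh: "L2 (h N)" for N
    proof (rule L2_bound[OF H1_L2[OF z], where C="(1 + (real N)\<^sup>2) powr (s / 2)"])
      show "norm (h N x) \<le> (1 + (real N)\<^sup>2) powr (s / 2) * norm (?z x)" for x
        using jb_le[OF s, of x "real N"] jb_pos[of s x] by (cases "norm x \<le> real N") (auto simp: h_def f_def norm_mult intro!: mult_right_mono)
    qed simp
    have bound: "l2norm (h N) \<le> ?c" for N
    proof -
      have j: "jb s x \<le> (1 + (real N)\<^sup>2) powr (s / 2)" if "norm x \<le> real N" for x :: pt by (rule jb_le[OF s that])
      have Lfh: "L2 (f (h N))"
      proof (rule L2_bound[OF Lh, where C="(1 + (real N)\<^sup>2) powr (s / 2)"])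
        show "f (h N) \<in> borel_measurable borel" unfolding f_def by measurable
        show "norm (f (h N) x) \<le> (1 + (real N)\<^sup>2) powr (s / 2) * norm (h N x)" for x
          using j[of x] jb_pos[of s x] by (cases "norm x \<le> real N") (auto simp: f_def h_def norm_mult intro!: mult_right_mono)
      qed
      let ?u = "RDir (- K) (f (h N))" and ?w = "Rfree (f (h N))"
      have o': "obstacle_sol (- K) (f (h N)) ?u ?w" by (rule obstacle_sol_resolvents[OF Lfh Y])
      have z': "H1 (\<lambda>x. ?u x - ?w x)" by (intro H1_diff obstacle_sol_H1[OF o'])
      \<comment> \<open>\<open>f (h N)\<close> is the truncated difference times the squared weight,
        so pairing it with z returns the squared norm of \<open>h N\<close>.\<close>
      have "l2inner ?z (f (h N)) = l2inner (h N) (h N)"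
        unfolding l2inner_def by (rule Bochner_Integration.integral_cong) (auto simp: f_def h_def indicator_def mult_ac)
      then have "complex_of_real ((l2norm (h N))\<^sup>2) = - form1 ?z (\<lambda>x. ?u x - ?w x)"
        using l2inner_resolvent_difference[OF Lfh o o'] l2inner_self by simp
      then have "(l2norm (h N))\<^sup>2 = cmod (form1 ?z (\<lambda>x. ?u x - ?w x))"
        by (metis abs_of_nonneg norm_minus_cancel norm_of_real zero_le_power2)
      also have "\<dots> \<le> h1norm ?z * h1norm (\<lambda>x. ?u x - ?w x)" by (rule form1_Cauchy_Schwarz[OF z z'])
      \<comment> \<open>The first factor is the cut-off energy of w; the second is linear in the
        norm of \<open>h N\<close> and will cancel against one power on the left.\<close>
      also have "\<dots> \<le> h1norm (\<lambda>x. complex_of_real (cutoff R x) * w x) * (C * l2norm (h N))"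
      proof (intro mult_mono h1norm_nonneg)
        show "h1norm ?z \<le> h1norm (\<lambda>x. complex_of_real (cutoff R x) * w x)"
          by (rule h1norm_resolvent_difference_le[OF R K(2) o])
        have "h1norm (\<lambda>x. ?u x - ?w x) \<le> h1norm (\<lambda>x. complex_of_real (cutoff R x) * ?w x)"
          by (rule h1norm_resolvent_difference_le[OF R K(2) o'])
        also have "\<dots> \<le> C * l2norm (h N)" by (rule C(2)[OF Lh Lfh free_sol_Rfree[OF Lfh]])
        finally show "h1norm (\<lambda>x. ?u x - ?w x) \<le> C * l2norm (h N)" .
      qed
      finally have "l2norm (h N) * l2norm (h N) \<le> ?c * l2norm (h N)" by (simp add: power2_eq_square mult_ac)
      then show ?thesis
        using l2norm_nonneg[of "h N"] C(1) h1norm_nonneg mult_right_le_imp_le[of "l2norm (h N)" "l2norm (h N)" ?c]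
        by (cases "l2norm (h N) = 0") (auto simp: mult_nonneg_nonneg)
    qed
    have c0: "0 \<le> ?c" using C(1) by (simp add: h1norm_nonneg)
    \<comment> \<open>The bound is uniform in N, so Fatou's lemma removes the truncation.\<close>
    have "(\<integral>\<^sup>+x. ennreal ((norm (f ?z x))\<^sup>2) \<partial>lborel) = (\<integral>\<^sup>+x. liminf (\<lambda>N. ennreal ((norm (h N x))\<^sup>2)) \<partial>lborel)"
    proof (rule nn_integral_cong)
      fix x
      have "(\<lambda>N. ennreal ((norm (h N x))\<^sup>2)) \<longlonglongrightarrow> ennreal ((norm (f ?z x))\<^sup>2)"
      proof (rule tendsto_eventually)
        obtain N where "norm x \<le> real N" using real_arch_simple by blast
        then show "\<forall>\<^sub>F N in sequentially. ennreal ((norm (h N x))\<^sup>2) = ennreal ((norm (f ?z x))\<^sup>2)"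
          unfolding eventually_sequentially by (intro exI[of _ N]) (auto simp: h_def indicator_def)
      qed
      from lim_imp_Liminf[OF sequentially_bot this]
      show "ennreal ((norm (f ?z x))\<^sup>2) = liminf (\<lambda>N. ennreal ((norm (h N x))\<^sup>2))" by (rule sym)
    qed
    also have "\<dots> \<le> liminf (\<lambda>N. \<integral>\<^sup>+x. ennreal ((norm (h N x))\<^sup>2) \<partial>lborel)" by (rule nn_integral_liminf) simp
    also have "\<dots> \<le> limsup (\<lambda>N. \<integral>\<^sup>+x. ennreal ((norm (h N x))\<^sup>2) \<partial>lborel)" by (rule Liminf_le_Limsup) simp
    also have "\<dots> \<le> ennreal (?c\<^sup>2)"
      unfolding nn_integral_sq[OF Lh] by (intro Limsup_bounded always_eventually allI ennreal_leI power_mono bound l2norm_nonneg)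
    finally show ?thesis using L2_nn_integralI[of "f ?z", OF _ _ c0] by simp
  qed
  then show ?thesis using C(1) by blast
qed

text \<open>\<open>D\<close> contains the L^2 functions of bounded support and so is dense; a
  bounded symmetric operator on it extends to a self-adjoint one. As L^2 is complete, Cauchy
  subsequences of images express compactness.\<close>

theorem theorem2p3:
  fixes K :: "(real^2) set" and s :: real
  assumes "compact K" and "\<not> polar K" and "s > 0"
  defines "D \<equiv> {g. L2 g \<and> L2 (\<lambda>x. complex_of_real (jb s x) * g x)}"
      and "T \<equiv> (\<lambda>g x. complex_of_real (jb s x) * Vop K (\<lambda>y. complex_of_real (jb s y) * g y) x)"
  shows "(\<exists>C. \<forall>g\<in>D. L2 (T g) \<and> l2norm (T g) \<le> C * l2norm g)
       \<and> (\<forall>gs :: nat \<Rightarrow> (real^2 \<Rightarrow> complex). (\<forall>n. gs n \<in> D \<and> l2norm (gs n) \<le> 1) \<longrightarrow>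
            (\<exists>r :: nat \<Rightarrow> nat. strict_mono r \<and>
               (\<forall>\<epsilon>>0. \<exists>N. \<forall>m\<ge>N. \<forall>n\<ge>N. l2norm (\<lambda>x. T (gs (r m)) x - T (gs (r n)) x) < \<epsilon>)))
       \<and> (\<forall>g\<in>D. \<forall>h\<in>D. l2inner (T g) h = l2inner g (T h))"
proof -
  define f where "f = (\<lambda>g x. complex_of_real (jb s x) * g x :: complex)"
  define U where "U g = RDir (- K) (f g)" for g
  define W where "W g = Rfree (f g)" for g
  have T: "T g = f (\<lambda>x. U g x - W g x)" for g
    by (simp add: T_def f_def Vop_def U_def W_def)
  have DI: "L2 g" "L2 (f g)" if "g \<in> D" for g using that by (auto simp: D_def f_def)
  have Y: "- K \<in> sets borel" using assms(1) by (simp add: borel_closed compact_imp_closed borel_comp)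
  have sol: "obstacle_sol (- K) (f g) (U g) (W g)" if "g \<in> D" for g
    unfolding U_def W_def by (rule obstacle_sol_resolvents[OF DI(2)[OF that] Y])
  have fsol: "free_sol (f g) (W g)" if "g \<in> D" for g using sol[OF that] by (simp add: obstacle_sol_def)
  obtain R where "0 < R" and K: "K \<subseteq> ball 0 R"
    using compact_imp_bounded[OF assms(1)] bounded_subset_ballD by blast
  then have R: "0 \<le> R" "0 \<le> R + 1" by auto
  obtain C where C: "0 \<le> C" "\<And>g u w. L2 g \<Longrightarrow> L2 (f g) \<Longrightarrow> obstacle_sol (- K) (f g) u w \<Longrightarrow>
      L2 (f (\<lambda>x. u x - w x)) \<and> l2norm (f (\<lambda>x. u x - w x)) \<le> C * h1norm (\<lambda>x. complex_of_real (cutoff R x) * w x)"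
    using weighted_resolvent_difference[OF assms(3,1) K R(1)] unfolding f_def by blast
  obtain A where A: "0 \<le> A" "\<And>g w. L2 g \<Longrightarrow> L2 (f g) \<Longrightarrow> free_sol (f g) w \<Longrightarrow>
      (h1norm (\<lambda>x. complex_of_real (cutoff R x) * w x))\<^sup>2 \<le> A * l2norm g * loc_norm (R + 1) w \<and>
      h1norm (\<lambda>x. complex_of_real (cutoff R x) * w x) \<le> A * l2norm g"
    using cutoff_free_sol_bounds[OF assms(3) R(1)] unfolding f_def by blast
  \<comment> \<open>This cutoff has radius R + 1, so it equals 1 on the ball where
    \<open>loc_norm (R + 1)\<close> looks; convergence of the cut-off solutions then controls that
    norm.\<close>
  obtain A' where A': "0 \<le> A'" "\<And>g w. L2 g \<Longrightarrow> L2 (f g) \<Longrightarrow> free_sol (f g) w \<Longrightarrow>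
      h1norm (\<lambda>x. complex_of_real (cutoff (R + 1) x) * w x) \<le> A' * l2norm g"
    using cutoff_free_sol_bounds[OF assms(3) R(2)] unfolding f_def by blast
  have "L2 (T g) \<and> l2norm (T g) \<le> (C * A) * l2norm g" if g: "g \<in> D" for g
  proof -
    have "C * h1norm (\<lambda>x. complex_of_real (cutoff R x) * W g x) \<le> C * (A * l2norm g)"
      using A(2)[OF DI[OF g] fsol[OF g]] C(1) by (intro mult_left_mono) auto
    then show ?thesis unfolding T using C(2)[OF DI[OF g] sol[OF g]] by auto
  qed
  moreover have "\<exists>r :: nat \<Rightarrow> nat. strict_mono r \<and>
      (\<forall>\<epsilon>>0. \<exists>N. \<forall>m\<ge>N. \<forall>n\<ge>N. l2norm (\<lambda>x. T (gs (r m)) x - T (gs (r n)) x) < \<epsilon>)"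
    if gs: "\<And>n. gs n \<in> D" "\<And>n. l2norm (gs n) \<le> 1" for gs :: "nat \<Rightarrow> fn"
  proof -
    let ?\<chi> = "\<lambda>x. complex_of_real (cutoff (R + 1) x)"
    note HW = free_sol_H1[OF fsol[OF gs(1)]]
    obtain B where B: "C1_bounded B ?\<chi>" using cutoff_C1_bounded[OF R(2)] by blast
    obtain r where r: "strict_mono (r :: nat \<Rightarrow> nat)"
      "\<And>e. 0 < e \<Longrightarrow> \<exists>N. \<forall>m\<ge>N. \<forall>n\<ge>N. l2norm (\<lambda>x. ?\<chi> x * W (gs (r m)) x - ?\<chi> x * W (gs (r n)) x) < e"
    proof -
      have "\<exists>r. strict_mono (r :: nat \<Rightarrow> nat) \<and>
          (\<forall>e>0. \<exists>N. \<forall>m\<ge>N. \<forall>n\<ge>N. l2norm (\<lambda>x. ?\<chi> x * W (gs (r m)) x - ?\<chi> x * W (gs (r n)) x) < e)"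
      proof (rule Rellich[where C=A' and R="R + 2"])
        show "h1norm (\<lambda>x. ?\<chi> x * W (gs n) x) \<le> A'" for n
          using A'(2)[OF DI[OF gs(1)] fsol[OF gs(1)], of n] mult_left_mono[OF gs(2)[of n] A'(1)] by linarith
        show "?\<chi> x * W (gs n) x = 0" if "R + 2 < norm x" for n x using that R by (simp add: cutoff_eq_0)
      qed (use R in \<open>auto intro: H1_mult[OF B] HW\<close>)
      then show ?thesis using that by blast
    qed
    have "\<exists>N. \<forall>m\<ge>N. \<forall>n\<ge>N. l2norm (\<lambda>x. T (gs (r m)) x - T (gs (r n)) x) < \<epsilon>" if \<epsilon>: "0 < \<epsilon>" for \<epsilon>
    proof -
      \<comment> \<open>Data of norm at most 1 differ by at most 2, so the squared energy of a
        difference will be at most 2 A \<delta>, below (2 A + 1) \<delta> = (\<epsilon> / (C +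
        1))^2.\<close>
      define \<delta> where "\<delta> = (\<epsilon> / (C + 1))\<^sup>2 / (2 * A + 1)"
      have \<delta>: "0 < \<delta>" using \<epsilon> C(1) A(1) by (simp add: \<delta>_def)
      obtain N where N: "\<And>m n. N \<le> m \<Longrightarrow> N \<le> n \<Longrightarrow>
          l2norm (\<lambda>x. ?\<chi> x * W (gs (r m)) x - ?\<chi> x * W (gs (r n)) x) < \<delta>"
        using r(2)[OF \<delta>] by blast
      have "l2norm (\<lambda>x. T (gs (r m)) x - T (gs (r n)) x) < \<epsilon>" if mn: "N \<le> m" "N \<le> n" for m n
      proof -
        let ?g = "gs (r m)" and ?h = "gs (r n)"
        let ?d = "\<lambda>x. ?g x - ?h x" and ?u = "\<lambda>x. U ?g x - U ?h x" and ?w = "\<lambda>x. W ?g x - W ?h x"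
        let ?H = "h1norm (\<lambda>x. complex_of_real (cutoff R x) * ?w x)"
        have fd: "f ?d = (\<lambda>x. f ?g x - f ?h x)" by (simp add: f_def right_diff_distrib)
        have Ld: "L2 ?d" "L2 (f ?d)" unfolding fd by (intro L2_diff DI gs)+
        have od: "obstacle_sol (- K) (f ?d) ?u ?w"
          unfolding fd by (intro obstacle_sol_diff DI gs sol)
        then have fsd: "free_sol (f ?d) ?w" by (simp add: obstacle_sol_def)
        have "(\<lambda>x. T ?g x - T ?h x) = f (\<lambda>x. ?u x - ?w x)" unfolding T by (auto simp: f_def algebra_simps)
        then have le: "l2norm (\<lambda>x. T ?g x - T ?h x) \<le> C * ?H" using C(2)[OF Ld od] by simp
        have "l2norm ?d \<le> 2"
          using l2norm_triangle_diff[OF DI(1)[OF gs(1)] DI(1)[OF gs(1)], of "r m" "r n"] gs(2)[of "r m"] gs(2)[of "r n"] by linarith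
        moreover have "loc_norm (R + 1) ?w < \<delta>"
        proof -
          have L: "L2 (\<lambda>x. ?\<chi> x * W ?g x - ?\<chi> x * W ?h x)" by (intro L2_diff H1_L2 H1_mult[OF B] HW)
          have "loc_norm (R + 1) ?w \<le> 1 * l2norm (\<lambda>x. ?\<chi> x * W ?g x - ?\<chi> x * W ?h x)"
            by (rule loc_norm_le[OF H1_L2[OF free_sol_H1[OF fsd]] L]) (auto simp: cutoff_eq_1)
          then show ?thesis using N[OF mn] by simp
        qed
        ultimately have "A * l2norm ?d * loc_norm (R + 1) ?w \<le> A * 2 * \<delta>"
          using A(1) l2norm_nonneg by (intro mult_mono mult_left_mono) (auto simp: loc_norm_def mult_nonneg_nonneg)
        then have "?H\<^sup>2 \<le> A * 2 * \<delta>" using A(2)[OF Ld fsd] by linarith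
        also have "\<dots> < (2 * A + 1) * \<delta>" using \<delta> by (simp add: algebra_simps)
        also have "\<dots> = (\<epsilon> / (C + 1))\<^sup>2" unfolding \<delta>_def using A(1) by simp
        finally have "?H < \<epsilon> / (C + 1)" using \<epsilon> C(1) by (intro power2_less_imp_less[of ?H]) auto
        then have "(C + 1) * ?H < \<epsilon>" using C(1) by (simp add: field_simps)
        then show ?thesis using le h1norm_nonneg[of "\<lambda>x. complex_of_real (cutoff R x) * ?w x"] by (simp add: algebra_simps)
      qed
      then show ?thesis by blast
    qed
    then show ?thesis using r(1) by blast
  qed
  moreover have "l2inner (T g) h = l2inner g (T h)" if g: "g \<in> D" and h: "h \<in> D" for g h
  proof -
    have "l2inner (T g) h = l2inner (\<lambda>x. U g x - W g x) (f h)"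
      by (simp add: l2inner_def T f_def mult_ac)
    also have "\<dots> = l2inner (f g) (\<lambda>x. U h x - W h x)"
      by (rule resolvent_difference_symmetric[OF DI(2)[OF g] DI(2)[OF h] sol[OF g] sol[OF h]])
    also have "\<dots> = l2inner g (T h)" by (simp add: l2inner_def T f_def mult_ac)
    finally show ?thesis .
  qed
  ultimately show ?thesis by blast
qed

end
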